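(* Let $\vec c=(c_1,\dots,c_k)$ be a composition of $n$ with $c_k>0$, and let $B$ be the border strip of $\vec c$. Then the top homology group $\widetilde H_{k-2}(\Delta(\Pi^\bullet_{\vec c}-\{\hat 1\}))$ is isomorphic to the Specht module $S^B$ as $\mathfrak S_n$-modules.
   Context: A pointed set partition of $[n]$ is $\{B_1,\dots,B_k,\underline Z\}$ where $Z\subseteq[n]$ (possibly empty, the pointed block) and $B_1,\dots,B_k$ are nonempty blocks partitioning $[n]\setminus Z$. $\Pi^\bullet_n$ is the poset of these with $\pi\le\pi'$ iff each non-pointed block of $\pi$ lies in some block of $\pi'$ and the pointed block of $\pi$ lies in the pointed block of $\pi'$; its type is the multiset $\{|B_1|,\dots,|B_k|\}$ with pointed number $|Z|$. A pointed composition of $n$ is $(c_1,\dots,c_k)$ with $c_1,\dots,c_{k-1}\ge1$, $c_k\ge0$, sum $n$, ordered by $\vec c\le\vec d$ iff $\vec d$ is obtained from $\vec c$ by replacing runs of consecutive entries by their sums; its type is the multiset $\{c_1,\dots,c_{k-1}\}$ with pointed number $c_k$. $\Pi^\bullet_{\vec c}$ is the induced subposet of $\Pi^\bullet_n$ of all $\pi$ with $\operatorname{type}(\pi)=\operatorname{type}(\vec d)$ for some $\vec d\ge\vec c$; $\hat 1=\{\underline{[n]}\}$; $\Delta(P)$ is the order complex; $\mathfrak S_n$ acts by relabeling; homology is reduced with coefficients in a fixed field. The border strip $B$ of $\vec c$ is the connected skew shape with no $2\times2$ square having $k$ rows, the $i$-th row from the bottom having $c_i$ boxes. A tableau of shape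 $B$ is a bijective filling of its boxes by $[n]$; a tabloid is an equivalence class of tableaux modulo permuting entries within rows; $M^B$ is spanned by tabloids; for a tableau $t$ with column stabilizer $C_t$, ${\bf e}_t=\sum_{\gamma\in C_t}\operatorname{sign}(\gamma)\gamma\{t\}$; the Specht module $S^B$ is the span of all ${\bf e}_t$. *)

theory Defs
  imports
    Complex_Main
    "HOL-Algebra.Sym_Groups"
    "HOL-Algebra.AbelCoset"
    "HOL-Algebra.Module"
    "HOL-Library.Function_Algebras"
    "HOL-Library.Disjoint_Sets"
    "HOL-Library.FuncSet"
    "HOL-Library.Multiset"
begin

section \<open>Linear representations of a group\<close>

text \<open>
  A G-module over a field \<open>'k\<close> is a vector space together with an action of the group \<open>G\<close>.
  The scalars are all of the type \<open>'k\<close>; the components \<^const>\<open>monoid.mult\<close> and \<^const>\<open>one\<close>, which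
  the record of modules inherits from rings, carry no meaning.
\<close>

record ('g, 'k, 'v) gmodule = "('k, 'v) module" +
  gact :: "'g \<Rightarrow> 'v \<Rightarrow> 'v"

definition gmodule_hom ::
  "('g, 'm) monoid_scheme \<Rightarrow> ('g, 'k, 'v) gmodule \<Rightarrow> ('g, 'k, 'w) gmodule \<Rightarrow> ('v \<Rightarrow> 'w) set"
  where "gmodule_hom G M N =
    {\<phi> \<in> hom (add_monoid M) (add_monoid N).
      (\<forall>a. \<forall>x\<in>carrier M. \<phi> (a \<odot>\<^bsub>M\<^esub> x) = a \<odot>\<^bsub>N\<^esub> \<phi> x) \<and>
      (\<forall>g\<in>carrier G. \<forall>x\<in>carrier M. \<phi> (gact M g x) = gact N g (\<phi> x))}"

definition gmodule_isomorphic ::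
  "('g, 'm) monoid_scheme \<Rightarrow> ('g, 'k, 'v) gmodule \<Rightarrow> ('g, 'k, 'w) gmodule \<Rightarrow> bool"
  where "gmodule_isomorphic G M N \<longleftrightarrow>
    (\<exists>\<phi> \<in> gmodule_hom G M N. bij_betw \<phi> (carrier M) (carrier N))"

text \<open>
  The quotient of \<open>M\<close> by an invariant subspace \<open>N\<close>, with the cosets of \<open>N\<close> as elements.
  The union over all representatives makes \<open>0\<close> times a coset equal to \<open>N\<close> and not to \<open>{0}\<close>.
\<close>

definition gmodule_quot :: "('g, 'k, 'v) gmodule \<Rightarrow> 'v set \<Rightarrow> ('g, 'k, 'v set) gmodule"
  where "gmodule_quot M N =
    \<lparr>carrier = a_rcosets\<^bsub>M\<^esub> N, monoid.mult = undefined, one = undefined,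
     zero = N, add = set_add M,
     smult = (\<lambda>a C. \<Union>x\<in>C. N +>\<^bsub>M\<^esub> (a \<odot>\<^bsub>M\<^esub> x)),
     gact = (\<lambda>g C. \<Union>x\<in>C. N +>\<^bsub>M\<^esub> gact M g x)\<rparr>"

subsection \<open>Spaces of functions and free vector spaces\<close>

definition fscale :: "'k::field \<Rightarrow> ('x \<Rightarrow> 'k) \<Rightarrow> 'x \<Rightarrow> 'k"
  where "fscale a f = (\<lambda>x. a * f x)"

interpretation fun_space: vector_space fscale
  by unfold_locales (auto simp: fscale_def fun_eq_iff algebra_simps)

definition free_space :: "'x set \<Rightarrow> ('x \<Rightarrow> 'k::field) set"
  where "free_space A = {f. finite {x. f x \<noteq> 0} \<and> {x. f x \<noteq> 0} \<subseteq> A}"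

definition basis_vec :: "'x \<Rightarrow> 'x \<Rightarrow> 'k::field"
  where "basis_vec x = (\<lambda>y. if y = x then 1 else 0)"

text \<open>The linear map on finitely supported functions sending \<open>basis_vec x\<close> to \<open>T x\<close>.\<close>

definition lin_ext :: "('x \<Rightarrow> 'y \<Rightarrow> 'k::field) \<Rightarrow> ('x \<Rightarrow> 'k) \<Rightarrow> 'y \<Rightarrow> 'k"
  where "lin_ext T f = (\<Sum>x | f x \<noteq> 0. fscale (f x) (T x))"

text \<open>
  A space \<open>V\<close> of functions on \<open>'x\<close> on which the group acts through an action \<open>\<alpha>\<close> on
  the basis \<open>'x\<close>.
\<close>

definition perm_gmodule ::
  "('g \<Rightarrow> 'x \<Rightarrow> 'x) \<Rightarrow> ('x \<Rightarrow> 'k) set \<Rightarrow> ('g, 'k::field, 'x \<Rightarrow> 'k) gmodule"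
  where "perm_gmodule \<alpha> V =
    \<lparr>carrier = V, monoid.mult = undefined, one = undefined, zero = 0, add = (+),
     smult = fscale, gact = (\<lambda>g. lin_ext (\<lambda>x. basis_vec (\<alpha> g x)))\<rparr>"


section \<open>Order complexes and reduced simplicial homology\<close>

definition order_complex :: "'a set \<Rightarrow> ('a \<Rightarrow> 'a \<Rightarrow> bool) \<Rightarrow> 'a set set"
  where "order_complex P r =
    {C. finite C \<and> C \<subseteq> P \<and> (\<forall>x\<in>C. \<forall>y\<in>C. r x y \<or> r y x)}"

text \<open>
  Simplices are oriented by listing their vertices increasingly with respect to a relation
  \<open>r\<close> which linearly orders every simplex of \<open>K\<close>. The empty simplex, of dimension \<open>-1\<close>,
  is included, so that the homology below is reduced.
\<close>

definition simplices :: "'a set set \<Rightarrow> ('a \<Rightarrow> 'a \<Rightarrow> bool) \<Rightarrow> int \<Rightarrow> 'a list set"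
  where "simplices K r d =
    {xs. set xs \<in> K \<and> sorted_wrt (\<lambda>x y. r x y \<and> x \<noteq> y) xs \<and> int (length xs) = d + 1}"

definition boundary :: "('a list \<Rightarrow> 'k::field) \<Rightarrow> 'a list \<Rightarrow> 'k"
  where "boundary = lin_ext (\<lambda>xs. \<Sum>i<length xs.
    fscale ((-1) ^ i) (basis_vec (take i xs @ drop (Suc i) xs)))"

definition cycles :: "'a set set \<Rightarrow> ('a \<Rightarrow> 'a \<Rightarrow> bool) \<Rightarrow> int \<Rightarrow> ('a list \<Rightarrow> 'k::field) set"
  where "cycles K r d = {z \<in> free_space (simplices K r d). boundary z = 0}"

definition boundaries :: "'a set set \<Rightarrow> ('a \<Rightarrow> 'a \<Rightarrow> bool) \<Rightarrow> int \<Rightarrow> ('a list \<Rightarrow> 'k::field) set"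
  where "boundaries K r d = boundary ` free_space (simplices K r (d + 1))"

text \<open>
  The reduced homology with coefficients in \<open>'k\<close>, as a G-module: \<open>\<alpha>\<close> is an action of the
  group on the vertices by automorphisms of \<open>K\<close> that respect \<open>r\<close>.
\<close>

definition reduced_homology ::
  "'a set set \<Rightarrow> ('a \<Rightarrow> 'a \<Rightarrow> bool) \<Rightarrow> ('g \<Rightarrow> 'a \<Rightarrow> 'a) \<Rightarrow> int
    \<Rightarrow> ('g, 'k::field, ('a list \<Rightarrow> 'k) set) gmodule"
  where "reduced_homology K r \<alpha> d =
    gmodule_quot (perm_gmodule (\<lambda>g. map (\<alpha> g)) (cycles K r d)) (boundaries K r d)"


section \<open>Pointed compositions and pointed set partitions\<close>

definition pointed_composition :: "nat \<Rightarrow> nat list \<Rightarrow> bool"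
  where "pointed_composition n c \<longleftrightarrow>
    c \<noteq> [] \<and> (\<forall>x\<in>set (butlast c). 1 \<le> x) \<and> sum_list c = n"

definition composition_le :: "nat list \<Rightarrow> nat list \<Rightarrow> bool"
  where "composition_le c d \<longleftrightarrow>
    (\<exists>runs. [] \<notin> set runs \<and> concat runs = c \<and> map sum_list runs = d)"

definition composition_type :: "nat list \<Rightarrow> nat multiset \<times> nat"
  where "composition_type c = (mset (butlast c), last c)"

text \<open>
  The pair \<open>(P, Z)\<close> stands for the pointed set partition with set \<open>P\<close> of non-pointed blocks
  and pointed block \<open>Z\<close>.
\<close>

type_synonym pointed_partition = "nat set set \<times> nat set"

definition pointed_partitions :: "nat \<Rightarrow> pointed_partition set"
  where "pointed_partitions n = {(P, Z). Z \<subseteq> {1..n} \<and> partition_on ({1..n} - Z) P}"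

definition pp_le :: "pointed_partition \<Rightarrow> pointed_partition \<Rightarrow> bool"
  where "pp_le = (\<lambda>(P, Z) (P', Z').
    (\<forall>b\<in>P. \<exists>b'\<in>insert Z' P'. b \<subseteq> b') \<and> Z \<subseteq> Z')"

definition pp_type :: "pointed_partition \<Rightarrow> nat multiset \<times> nat"
  where "pp_type = (\<lambda>(P, Z). (image_mset card (mset_set P), card Z))"

definition pp_top :: "nat \<Rightarrow> pointed_partition"
  where "pp_top n = ({}, {1..n})"

definition pp_act :: "(nat \<Rightarrow> nat) \<Rightarrow> pointed_partition \<Rightarrow> pointed_partition"
  where "pp_act \<sigma> = (\<lambda>(P, Z). ((`) \<sigma> ` P, \<sigma> ` Z))"

definition restricted_partitions :: "nat \<Rightarrow> nat list \<Rightarrow> pointed_partition set"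
  where "restricted_partitions n c =
    {\<pi> \<in> pointed_partitions n.
      \<exists>d. pointed_composition n d \<and> composition_le c d \<and> pp_type \<pi> = composition_type d}"


section \<open>Border strips and Specht modules\<close>

text \<open>The box \<open>(i, j)\<close> lies in row \<open>i\<close>, counted from the top, and in column \<open>j\<close>.\<close>

type_synonym box = "nat \<times> nat"

definition partition_shape :: "(nat \<Rightarrow> nat) \<Rightarrow> bool"
  where "partition_shape \<kappa> \<longleftrightarrow> antimono \<kappa> \<and> finite {i. \<kappa> i \<noteq> 0}"

definition skew_shape :: "box set \<Rightarrow> bool"
  where "skew_shape B \<longleftrightarrow>
    (\<exists>\<kappa> \<mu>. partition_shape \<kappa> \<and> partition_shape \<mu> \<and> (\<forall>i. \<mu> i \<le> \<kappa> i) \<and>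
      B = {(i, j). \<mu> i \<le> j \<and> j < \<kappa> i})"

definition adjacent_boxes :: "(box \<times> box) set"
  where "adjacent_boxes = {((i, j), (i', j')).
    i = i' \<and> (j' = Suc j \<or> j = Suc j') \<or> j = j' \<and> (i' = Suc i \<or> i = Suc i')}"

definition connected_shape :: "box set \<Rightarrow> bool"
  where "connected_shape B \<longleftrightarrow> (\<forall>x\<in>B. \<forall>y\<in>B. (x, y) \<in> (adjacent_boxes \<inter> B \<times> B)\<^sup>*)"

text \<open>
  The row count pins the strip down vertically (its rows are \<open>0, \<dots>, k - 1\<close>), so that
  \<open>B\<close> is determined by \<open>c\<close> up to a horizontal translation.
\<close>

definition border_strip_of :: "nat list \<Rightarrow> box set \<Rightarrow> bool"
  where "border_strip_of c B \<longleftrightarrow>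
    skew_shape B \<and> connected_shape B \<and>
    \<not> (\<exists>i j. {(i, j), (i, Suc j), (Suc i, j), (Suc i, Suc j)} \<subseteq> B) \<and>
    fst ` B = {..<length c} \<and>
    (\<forall>i<length c. card {j. (length c - 1 - i, j) \<in> B} = c ! i)"

definition tableaux :: "box set \<Rightarrow> nat \<Rightarrow> (box \<Rightarrow> nat) set"
  where "tableaux B n = {t \<in> extensional B. bij_betw t B {1..n}}"

definition row_equiv :: "box set \<Rightarrow> nat \<Rightarrow> ((box \<Rightarrow> nat) \<times> (box \<Rightarrow> nat)) set"
  where "row_equiv B n = {(t, t'). t \<in> tableaux B n \<and> t' \<in> tableaux B n \<and>
    (\<exists>\<rho>. \<rho> permutes B \<and> (\<forall>x\<in>B. fst (\<rho> x) = fst x) \<and> t' = t \<circ> \<rho>)}"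

definition tabloids :: "box set \<Rightarrow> nat \<Rightarrow> (box \<Rightarrow> nat) set set"
  where "tabloids B n = tableaux B n // row_equiv B n"

definition tabloid :: "box set \<Rightarrow> nat \<Rightarrow> (box \<Rightarrow> nat) \<Rightarrow> (box \<Rightarrow> nat) set"
  where "tabloid B n t = row_equiv B n `` {t}"

definition tabloid_act :: "box set \<Rightarrow> (nat \<Rightarrow> nat) \<Rightarrow> (box \<Rightarrow> nat) set \<Rightarrow> (box \<Rightarrow> nat) set"
  where "tabloid_act B \<sigma> T = (\<lambda>t. restrict (\<sigma> \<circ> t) B) ` T"

definition tabloid_gmodule ::
  "box set \<Rightarrow> nat \<Rightarrow> (nat \<Rightarrow> nat, 'k::field, (box \<Rightarrow> nat) set \<Rightarrow> 'k) gmodule"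
  where "tabloid_gmodule B n = perm_gmodule (tabloid_act B) (free_space (tabloids B n))"

definition column_stabilizer :: "box set \<Rightarrow> nat \<Rightarrow> (box \<Rightarrow> nat) \<Rightarrow> (nat \<Rightarrow> nat) set"
  where "column_stabilizer B n t =
    {\<gamma>. \<gamma> permutes {1..n} \<and> (\<forall>j. \<gamma> ` t ` {x \<in> B. snd x = j} = t ` {x \<in> B. snd x = j})}"

definition polytabloid :: "box set \<Rightarrow> nat \<Rightarrow> (box \<Rightarrow> nat) \<Rightarrow> (box \<Rightarrow> nat) set \<Rightarrow> 'k::field"
  where "polytabloid B n t = (\<Sum>\<gamma>\<in>column_stabilizer B n t.
    fscale (of_int (sign \<gamma>)) (basis_vec (tabloid_act B \<gamma> (tabloid B n t))))"

definition specht_module ::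
  "box set \<Rightarrow> nat \<Rightarrow> (nat \<Rightarrow> nat, 'k::field, (box \<Rightarrow> nat) set \<Rightarrow> 'k) gmodule"
  where "specht_module B n =
    tabloid_gmodule B n\<lparr>carrier := fun_space.span (polytabloid B n ` tableaux B n)\<rparr>"

text \<open>Every composition with positive parts has a border strip.\<close>

lemma border_strip_exists:
  assumes "c \<noteq> []" and pos: "\<forall>x\<in>set c. 1 \<le> x"
  shows "\<exists>B. border_strip_of c B"
proof -
  define k where "k = length c"
  define s where "s i = (\<Sum>j<i. c ! j - 1)" for i
  define \<mu> where "\<mu> r = (if r < k then s (k - 1 - r) else 0)" for r
  define \<kappa> where "\<kappa> r = (if r < k then s (k - 1 - r) + c ! (k - 1 - r) else 0)" for r
  define B where "B = {(i, j). \<mu> i \<le> j \<and> j < \<kappa> i}"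
  have cp: "c ! i \<ge> 1" if "i < k" for i
    using pos that by (auto simp: k_def)
  have s_Suc: "s (Suc i) = s i + (c ! i - 1)" for i
    by (simp add: s_def)
  have s_mono: "s i \<le> s j" if "i \<le> j" for i j
    using that by (auto simp: s_def intro: sum_mono2)
  have \<kappa>_Suc: "\<kappa> r = Suc (s (k - r))" if "r < k" for r
    using cp[of "k - 1 - r"] that s_Suc[of "k - 1 - r"]
    by (simp add: \<kappa>_def Suc_diff_Suc)
  have \<mu>_Suc: "\<mu> r = s (k - 1 - r)" if "r < k" for r
    using that by (simp add: \<mu>_def)
  have le_mu: "\<mu> i \<le> \<kappa> i" for i by (simp add: \<mu>_def \<kappa>_def)
  have sk: "skew_shape B"
    unfolding skew_shape_def
  proof (intro exI conjI)
    show "partition_shape \<kappa>" unfolding partition_shape_def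
    proof
      show "antimono \<kappa>"
      proof (rule antimonoI)
        fix x y :: nat assume "x \<le> y"
        then show "\<kappa> y \<le> \<kappa> x"
          by (cases "y < k") (auto simp: \<kappa>_Suc s_mono, simp add: \<kappa>_def)
      qed
      show "finite {i. \<kappa> i \<noteq> 0}"
        by (rule finite_subset[of _ "{..<k}"]) (auto simp: \<kappa>_def split: if_splits)
    qed
    show "partition_shape \<mu>" unfolding partition_shape_def
    proof
      show "antimono \<mu>"
        by (rule antimonoI) (auto simp: \<mu>_def s_mono)
      show "finite {i. \<mu> i \<noteq> 0}"
        by (rule finite_subset[of _ "{..<k}"]) (auto simp: \<mu>_def split: if_splits)
    qed
  qed (use le_mu in \<open>auto simp: B_def\<close>)
  have B_iff: "(i, j) \<in> B \<longleftrightarrow> i < k \<and> s (k - 1 - i) \<le> j \<and> j \<le> s (k - i)" for i j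
  proof (cases "i < k")
    case True
    then show ?thesis by (auto simp: B_def \<mu>_Suc \<kappa>_Suc less_Suc_eq_le)
  next
    case False
    then show ?thesis by (simp add: B_def \<kappa>_def)
  qed
  define R where "R = (adjacent_boxes \<inter> B \<times> B)\<^sup>*"
  have symR: "sym R"
    unfolding R_def by (rule sym_rtrancl) (auto simp: sym_def adjacent_boxes_def)
  have row: "((i, j), (i, j + m)) \<in> R" if "(i, j) \<in> B" "(i, j + m) \<in> B" for i j m
    using that(2)
  proof (induction m)
    case 0
    then show ?case by (simp add: R_def)
  next
    case (Suc m)
    then have "(i, j + m) \<in> B" using that(1) by (auto simp: B_iff)
    then have "((i, j), (i, j + m)) \<in> R" using Suc by simp
    moreover have "((i, j + m), (i, j + Suc m)) \<in> adjacent_boxes \<inter> B \<times> B"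
      using Suc.prems \<open>(i, j + m) \<in> B\<close> by (auto simp: adjacent_boxes_def)
    ultimately show ?case unfolding R_def by (rule rtrancl_into_rtrancl)
  qed
  have last: "((i, j), (i, s (k - i))) \<in> R" if "(i, j) \<in> B" for i j
  proof -
    have "(i, j + (s (k - i) - j)) \<in> B" using that s_mono[of "k - 1 - i" "k - i"] by (auto simp: B_iff)
    from row[OF that this] show ?thesis using that by (simp add: B_iff)
  qed
  have step: "((Suc i, s (k - Suc i)), (i, s (k - i))) \<in> R" if "Suc i < k" for i
  proof -
    have B1: "(Suc i, s (k - Suc i)) \<in> B" "(i, s (k - Suc i)) \<in> B"
      using that by (auto simp: B_iff intro!: s_mono)
    then have "((Suc i, s (k - Suc i)), (i, s (k - Suc i))) \<in> R"
      unfolding R_def by (intro r_into_rtrancl) (auto simp: adjacent_boxes_def)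
    with last[OF B1(2)] show ?thesis unfolding R_def by (meson rtrancl_trans)
  qed
  have top: "((i, s (k - i)), (0, s k)) \<in> R" if "i < k" for i
    using that
  proof (induction i)
    case 0
    then show ?case by (simp add: R_def)
  next
    case (Suc i)
    then show ?case using step[of i] unfolding R_def by (auto intro: rtrancl_trans)
  qed
  have to_top: "(x, (0, s k)) \<in> R" if "x \<in> B" for x
  proof -
    obtain i j where x: "x = (i, j)" by (cases x)
    with that have "i < k" by (auto simp: B_iff)
    from last[of i j] top[OF this] that x show ?thesis
      unfolding R_def by (auto intro: rtrancl_trans)
  qed
  have conn: "connected_shape B"
    unfolding connected_shape_def R_def[symmetric]
  proof (intro ballI)
    fix x y assume "x \<in> B" "y \<in> B"
    then have "(x, (0, s k)) \<in> R" "((0, s k), y) \<in> R"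
      using to_top symD[OF symR to_top] by blast+
    then show "(x, y) \<in> R" unfolding R_def by (rule rtrancl_trans)
  qed
  have sq: "\<not> (\<exists>i j. {(i, j), (i, Suc j), (Suc i, j), (Suc i, Suc j)} \<subseteq> B)"
    by (auto simp: B_iff)
  have rows: "fst ` B = {..<k}"
  proof (intro equalityI subsetI)
    fix i assume "i \<in> {..<k}"
    then have "(i, s (k - i)) \<in> B" by (auto simp: B_iff intro!: s_mono)
    then show "i \<in> fst ` B" by (metis fst_conv imageI)
  qed (auto simp: B_iff)
  have cards: "card {j. (k - 1 - i, j) \<in> B} = c ! i" if "i < k" for i
  proof -
    have "{j. (k - 1 - i, j) \<in> B} = {s i ..< s i + c ! i}"
      using that by (auto simp: B_def \<mu>_def \<kappa>_def)
    then show ?thesis by simp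
  qed
  show ?thesis
    unfolding border_strip_of_def using sk conn sq rows cards
    by (intro exI[of _ B]) (auto simp: k_def)
qed

end

theory Submission
  imports Defs
begin

text \<open>
  Sending a pointed partition to its pointed block maps the poset without its top to the poset of proper
  subsets of \<open>[n]\<close> whose sizes are sums of final segments of \<open>c\<close>. This map \<open>p\<close> is a homotopy equivalence:
  a chain \<open>Z\<^sub>0 \<subset> \<dots> \<subset> Z\<^sub>m\<close> of subsets determines the pointed partition with blocks \<open>Z\<^sub>1 - Z\<^sub>0, \<dots>, [n] - Z\<^sub>m\<close>
  and pointed block \<open>Z\<^sub>0\<close>, which together with barycentric subdivision yields a chain map \<open>s\<close> with \<open>p s = 1\<close>,
  and \<open>s p\<close> is homotopic to the identity because both carry a chain into the cone above its least element.
  In top degree cycles are homology classes, so \<open>p\<close> restricts to an equivariant isomorphism of top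
  cycles. The maximal chains of subsets are the tabloids of shape \<open>B\<close>, polytabloids are cycles since
  consecutive rows of \<open>B\<close> share a column, and a straightening argument shows that they span all top
  cycles: a tabloid of least weight in the support of a cycle comes from a tableau with increasing
  columns, whose polytabloid has this tabloid as its unique term of least weight.
\<close>

section \<open>Linear maps on finitely supported functions\<close>

text \<open>Write k for \<open>length c\<close>. The number of non-pointed blocks drops strictly
  along a chain of proper partitions and stays between \<open>1\<close> and \<open>k - 1\<close>, so
  no chain has \<open>k\<close> elements and there are no top boundaries. The homotopy sends chains
  with \<open>k - 1\<close> elements to chains with \<open>k\<close> elements, hence is
  \<open>0\<close> there, and \<open>s p = 1\<close> holds exactly on top cycles. So
  \<open>p\<close> is bijective on cycles, and only \<open>p\<close> has to be equivariant. The
  obstacle is that \<open>p\<close> is only weakly monotone: collapsed chains must go to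
  \<open>0\<close>. Building projection, subdivision and homotopy all from cones over least vertices
  reduces their identities to inductions on chains. Positive parts make the tail sums of
  \<open>c\<close> distinct. Hence a face of a maximal flag remembers which set was removed, and the
  cycle condition splits into separate equations, one for each face. The coefficient field is
  arbitrary, so signs cancel by pairing terms and leading coefficients are \<open>1\<close>.\<close>

lemma fscale_apply [simp]: "fscale a f x = a * f x"
  by (simp add: fscale_def)

lemma sum_apply: "(\<Sum>i\<in>I. F i) x = (\<Sum>i\<in>I. F i x)" for F :: "'i \<Rightarrow> 'x \<Rightarrow> 'k::field"
  by (induction I rule: infinite_finite_induct) auto

lemma basis_vec_apply: "basis_vec x y = (if y = x then 1 else 0)"
  by (simp add: basis_vec_def)

lemma subspace_free_space: "fun_space.subspace (free_space A :: ('x \<Rightarrow> 'k::field) set)"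
  unfolding fun_space.subspace_def
proof (intro conjI ballI allI)
  show "0 \<in> (free_space A :: ('x \<Rightarrow> 'k) set)"
    by (simp add: free_space_def)
next
  fix f g :: "'x \<Rightarrow> 'k"
  assume fg: "f \<in> free_space A" "g \<in> free_space A"
  have s: "{x. (f + g) x \<noteq> 0} \<subseteq> {x. f x \<noteq> 0} \<union> {x. g x \<noteq> 0}" by auto
  have "finite {x. (f + g) x \<noteq> 0}"
    using fg by (intro finite_subset[OF s]) (simp add: free_space_def)
  moreover have "{x. (f + g) x \<noteq> 0} \<subseteq> A"
    using fg s unfolding free_space_def by blast
  ultimately show "f + g \<in> free_space A"
    by (simp only: free_space_def mem_Collect_eq)
next
  fix a and f :: "'x \<Rightarrow> 'k"
  assume f: "f \<in> free_space A"
  have s: "{x. fscale a f x \<noteq> 0} \<subseteq> {x. f x \<noteq> 0}" by auto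
  have "finite {x. fscale a f x \<noteq> 0}"
    using f by (intro finite_subset[OF s]) (simp add: free_space_def)
  moreover have "{x. fscale a f x \<noteq> 0} \<subseteq> A"
    using f s unfolding free_space_def by blast
  ultimately show "fscale a f \<in> free_space A"
    by (simp only: free_space_def mem_Collect_eq)
qed

lemmas free_space_zero [simp] = fun_space.subspace_0[OF subspace_free_space]
lemmas free_space_add = fun_space.subspace_add[OF subspace_free_space]
lemmas free_space_diff = fun_space.subspace_diff[OF subspace_free_space]
lemmas free_space_scale = fun_space.subspace_scale[OF subspace_free_space]
lemmas free_space_sum = fun_space.subspace_sum[OF subspace_free_space]

lemma free_space_basis: "x \<in> A \<Longrightarrow> basis_vec x \<in> free_space A"
proof -
  assume "x \<in> A"
  moreover have "{y. (basis_vec x y :: 'b) \<noteq> 0} = {x}" by (auto simp: basis_vec_def)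
  ultimately show ?thesis by (simp add: free_space_def)
qed

lemma free_space_mono: "f \<in> free_space A \<Longrightarrow> A \<subseteq> B \<Longrightarrow> f \<in> free_space B"
  by (auto simp: free_space_def)

lemma free_space_UNIV: "f \<in> free_space A \<Longrightarrow> f \<in> free_space UNIV"
  by (erule free_space_mono) simp

lemma free_space_finite: "f \<in> free_space A \<Longrightarrow> finite {x. f x \<noteq> 0}"
  by (simp add: free_space_def)

lemma free_space_support: "f \<in> free_space A \<Longrightarrow> f x \<noteq> 0 \<Longrightarrow> x \<in> A"
  by (auto simp: free_space_def)

lemma free_space_empty [simp]: "free_space {} = {0}"
  by (auto simp: free_space_def)

text \<open>The supports of \<open>f\<close>, \<open>g\<close> and \<open>f + g\<close> differ; a
  common finite index set makes the three sums comparable.\<close>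

lemma lin_ext_superset:
  assumes "finite S" "{x. f x \<noteq> 0} \<subseteq> S"
  shows "lin_ext T f = (\<Sum>x\<in>S. fscale (f x) (T x))"
  unfolding lin_ext_def using assms by (intro sum.mono_neutral_left) auto

lemma lin_ext_zero [simp]: "lin_ext T 0 = 0"
  by (simp add: lin_ext_def)

lemma lin_ext_basis [simp]: "lin_ext T (basis_vec x) = T x"
proof -
  have "{y. (basis_vec x y :: 'b) \<noteq> 0} = {x}" by (auto simp: basis_vec_def)
  then show ?thesis by (simp add: lin_ext_def basis_vec_apply)
qed

lemma lin_ext_add:
  assumes "f \<in> free_space UNIV" "g \<in> free_space UNIV"
  shows "lin_ext T (f + g) = lin_ext T f + lin_ext T g"
proof -
  let ?S = "{x. f x \<noteq> 0} \<union> {x. g x \<noteq> 0}"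
  have fin: "finite ?S" using assms by (auto simp: free_space_def)
  have "lin_ext T (f + g) = (\<Sum>x\<in>?S. fscale ((f + g) x) (T x))"
    using fin by (rule lin_ext_superset) auto
  moreover have "lin_ext T f = (\<Sum>x\<in>?S. fscale (f x) (T x))"
    using fin by (rule lin_ext_superset) auto
  moreover have "lin_ext T g = (\<Sum>x\<in>?S. fscale (g x) (T x))"
    using fin by (rule lin_ext_superset) auto
  ultimately show ?thesis
    by (simp add: sum.distrib fun_space.scale_left_distrib)
qed

lemma lin_ext_scale: "lin_ext T (fscale a f) = fscale a (lin_ext T f)"
\<comment> \<open>Scaling by \<open>a \<noteq> 0\<close> keeps the support, over which
  \<open>lin_ext\<close> sums; scaling by \<open>0\<close> empties it.\<close>
proof (cases "a = 0")
  case True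
  then show ?thesis by (simp only: fun_space.scale_zero_left lin_ext_zero)
next
  case False
  then show ?thesis
    by (simp add: lin_ext_def fun_space.scale_sum_right)
qed

lemma lin_ext_diff:
  assumes "f \<in> free_space UNIV" "g \<in> free_space UNIV"
  shows "lin_ext T (f - g) = lin_ext T f - lin_ext T g"
proof -
  have "lin_ext T (f - g + g) = lin_ext T (f - g) + lin_ext T g"
    using assms by (intro lin_ext_add free_space_diff)
  then show ?thesis by (simp add: algebra_simps)
qed

lemma lin_ext_sum:
  assumes "\<And>i. i \<in> I \<Longrightarrow> F i \<in> free_space UNIV"
  shows "lin_ext T (\<Sum>i\<in>I. F i) = (\<Sum>i\<in>I. lin_ext T (F i))"
  using assms
  by (induction I rule: infinite_finite_induct) (auto simp: lin_ext_add free_space_sum)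

lemma lin_ext_mem:
  assumes "f \<in> free_space A" "fun_space.subspace V" "\<And>x. x \<in> A \<Longrightarrow> T x \<in> V"
  shows "lin_ext T f \<in> V"
  unfolding lin_ext_def using assms
  by (intro fun_space.subspace_sum fun_space.subspace_scale) (auto dest: free_space_support)

lemmas lin_ext_free = lin_ext_mem[OF _ subspace_free_space]

lemma lin_ext_cong:
  assumes "f \<in> free_space A" "\<And>x. x \<in> A \<Longrightarrow> S x = T x"
  shows "lin_ext S f = lin_ext T f"
  unfolding lin_ext_def using assms by (intro sum.cong) (auto dest: free_space_support)

text \<open>With \<open>lin_ext_cong\<close>, this reduces identities between composites of linear
  maps to identities on basis vectors.\<close>

lemma lin_ext_comp:
  assumes "f \<in> free_space A" "\<And>x. x \<in> A \<Longrightarrow> T x \<in> free_space UNIV"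
  shows "lin_ext S (lin_ext T f) = lin_ext (\<lambda>x. lin_ext S (T x)) f"
  unfolding lin_ext_def[of T] lin_ext_def[of _ f] using assms
  by (subst lin_ext_sum) (auto intro!: sum.cong free_space_scale simp: lin_ext_scale dest: free_space_support)

lemma lin_ext_diff_left:
  "lin_ext (\<lambda>x. S x - T x) f = lin_ext S f - lin_ext T f"
  by (simp add: lin_ext_def fun_space.scale_right_diff_distrib sum_subtractf)

lemma lin_ext_id:
  assumes "f \<in> free_space UNIV"
  shows "lin_ext basis_vec f = f"
proof
  fix x
  have "lin_ext basis_vec f x = (\<Sum>y | f y \<noteq> 0. if x = y then f y else 0)"
    unfolding lin_ext_def sum_apply by (intro sum.cong) (auto simp: basis_vec_apply)
  then show "lin_ext basis_vec f x = f x" using assms by (simp add: free_space_finite)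
qed

lemma lin_ext_const_zero [simp]: "lin_ext (\<lambda>x. 0) f = 0"
  by (simp add: lin_ext_def)

text \<open>Reads off a single coefficient, which shows that an injective relabelling of the basis
  is injective on vectors.\<close>

lemma lin_ext_inj_apply:
  assumes "f \<in> free_space A" "inj_on h A" "x \<in> A"
  shows "lin_ext (\<lambda>x. basis_vec (h x)) f (h x) = f x"
proof -
  have "lin_ext (\<lambda>x. basis_vec (h x)) f (h x) = (\<Sum>y | f y \<noteq> 0. if y = x then f y else 0)"
    unfolding lin_ext_def sum_apply
  proof (intro sum.cong refl)
    fix y assume "y \<in> {y. f y \<noteq> 0}"
    then have "y \<in> A" using assms(1) by (simp add: free_space_support)
    then have "h x = h y \<longleftrightarrow> y = x" using assms(2,3) by (metis inj_onD)
    then show "fscale (f y) (basis_vec (h y)) (h x) = (if y = x then f y else 0)"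
      by (simp add: basis_vec_apply)
  qed
  then show ?thesis using assms by (simp add: free_space_finite)
qed

subsection \<open>Ordered simplices and cones\<close>

definition del :: "nat \<Rightarrow> 'a list \<Rightarrow> 'a list"
  where "del i xs = take i xs @ drop (Suc i) xs"

lemma length_del [simp]: "i < length xs \<Longrightarrow> length (del i xs) = length xs - 1"
  by (simp add: del_def)

lemma del_0_Cons [simp]: "del 0 (x # xs) = xs"
  by (simp add: del_def)

lemma del_Suc_Cons [simp]: "del (Suc i) (x # xs) = x # del i xs"
  by (simp add: del_def)

lemma set_del_subset: "set (del i xs) \<subseteq> set xs"
  by (auto simp: del_def dest: in_set_takeD in_set_dropD)

lemma sorted_wrt_del: "sorted_wrt r xs \<Longrightarrow> sorted_wrt r (del i xs)"
proof (induction xs arbitrary: i)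
  case (Cons x xs)
  then show ?case
    by (cases i) (use set_del_subset[of _ xs] in \<open>auto\<close>)
qed (simp add: del_def)

definition bd :: "'a list \<Rightarrow> 'a list \<Rightarrow> 'k::field"
  where "bd xs = (\<Sum>i<length xs. fscale ((-1) ^ i) (basis_vec (del i xs)))"

lemma boundary_eq: "boundary = lin_ext bd"
  by (simp add: boundary_def bd_def[abs_def] del_def)

definition cone :: "'a \<Rightarrow> ('a list \<Rightarrow> 'k::field) \<Rightarrow> 'a list \<Rightarrow> 'k"
  where "cone a = lin_ext (\<lambda>xs. basis_vec (a # xs))"

text \<open>\<open>cone\<close> may repeat the vertex \<open>a\<close>; here such degenerate lists
  become \<open>0\<close>. This is the variant that matches projections, which can collapse
  vertices.\<close>

definition dcone :: "'a \<Rightarrow> ('a list \<Rightarrow> 'k::field) \<Rightarrow> 'a list \<Rightarrow> 'k"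
  where "dcone a = lin_ext (\<lambda>xs. if a \<in> set xs then 0 else basis_vec (a # xs))"

lemma bd_Nil: "bd [] = 0"
  by (simp add: bd_def)

lemma bd_mem:
  assumes "fun_space.subspace V" "\<And>i. i < length xs \<Longrightarrow> basis_vec (del i xs) \<in> V"
  shows "bd xs \<in> V"
  unfolding bd_def using assms
  by (intro fun_space.subspace_sum fun_space.subspace_scale) auto

lemma bd_free: "(\<And>i. i < length xs \<Longrightarrow> del i xs \<in> A) \<Longrightarrow> bd xs \<in> free_space A"
  by (auto intro: bd_mem subspace_free_space free_space_basis)

lemma bd_free_UNIV [simp]: "bd xs \<in> free_space UNIV"
  by (simp add: bd_free)

lemma cone_basis [simp]: "cone a (basis_vec xs) = basis_vec (a # xs)"
  by (simp add: cone_def)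

lemma dcone_basis: "dcone a (basis_vec xs) = (if a \<in> set xs then 0 else basis_vec (a # xs))"
  by (simp add: dcone_def)

text \<open>Omitting \<open>a\<close> leaves \<open>xs\<close>; omitting a later vertex keeps
  \<open>a\<close> in front and shifts the index by one, which flips the sign. The recursion
  replaces double sums over indices.\<close>

lemma bd_Cons: "bd (a # xs) = basis_vec xs - cone a (bd xs)"
proof -
  have "cone a (bd xs :: 'a list \<Rightarrow> 'b)
      = (\<Sum>i<length xs. fscale ((-1) ^ i) (basis_vec (a # del i xs)))"
    unfolding bd_def cone_def
    by (subst lin_ext_sum) (auto simp: lin_ext_scale intro: free_space_scale free_space_basis)
  moreover have "(bd (a # xs) :: 'a list \<Rightarrow> 'b) = basis_vec xs
      + (\<Sum>i<length xs. fscale ((-1) ^ Suc i) (basis_vec (a # del i xs)))"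
    unfolding bd_def length_Cons sum.lessThan_Suc_shift by simp
  moreover have "(\<Sum>i<length xs. fscale ((-1) ^ Suc i) (basis_vec (a # del i xs)))
      = - (\<Sum>i<length xs. fscale ((-1) ^ i) (basis_vec (a # del i xs) :: 'a list \<Rightarrow> 'b))"
    by (simp add: sum_negf[symmetric])
  ultimately show ?thesis by simp
qed

lemma boundary_basis [simp]: "boundary (basis_vec xs) = bd xs"
  by (simp add: boundary_eq)

lemma cone_free: "u \<in> free_space A \<Longrightarrow> (\<And>xs. xs \<in> A \<Longrightarrow> a # xs \<in> B) \<Longrightarrow> cone a u \<in> free_space B"
  unfolding cone_def by (erule lin_ext_free) (auto intro: free_space_basis)

lemma dcone_free:
  "u \<in> free_space A \<Longrightarrow> (\<And>xs. xs \<in> A \<Longrightarrow> a \<notin> set xs \<Longrightarrow> a # xs \<in> B) \<Longrightarrow> dcone a u \<in> free_space B"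
  unfolding dcone_def by (erule lin_ext_free) (auto intro: free_space_basis)

text \<open>Coning is a contracting homotopy. Since the empty list counts as a simplex, no
  correction occurs in the lowest degree.\<close>

lemma boundary_cone:
  assumes "u \<in> free_space UNIV"
  shows "boundary (cone a u) = u - cone a (boundary u)"
proof -
  have "boundary (cone a u) = lin_ext (\<lambda>xs. basis_vec xs - cone a (bd xs)) u"
    unfolding bd_Cons[symmetric] boundary_eq
    by (simp only: cone_def lin_ext_comp[OF assms free_space_basis] lin_ext_basis UNIV_I)
  also have "\<dots> = u - lin_ext (\<lambda>xs. cone a (bd xs)) u"
    by (simp add: lin_ext_diff_left lin_ext_id assms)
  also have "lin_ext (\<lambda>xs. cone a (bd xs)) u = cone a (boundary u)"
    unfolding cone_def boundary_eq using assms by (subst lin_ext_comp) auto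
  finally show ?thesis .
qed

text \<open>The cone identity gives this by induction on the first vertex, without pairing double
  deletions.\<close>

lemma boundary_bd: "boundary (bd xs) = 0"
proof (induction xs)
  case Nil
  show ?case by (simp only: bd_Nil boundary_eq lin_ext_zero)
next
  case (Cons a xs)
  have "boundary (bd (a # xs) :: 'a list \<Rightarrow> 'b)
      = boundary (basis_vec xs) - boundary (cone a (bd xs))"
    unfolding bd_Cons boundary_eq
    by (intro lin_ext_diff free_space_basis cone_free[of _ UNIV]) auto
  then show ?case
    by (simp only: boundary_cone bd_free_UNIV boundary_basis Cons.IH diff_self)
      (simp only: cone_def lin_ext_zero diff_zero diff_self)
qed

lemma dcone_cone: "u \<in> free_space UNIV \<Longrightarrow> dcone a (cone a u) = 0"
  unfolding dcone_def cone_def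
  by (simp only: lin_ext_comp[of u UNIV] free_space_basis UNIV_I lin_ext_basis list.set_intros
      if_True lin_ext_const_zero)

lemma dcone_bd:
  assumes "a \<notin> set xs"
  shows "dcone a (bd xs) = cone a (bd xs)"
  unfolding dcone_def cone_def
  by (rule lin_ext_cong[of _ "{ys. set ys \<subseteq> set xs}"])
    (use assms set_del_subset[of _ xs] in \<open>auto intro!: bd_free\<close>)

lemma dcone_diff:
  "f \<in> free_space UNIV \<Longrightarrow> g \<in> free_space UNIV \<Longrightarrow> dcone a (f - g) = dcone a f - dcone a g"
  unfolding dcone_def by (rule lin_ext_diff)

lemma cone_free_UNIV: "u \<in> free_space UNIV \<Longrightarrow> cone a u \<in> free_space UNIV"
  by (erule cone_free) auto

text \<open>Every face of \<open>a # xs\<close> other than \<open>xs\<close> still contains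
  \<open>a\<close> and is killed.\<close>

lemma dcone_bd_Cons: "a \<notin> set xs \<Longrightarrow> dcone a (bd (a # xs)) = basis_vec (a # xs)"
  by (simp add: bd_Cons dcone_diff free_space_basis cone_free_UNIV dcone_cone dcone_basis)

text \<open>
  Chains of elements that are all at least \<open>a\<close> contain \<open>a\<close> at most at the front; on them \<open>dcone a\<close>
  contracts.
\<close>

definition conical :: "'a \<Rightarrow> 'a list set"
  where "conical a = {xs. a \<notin> set (tl xs)}"

lemma boundary_dcone:
  assumes "u \<in> free_space (conical a)"
  shows "boundary (dcone a u) = u - dcone a (boundary u)"
proof -
  have *: "boundary (dcone a (basis_vec xs)) = basis_vec xs - dcone a (bd xs :: 'a list \<Rightarrow> 'b)"
    if con: "xs \<in> conical a" for xs
  proof (cases "a \<in> set xs")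
    case True
    then obtain ys where "xs = a # ys" "a \<notin> set ys"
      using con True unfolding conical_def by (cases xs) auto
    then show ?thesis by (simp add: dcone_bd_Cons) (simp add: dcone_basis boundary_eq)
  next
    case False
    then show ?thesis by (simp add: dcone_bd) (simp add: dcone_basis bd_Cons)
  qed
  have "boundary (dcone a u) = lin_ext (\<lambda>xs. boundary (dcone a (basis_vec xs))) u"
    unfolding dcone_def boundary_eq using assms
    by (subst lin_ext_comp) (auto intro: free_space_basis)
  also have "\<dots> = lin_ext (\<lambda>xs. basis_vec xs - dcone a (bd xs)) u"
    using assms by (rule lin_ext_cong) (rule *)
  also have "\<dots> = u - lin_ext (\<lambda>xs. dcone a (bd xs)) u"
    using assms by (simp add: lin_ext_diff_left lin_ext_id free_space_UNIV)
  also have "lin_ext (\<lambda>xs. dcone a (bd xs)) u = dcone a (boundary u)"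
    unfolding dcone_def boundary_eq using assms by (subst lin_ext_comp) auto
  finally show ?thesis .
qed

subsection \<open>Projections and subdivisions\<close>

definition clists :: "'a set \<Rightarrow> ('a \<Rightarrow> 'a \<Rightarrow> bool) \<Rightarrow> 'a list set"
  where "clists P r = {xs. set xs \<subseteq> P \<and> sorted_wrt (\<lambda>x y. r x y \<and> x \<noteq> y) xs}"

text \<open>\<open>m\<close> counts vertices, so the dimension is \<open>m - 1\<close>; this keeps
  the index a natural number even for the empty simplex.\<close>

definition nclists :: "'a set \<Rightarrow> ('a \<Rightarrow> 'a \<Rightarrow> bool) \<Rightarrow> nat \<Rightarrow> 'a list set"
  where "nclists P r m = {xs \<in> clists P r. length xs = m}"

lemma clists_Nil [simp]: "[] \<in> clists P r"
  by (simp add: clists_def)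

lemma clists_Cons:
  "x # xs \<in> clists P r \<longleftrightarrow> x \<in> P \<and> xs \<in> clists P r \<and> (\<forall>y\<in>set xs. r x y \<and> x \<noteq> y)"
  by (auto simp: clists_def)

lemma clists_del: "xs \<in> clists P r \<Longrightarrow> del i xs \<in> clists P r"
  using set_del_subset[of i xs] by (auto simp: clists_def intro: sorted_wrt_del)

lemma clists_subset: "xs \<in> clists P r \<Longrightarrow> set xs \<subseteq> P"
  by (simp add: clists_def)

lemma bd_clists: "xs \<in> clists P r \<Longrightarrow> bd xs \<in> free_space (clists P r)"
  by (rule bd_free) (rule clists_del)

lemma lin_ext_bd:
  "lin_ext T (bd xs) = (\<Sum>i<length xs. fscale ((-1) ^ i) (T (del i xs)))"
  unfolding bd_def
  by (subst lin_ext_sum) (auto intro: free_space_scale free_space_basis simp: lin_ext_scale)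

text \<open>The simplicial chain map of a vertex map; a simplex on which \<open>p\<close> is not
  injective becomes degenerate, hence \<open>0\<close>.\<close>

definition push :: "('a \<Rightarrow> 'b) \<Rightarrow> 'a list \<Rightarrow> 'b list \<Rightarrow> 'k::field"
  where "push p xs = (if distinct (map p xs) then basis_vec (map p xs) else 0)"

lemma push_free_UNIV [simp]: "push p xs \<in> free_space UNIV"
  by (simp add: push_def free_space_basis)

lemma push_Cons: "push p (a # xs) = dcone (p a) (push p xs)"
  by (simp add: push_def dcone_basis) (simp add: dcone_def)

lemma push_cone:
  assumes "u \<in> free_space UNIV"
  shows "lin_ext (push p) (cone a u) = dcone (p a) (lin_ext (push p) u)"
proof -
  have "lin_ext (push p) (cone a u) = lin_ext (\<lambda>xs. dcone (p a) (push p xs)) u"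
    by (simp only: cone_def lin_ext_comp[OF assms free_space_basis] lin_ext_basis UNIV_I push_Cons)
  also have "\<dots> = dcone (p a) (lin_ext (push p) u)"
    unfolding dcone_def by (rule lin_ext_comp[OF assms push_free_UNIV, symmetric])
  finally show ?thesis .
qed

text \<open>
  \<open>subdiv s\<close> is barycentric subdivision, with \<open>s ys\<close> in the role of the barycentre of \<open>ys\<close>.
\<close>

function subdiv :: "('b list \<Rightarrow> 'a) \<Rightarrow> 'b list \<Rightarrow> 'a list \<Rightarrow> 'k::field"
  where "subdiv s ys = (if ys = [] then basis_vec []
    else \<Sum>i<length ys. fscale ((-1) ^ i) (cone (s ys) (subdiv s (del i ys))))"
  by pat_completeness auto
termination
  by (relation "measure (\<lambda>(s, ys). length ys)") auto

declare subdiv.simps [simp del]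

lemma subdiv_free_UNIV [simp]: "subdiv s ys \<in> free_space UNIV"
proof (induction ys rule: length_induct)
  case (1 ys)
  then show ?case
    by (subst subdiv.simps)
      (auto intro!: free_space_basis free_space_sum free_space_scale cone_free_UNIV)
qed

lemma subdiv_Nil: "subdiv s [] = basis_vec []"
  by (subst subdiv.simps) simp

text \<open>The definition spells out the sum over faces so that termination is visible; this is the
  conceptual form, the cone from the barycentre over the subdivided boundary.\<close>

lemma subdiv_eq:
  assumes "ys \<noteq> []"
  shows "subdiv s ys = (cone (s ys) (lin_ext (subdiv s) (bd ys)) :: 'a list \<Rightarrow> 'k::field)"
proof -
  have "(cone (s ys) (lin_ext (subdiv s) (bd ys)) :: 'a list \<Rightarrow> 'k) =
      (\<Sum>i<length ys. fscale ((-1) ^ i) (cone (s ys) (subdiv s (del i ys))))"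
    unfolding lin_ext_bd unfolding cone_def
    by (subst lin_ext_sum) (auto intro: free_space_scale simp: lin_ext_scale)
  then show ?thesis using assms by (subst subdiv.simps) simp
qed

text \<open>By induction the subdivided boundary is itself a cycle, and the boundary of a cone over
  a cycle is that cycle.\<close>

lemma boundary_subdiv: "boundary (subdiv s ys) = (lin_ext (subdiv s) (bd ys) :: 'a list \<Rightarrow> 'k::field)"
proof (induction ys rule: length_induct)
  case (1 ys)
  show ?case
  proof (cases "ys = []")
    case True
    then show ?thesis by (simp only: subdiv_Nil boundary_basis bd_Nil lin_ext_zero)
  next
    case False
    let ?u = "lin_ext (subdiv s) (bd ys) :: 'a list \<Rightarrow> 'k"
    have u: "?u \<in> free_space UNIV"
      by (rule lin_ext_free[OF bd_free_UNIV]) simp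
    have "boundary ?u = lin_ext (\<lambda>zs. boundary (subdiv s zs)) (bd ys)"
      unfolding boundary_eq by (rule lin_ext_comp[OF bd_free_UNIV subdiv_free_UNIV])
    also have "\<dots> = lin_ext (\<lambda>zs. lin_ext (subdiv s) (bd zs)) (bd ys)"
      using False "1.IH" by (intro lin_ext_cong[OF bd_free[of ys "{zs. length zs < length ys}"]]) auto
    also have "\<dots> = lin_ext (subdiv s) (boundary (bd ys))"
      unfolding boundary_eq by (rule lin_ext_comp[OF bd_free_UNIV bd_free_UNIV, symmetric])
    also have "\<dots> = 0" by (simp only: boundary_bd lin_ext_zero)
    finally have "boundary ?u = 0" .
    then show ?thesis
      unfolding subdiv_eq[OF False] boundary_cone[OF u] by (simp only: cone_def lin_ext_zero diff_zero)
  qed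
qed

text \<open>The homotopy equation prescribes \<open>boundary (htpy p s w)\<close> in terms of the
  faces of \<open>w\<close>. The prescribed chain turns out to be a cycle, and coning it off from
  the least vertex fills it.\<close>

function htpy :: "('a \<Rightarrow> 'b) \<Rightarrow> ('b list \<Rightarrow> 'a) \<Rightarrow> 'a list \<Rightarrow> 'a list \<Rightarrow> 'k::field"
  where "htpy p s w = (if w = [] then 0
    else dcone (hd w) (lin_ext (subdiv s) (push p w) - basis_vec w
      - (\<Sum>i<length w. fscale ((-1) ^ i) (htpy p s (del i w)))))"
  by pat_completeness auto
termination
  by (relation "measure (\<lambda>(p, s, w). length w)") auto

declare htpy.simps [simp del]

lemma htpy_Nil [simp]: "htpy p s [] = 0"
  by (subst htpy.simps) simp

lemma htpy_eq:
  "w \<noteq> [] \<Longrightarrow> htpy p s w = dcone (hd w) (lin_ext (subdiv s) (push p w) - basis_vec w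
      - lin_ext (htpy p s) (bd w))"
  by (subst htpy.simps) (simp add: lin_ext_bd)

text \<open>\<open>s\<close> is defined on chains of \<open>Q\<close>, not on elements, and it moves
  strictly up when a vertex of the chain is dropped. By \<open>p_s\<close> the composite of
  \<open>s\<close> and \<open>p\<close> is the least vertex map on the barycentric subdivision,
  which makes \<open>p\<close> a retraction on chains. \<open>le_s\<close> keeps the subdivided
  image of a chain above the least element of that chain.\<close>

locale chain_retraction =
  fixes P :: "'a set" and le :: "'a \<Rightarrow> 'a \<Rightarrow> bool" and Q :: "'b set" and le' :: "'b \<Rightarrow> 'b \<Rightarrow> bool"
    and p :: "'a \<Rightarrow> 'b" and s :: "'b list \<Rightarrow> 'a"
  assumes refl: "x \<in> P \<Longrightarrow> le x x"
    and antisym: "x \<in> P \<Longrightarrow> y \<in> P \<Longrightarrow> le x y \<Longrightarrow> le y x \<Longrightarrow> x = y"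
    and trans: "x \<in> P \<Longrightarrow> y \<in> P \<Longrightarrow> z \<in> P \<Longrightarrow> le x y \<Longrightarrow> le y z \<Longrightarrow> le x z"
    and antisym': "x' \<in> Q \<Longrightarrow> y' \<in> Q \<Longrightarrow> le' x' y' \<Longrightarrow> le' y' x' \<Longrightarrow> x' = y'"
    and p_mem: "x \<in> P \<Longrightarrow> p x \<in> Q"
    and p_mono: "x \<in> P \<Longrightarrow> y \<in> P \<Longrightarrow> le x y \<Longrightarrow> le' (p x) (p y)"
    and s_mem: "ys \<in> clists Q le' \<Longrightarrow> ys \<noteq> [] \<Longrightarrow> s ys \<in> P"
    and p_s: "ys \<in> clists Q le' \<Longrightarrow> ys \<noteq> [] \<Longrightarrow> p (s ys) = hd ys"
    and s_del: "ys \<in> clists Q le' \<Longrightarrow> i < length ys \<Longrightarrow> del i ys \<noteq> [] \<Longrightarrow>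
      le (s ys) (s (del i ys)) \<and> s ys \<noteq> s (del i ys)"
    and le_s: "w \<in> clists P le \<Longrightarrow> w \<noteq> [] \<Longrightarrow> map p w \<in> clists Q le' \<Longrightarrow> le (hd w) (s (map p w))"
begin

lemma map_p_clists:
  assumes "w \<in> clists P le" "distinct (map p w)"
  shows "map p w \<in> clists Q le'"
  using assms by (induction w) (auto simp: clists_Cons p_mem clists_subset[THEN subsetD] intro!: p_mono)

lemma push_free:
  "w \<in> nclists P le m \<Longrightarrow> push p w \<in> free_space (nclists Q le' m)"
  by (auto simp: push_def nclists_def intro!: free_space_basis map_p_clists)

text \<open>\<open>push p (a # w)\<close> is a cone from \<open>p a\<close>, so induction and
  \<open>boundary_dcone\<close> apply: by monotonicity and antisymmetry the value \<open>p a\<close>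
  can recur in a strictly increasing image of \<open>w\<close> only at its front.\<close>

lemma boundary_push: "w \<in> clists P le \<Longrightarrow> boundary (push p w) = (lin_ext (push p) (bd w) :: 'b list \<Rightarrow> 'k::field)"
proof (induction w)
  case Nil
  show ?case by (simp only: push_def list.map distinct.simps if_True boundary_basis bd_Nil lin_ext_zero)
next
  case (Cons a w)
  then have w: "w \<in> clists P le" and a: "a \<in> P" and aw: "\<And>x. x \<in> set w \<Longrightarrow> x \<in> P \<and> le a x"
    by (auto simp: clists_Cons dest: clists_subset)
  have "(push p w :: 'b list \<Rightarrow> 'k) \<in> free_space (conical (p a))"
  proof (cases "distinct (map p w)")
    case True
    have "p a \<notin> set (tl (map p w))"
    proof (cases w)
      case (Cons b v)
      have "p a \<noteq> p x" if "x \<in> set v" for x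
      proof
        assume eq: "p a = p x"
        have "le' (p b) (p x)" "le' (p x) (p b)"
          using w aw a that eq Cons p_mono[of b x] p_mono[of a b] by (auto simp: clists_Cons)
        then have "p b = p x" using aw that Cons by (intro antisym' p_mem) auto
        then show False using True that Cons by auto
      qed
      then show ?thesis using Cons by auto
    qed simp
    then show ?thesis using True by (auto simp: push_def conical_def intro!: free_space_basis)
  qed (simp add: push_def)
  then have "(boundary (push p (a # w)) :: 'b list \<Rightarrow> 'k) = push p w - dcone (p a) (boundary (push p w))"
    by (simp only: push_Cons boundary_dcone)
  also have "\<dots> = push p w - lin_ext (push p) (cone a (bd w))"
    by (simp only: Cons.IH[OF w] push_cone[OF bd_free_UNIV])
  also have "\<dots> = lin_ext (push p) (bd (a # w))"
    by (simp only: bd_Cons lin_ext_diff free_space_basis UNIV_I cone_free_UNIV bd_free_UNIV lin_ext_basis)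
  finally show ?case .
qed

text \<open>The barycentre projects to the least vertex of \<open>ys\<close>, so after induction the
  image is the \<open>dcone\<close> from that vertex over \<open>bd ys\<close>; only the opposite
  face survives.\<close>

lemma push_subdiv: "ys \<in> clists Q le' \<Longrightarrow> lin_ext (push p) (subdiv s ys) = (basis_vec ys :: 'b list \<Rightarrow> 'k::field)"
proof (induction ys rule: length_induct)
  case (1 ys)
  show ?case
  proof (cases ys)
    case Nil
    then show ?thesis by (simp add: subdiv_Nil push_def)
  next
    case (Cons y zs)
    have "lin_ext (push p) (lin_ext (subdiv s) (bd ys) :: 'a list \<Rightarrow> 'k)
        = lin_ext (\<lambda>zs. lin_ext (push p) (subdiv s zs)) (bd ys)"
      by (rule lin_ext_comp[OF bd_free_UNIV subdiv_free_UNIV])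
    also have "\<dots> = lin_ext basis_vec (bd ys)"
      using 1 Cons
      by (intro lin_ext_cong[OF bd_free[of ys "{zs \<in> clists Q le'. length zs < length ys}"]])
        (auto intro: clists_del)
    also have "\<dots> = bd ys" by (simp add: lin_ext_id)
    finally have eq: "lin_ext (push p) (lin_ext (subdiv s) (bd ys) :: 'a list \<Rightarrow> 'k) = bd ys" .
    have ne: "ys \<noteq> []" using Cons by simp
    have "lin_ext (push p) (subdiv s ys :: 'a list \<Rightarrow> 'k) = dcone (p (s ys)) (bd ys)"
      unfolding subdiv_eq[OF ne] push_cone[OF lin_ext_free[OF bd_free_UNIV subdiv_free_UNIV]] eq ..
    also have "\<dots> = dcone y (bd ys)" using p_s[OF "1.prems"] Cons by simp
    also have "\<dots> = basis_vec ys"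
      using "1.prems" Cons dcone_bd_Cons[of y zs] by (auto simp: clists_Cons)
    finally show ?thesis .
  qed
qed

text \<open>The acyclic carrier of the homotopy argument: chains above \<open>a\<close>, where
  coning from \<open>a\<close> contracts.\<close>

definition upper :: "'a \<Rightarrow> nat \<Rightarrow> 'a list set"
  where "upper a m = {xs \<in> nclists P le m. \<forall>x\<in>set xs. le a x}"

lemma upper_mono: "a \<in> P \<Longrightarrow> b \<in> P \<Longrightarrow> le a b \<Longrightarrow> upper b m \<subseteq> upper a m"
  using trans[of a b] by (auto simp: upper_def nclists_def dest: clists_subset[THEN subsetD])

lemma upper_conical: "a \<in> P \<Longrightarrow> upper a m \<subseteq> conical a"
proof
  fix xs assume a: "a \<in> P" and xs: "xs \<in> upper a m"
  show "xs \<in> conical a"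
  proof (cases xs)
    case (Cons b ys)
    then show ?thesis using a xs antisym[of a b] by (fastforce simp: upper_def nclists_def conical_def clists_Cons)
  qed (simp add: conical_def)
qed

lemma upper_Cons: "a \<in> P \<Longrightarrow> xs \<in> upper a m \<Longrightarrow> a \<notin> set xs \<Longrightarrow> a # xs \<in> upper a (Suc m)"
  by (auto simp: upper_def nclists_def clists_Cons refl)

text \<open>Barycentres of proper faces lie strictly above that of \<open>ys\<close>, so coning from
  \<open>s ys\<close> always puts a new least element in front.\<close>

lemma subdiv_free:
  "ys \<in> clists Q le' \<Longrightarrow> ys \<noteq> [] \<Longrightarrow> (subdiv s ys :: 'a list \<Rightarrow> 'k::field) \<in> free_space (upper (s ys) (length ys))"
proof (induction ys rule: length_induct)
  case (1 ys)
  let ?a = "s ys"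
  have a: "?a \<in> P" using 1 by (simp add: s_mem)
  have "(subdiv s (del i ys) :: 'a list \<Rightarrow> 'k) \<in> free_space {xs \<in> upper ?a (length ys - 1). ?a \<notin> set xs}"
    if i: "i < length ys" for i
  proof (cases "del i ys = []")
    \<comment> \<open>A single vertex: its only face is the empty chain, which has no barycentre, so
      \<open>s_del\<close> cannot be applied.\<close>
    case True
    then have "length ys = 1" using i length_del[OF i] by (cases ys) auto
    then show ?thesis using True
      by (auto simp: subdiv_Nil upper_def nclists_def intro!: free_space_basis)
  next
    case False
    let ?b = "s (del i ys)"
    have c: "del i ys \<in> clists Q le'" using 1 by (simp add: clists_del)
    then have b: "?b \<in> P" using False by (simp add: s_mem)
    have ab: "le ?a ?b" "?a \<noteq> ?b" using s_del[OF "1.prems"(1) i False] by auto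
    have "upper ?b (length ys - 1) \<subseteq> {xs \<in> upper ?a (length ys - 1). ?a \<notin> set xs}"
      using upper_mono[OF a b ab(1)] antisym[OF a b ab(1)] ab(2) by (auto simp: upper_def)
    moreover have "(subdiv s (del i ys) :: 'a list \<Rightarrow> 'k) \<in> free_space (upper ?b (length ys - 1))"
      using "1.IH"[rule_format, of "del i ys"] c False i by simp
    ultimately show ?thesis by (rule free_space_mono[rotated])
  qed
  then have "(\<Sum>i<length ys. fscale ((-1) ^ i) (cone ?a (subdiv s (del i ys) :: 'a list \<Rightarrow> 'k)))
      \<in> free_space (upper ?a (length ys))"
    using upper_Cons[OF a, of _ "length ys - 1"] "1.prems"(2)
    by (intro free_space_sum free_space_scale cone_free) auto
  then show ?case using 1 by (subst subdiv.simps) simp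
qed

lemma subdiv_nclists:
  assumes "ys \<in> nclists Q le' m"
  shows "(subdiv s ys :: 'a list \<Rightarrow> 'k::field) \<in> free_space (nclists P le m)"
proof (cases "ys = []")
  case True
  then show ?thesis using assms by (auto simp: subdiv_Nil nclists_def intro!: free_space_basis)
next
  case False
  then show ?thesis using assms subdiv_free[of ys]
    by (auto simp: nclists_def upper_def elim: free_space_mono)
qed

text \<open>
  Both the identity and the composition of projection and subdivision carry a chain \<open>w\<close> into the cone
  \<open>upper (hd w)\<close>, which is why coning off from \<open>hd w\<close> defines a homotopy.
\<close>

lemma htpy_step_free:
  assumes w: "w \<in> clists P le" "w \<noteq> []"
    and IH: "\<And>i. i < length w \<Longrightarrow> del i w \<noteq> [] \<Longrightarrow>
      (htpy p s (del i w) :: 'a list \<Rightarrow> 'k::field) \<in> free_space (upper (hd (del i w)) (length w))"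
  shows "lin_ext (subdiv s) (push p w) - basis_vec w - lin_ext (htpy p s) (bd w :: 'a list \<Rightarrow> 'k)
    \<in> free_space (upper (hd w) (length w))"
proof (intro free_space_diff)
  obtain a v where av: "w = a # v" using w by (cases w) auto
  have a: "hd w \<in> P" using w av by (simp add: clists_Cons)
  show "(lin_ext (subdiv s) (push p w) :: 'a list \<Rightarrow> 'k) \<in> free_space (upper (hd w) (length w))"
  proof (cases "distinct (map p w)")
    case True
    then have c: "map p w \<in> clists Q le'" using w by (simp add: map_p_clists)
    have "upper (s (map p w)) (length w) \<subseteq> upper (hd w) (length w)"
      using w a c by (intro upper_mono le_s s_mem) auto
    with subdiv_free[OF c] w True show ?thesis
      by (auto simp: push_def elim: free_space_mono)
  next
    case False
    then have "lin_ext (subdiv s) (push p w) = (0 :: 'a list \<Rightarrow> 'k)"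
      by (simp only: push_def if_False lin_ext_zero)
    then show ?thesis by (simp only: free_space_zero)
  qed
  show "(basis_vec w :: 'a list \<Rightarrow> 'k) \<in> free_space (upper (hd w) (length w))"
    using w av refl[of a] by (intro free_space_basis) (auto simp: upper_def nclists_def clists_Cons)
  have "(htpy p s (del i w) :: 'a list \<Rightarrow> 'k) \<in> free_space (upper (hd w) (length w))" if i: "i < length w" for i
  proof (cases "del i w = []")
    case True
    then show ?thesis by (simp only: htpy_Nil free_space_zero)
  next
    case False
    then have h: "hd (del i w) \<in> set (del i w)" by simp
    have "hd (del i w) \<in> set w"
      using h set_del_subset[of i w] by blast
    then have "upper (hd (del i w)) (length w) \<subseteq> upper (hd w) (length w)"
      using w av a refl[of a] by (intro upper_mono) (auto simp: clists_Cons dest!: clists_subset)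
    then show ?thesis using IH[OF i False] by (rule free_space_mono[rotated])
  qed
  then show "(lin_ext (htpy p s) (bd w) :: 'a list \<Rightarrow> 'k) \<in> free_space (upper (hd w) (length w))"
    unfolding lin_ext_bd by (intro free_space_sum free_space_scale) auto
qed

lemma htpy_free:
  "w \<in> clists P le \<Longrightarrow> w \<noteq> [] \<Longrightarrow>
    (htpy p s w :: 'a list \<Rightarrow> 'k::field) \<in> free_space (upper (hd w) (Suc (length w)))"
proof (induction w rule: length_induct)
  case (1 w)
  have a: "hd w \<in> P" using 1 by (cases w) (auto simp: clists_Cons)
  have "lin_ext (subdiv s) (push p w) - basis_vec w - lin_ext (htpy p s) (bd w :: 'a list \<Rightarrow> 'k)
    \<in> free_space (upper (hd w) (length w))"
  proof (rule htpy_step_free[OF "1.prems"])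
    fix i assume i: "i < length w" "del i w \<noteq> []"
    then have "(htpy p s (del i w) :: 'a list \<Rightarrow> 'k) \<in> free_space (upper (hd (del i w)) (Suc (length (del i w))))"
      using 1(2) by (intro "1.IH"[rule_format]) (simp_all add: clists_del)
    moreover have "Suc (length (del i w)) = length w" using i by simp
    ultimately show "(htpy p s (del i w) :: 'a list \<Rightarrow> 'k) \<in> free_space (upper (hd (del i w)) (length w))"
      by simp
  qed
  then show ?case
    unfolding htpy_eq[OF "1.prems"(2)] by (rule dcone_free) (rule upper_Cons[OF a])
qed

lemma htpy_nclists:
  assumes "w \<in> nclists P le m"
  shows "(htpy p s w :: 'a list \<Rightarrow> 'k::field) \<in> free_space (nclists P le (Suc m))"
proof (cases "w = []")
  case True
  then show ?thesis by (simp only: htpy_Nil free_space_zero)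
next
  case False
  then show ?thesis using assms htpy_free[of w]
    by (auto simp: nclists_def upper_def elim: free_space_mono)
qed

text \<open>Subdivision and projection commute with the boundary, and the induction hypothesis on
  the faces cancels the other terms, so the chain being coned off is a cycle. As it lies above
  \<open>hd w\<close>, \<open>boundary_dcone\<close> returns it unchanged.\<close>

lemma boundary_htpy:
  "w \<in> clists P le \<Longrightarrow>
    boundary (htpy p s w :: 'a list \<Rightarrow> 'k::field)
      = lin_ext (subdiv s) (push p w) - basis_vec w - lin_ext (htpy p s) (bd w)"
proof (induction w rule: length_induct)
  case (1 w)
  show ?case
  proof (cases "w = []")
    case True
    have "boundary (htpy p s w) = (0 :: 'a list \<Rightarrow> 'k)"
      by (simp only: True htpy_Nil boundary_eq lin_ext_zero)
    moreover have "lin_ext (subdiv s) (push p w) = (basis_vec w :: 'a list \<Rightarrow> 'k)"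
      using True by (simp add: push_def subdiv_Nil)
    moreover have "lin_ext (htpy p s) (bd w) = (0 :: 'a list \<Rightarrow> 'k)"
      by (simp only: True bd_Nil lin_ext_zero)
    ultimately show ?thesis by simp
  next
    case False
    let ?S = "lin_ext (subdiv s) :: _ \<Rightarrow> 'a list \<Rightarrow> 'k" and ?H = "lin_ext (htpy p s) :: _ \<Rightarrow> 'a list \<Rightarrow> 'k"
    let ?u = "?S (push p w) - basis_vec w - ?H (bd w)"
    have hU: "htpy p s v \<in> (free_space UNIV :: ('a list \<Rightarrow> 'k) set)" if "v \<in> clists P le" for v
      using htpy_nclists[of v "length v"] that by (auto simp: nclists_def intro: free_space_UNIV)
    have Sfree: "?S f \<in> free_space UNIV" if "f \<in> free_space UNIV" for f
      by (rule lin_ext_free[OF that]) simp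
    have Hfree: "?H (bd w) \<in> free_space UNIV"
      by (rule lin_ext_free[OF bd_clists[OF "1.prems"] hU])
    have u: "?u \<in> free_space (upper (hd w) (length w))"
    proof (rule htpy_step_free[OF "1.prems" False])
      fix i assume i: "i < length w" "del i w \<noteq> []"
      then have "Suc (length (del i w)) = length w" by simp
      then show "(htpy p s (del i w) :: 'a list \<Rightarrow> 'k) \<in> free_space (upper (hd (del i w)) (length w))"
        using htpy_free[OF clists_del[OF "1.prems"] i(2)] by metis
    qed
    have bS: "boundary (?S f) = ?S (boundary f)" if "f \<in> free_space UNIV" for f
    proof -
      have "boundary (?S f) = lin_ext (\<lambda>ys. boundary (subdiv s ys)) f"
        unfolding boundary_eq by (rule lin_ext_comp[OF that subdiv_free_UNIV])
      also have "\<dots> = ?S (boundary f)"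
        unfolding boundary_subdiv unfolding boundary_eq by (rule lin_ext_comp[OF that bd_free_UNIV, symmetric])
      finally show ?thesis .
    qed
    have e1: "boundary (?S (push p w)) = ?S (lin_ext (push p) (bd w))"
      by (simp only: bS[OF push_free_UNIV] boundary_push[OF "1.prems"])
    have fr: "bd w \<in> free_space {v \<in> clists P le. length v < length w}"
      using False "1.prems" by (auto intro!: bd_free clists_del)
    have "boundary (?H (bd w)) = lin_ext (\<lambda>v. boundary (htpy p s v)) (bd w)"
      unfolding boundary_eq by (rule lin_ext_comp[OF bd_clists[OF "1.prems"] hU])
    also have "\<dots> = lin_ext (\<lambda>v. ?S (push p v) - basis_vec v - ?H (bd v)) (bd w)"
      using "1.IH" by (intro lin_ext_cong[OF fr]) auto
    also have "\<dots> = lin_ext (\<lambda>v. ?S (push p v)) (bd w) - bd w - lin_ext (\<lambda>v. ?H (bd v)) (bd w)"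
      by (simp only: lin_ext_diff_left lin_ext_id[OF bd_free_UNIV])
    also have "lin_ext (\<lambda>v. ?S (push p v)) (bd w) = ?S (lin_ext (push p) (bd w))"
      by (rule lin_ext_comp[OF bd_free_UNIV push_free_UNIV, symmetric])
    also have "lin_ext (\<lambda>v. ?H (bd v)) (bd w) = ?H (boundary (bd w))"
      unfolding boundary_eq by (rule lin_ext_comp[OF bd_free_UNIV bd_free_UNIV, symmetric])
    also have "\<dots> = 0" by (simp only: boundary_bd lin_ext_zero)
    finally have e2: "boundary (?H (bd w)) = ?S (lin_ext (push p) (bd w)) - bd w - 0" .
    have "boundary ?u = boundary (?S (push p w)) - boundary (basis_vec w) - boundary (?H (bd w))"
      unfolding boundary_eq
      by (simp only: lin_ext_diff[OF free_space_diff] lin_ext_diff Sfree[OF push_free_UNIV] Hfree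
          free_space_basis UNIV_I free_space_diff)
    also have "\<dots> = 0"
      by (simp only: e1 e2 boundary_basis diff_zero diff_self)
    finally have "boundary ?u = 0" .
    moreover have "boundary (htpy p s w) = ?u - dcone (hd w) (boundary ?u)"
      unfolding htpy_eq[OF False]
      by (rule boundary_dcone[OF free_space_mono[OF u upper_conical]])
        (use "1.prems" False in \<open>cases w; auto simp: clists_Cons\<close>)
    ultimately show ?thesis
      by (simp only: dcone_def lin_ext_zero diff_zero)
  qed
qed

text \<open>The homotopy takes values in chains with \<open>Suc m\<close> elements, of which there
  are none; its defining equation then leaves equality instead of equality up to a boundary.\<close>

lemma subdiv_push_cycle:
  fixes f :: "'a list \<Rightarrow> 'k::field"
  assumes f: "f \<in> free_space (nclists P le m)" "boundary f = 0"
    and top: "nclists P le (Suc m) = {}"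
  shows "lin_ext (subdiv s) (lin_ext (push p) f) = f"
proof -
  have "htpy p s w = (0 :: 'a list \<Rightarrow> 'k)" if "w \<in> nclists P le m" for w
    using htpy_nclists[OF that] top by simp
  then have "lin_ext (\<lambda>w. boundary (htpy p s w)) f = lin_ext (\<lambda>w. 0) f"
    by (intro lin_ext_cong[OF f(1)]) (simp only: boundary_eq lin_ext_zero)
  also have "\<dots> = 0" by (rule lin_ext_const_zero)
  finally have "0 = lin_ext (\<lambda>w. boundary (htpy p s w)) f" by simp
  also have "\<dots> = lin_ext (\<lambda>w. lin_ext (subdiv s) (push p w) - basis_vec w - lin_ext (htpy p s) (bd w)) f"
    by (rule lin_ext_cong[OF f(1)]) (rule boundary_htpy, simp add: nclists_def)
  also have "\<dots> = lin_ext (\<lambda>w. lin_ext (subdiv s) (push p w)) f - f - lin_ext (\<lambda>w. lin_ext (htpy p s) (bd w)) f"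
    by (simp only: lin_ext_diff_left lin_ext_id[OF free_space_UNIV[OF f(1)]])
  also have "lin_ext (\<lambda>w. lin_ext (subdiv s) (push p w)) f = lin_ext (subdiv s) (lin_ext (push p) f)"
    by (rule lin_ext_comp[OF f(1) push_free_UNIV, symmetric])
  also have "lin_ext (\<lambda>w. lin_ext (htpy p s) (bd w)) f = lin_ext (htpy p s) (boundary f)"
    unfolding boundary_eq by (rule lin_ext_comp[OF f(1) bd_free_UNIV, symmetric])
  also have "\<dots> = 0" by (simp only: f(2) lin_ext_zero)
  finally show ?thesis by (simp only: diff_zero eq_iff_diff_eq_0[symmetric] right_minus_eq) (metis right_minus_eq)
qed

text \<open>Subdivision is the inverse: a section of the projection in every degree, and on top
  cycles also inverse from the other side.\<close>

lemma push_bij: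
  assumes "nclists P le (Suc m) = {}"
  shows "bij_betw (lin_ext (push p))
    {f \<in> free_space (nclists P le m). boundary f = (0 :: 'a list \<Rightarrow> 'k::field)}
    {f \<in> free_space (nclists Q le' m). boundary f = 0}"
proof (rule bij_betw_byWitness[where f' = "lin_ext (subdiv s)"])
  show "\<forall>f\<in>{f \<in> free_space (nclists P le m). boundary f = (0 :: 'a list \<Rightarrow> 'k)}.
      lin_ext (subdiv s) (lin_ext (push p) f) = f"
    using assms by (auto intro: subdiv_push_cycle)
  show "\<forall>f\<in>{f \<in> free_space (nclists Q le' m). boundary f = (0 :: 'b list \<Rightarrow> 'k)}.
      lin_ext (push p) (lin_ext (subdiv s) f) = f"
  proof clarify
    fix f :: "'b list \<Rightarrow> 'k"
    assume f: "f \<in> free_space (nclists Q le' m)"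
    have "lin_ext (push p) (lin_ext (subdiv s) f) = lin_ext (\<lambda>ys. lin_ext (push p) (subdiv s ys)) f"
      by (rule lin_ext_comp[OF f subdiv_free_UNIV])
    also have "\<dots> = lin_ext basis_vec f"
      by (rule lin_ext_cong[OF f]) (rule push_subdiv, simp add: nclists_def)
    finally show "lin_ext (push p) (lin_ext (subdiv s) f) = f"
      using f by (simp add: lin_ext_id free_space_UNIV)
  qed
  show "lin_ext (push p) ` {f \<in> free_space (nclists P le m). boundary f = (0 :: 'a list \<Rightarrow> 'k)}
      \<subseteq> {f \<in> free_space (nclists Q le' m). boundary f = 0}"
  proof clarify
    fix f :: "'a list \<Rightarrow> 'k"
    assume f: "f \<in> free_space (nclists P le m)" "boundary f = 0"
    have "boundary (lin_ext (push p) f) = lin_ext (\<lambda>w. boundary (push p w)) f"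
      unfolding boundary_eq by (rule lin_ext_comp[OF f(1) push_free_UNIV])
    also have "\<dots> = lin_ext (\<lambda>w. lin_ext (push p) (bd w)) f"
      by (rule lin_ext_cong[OF f(1)]) (rule boundary_push, simp add: nclists_def)
    also have "\<dots> = lin_ext (push p) (boundary f)"
      unfolding boundary_eq by (rule lin_ext_comp[OF f(1) bd_free_UNIV, symmetric])
    finally show "lin_ext (push p) f \<in> free_space (nclists Q le' m) \<and> boundary (lin_ext (push p) f) = 0"
      using f lin_ext_free[OF f(1) push_free] by (simp only: lin_ext_zero simp_thms)
  qed
  show "lin_ext (subdiv s) ` {f \<in> free_space (nclists Q le' m). boundary f = (0 :: 'b list \<Rightarrow> 'k)}
      \<subseteq> {f \<in> free_space (nclists P le m). boundary f = 0}"
  proof clarify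
    fix f :: "'b list \<Rightarrow> 'k"
    assume f: "f \<in> free_space (nclists Q le' m)" "boundary f = 0"
    have "boundary (lin_ext (subdiv s) f) = lin_ext (\<lambda>ys. boundary (subdiv s ys)) f"
      unfolding boundary_eq by (rule lin_ext_comp[OF f(1) subdiv_free_UNIV])
    also have "\<dots> = lin_ext (subdiv s) (boundary f)"
      unfolding boundary_subdiv unfolding boundary_eq
      by (rule lin_ext_comp[OF f(1) bd_free_UNIV, symmetric])
    finally show "lin_ext (subdiv s) f \<in> free_space (nclists P le m) \<and> boundary (lin_ext (subdiv s) f) = 0"
      using f lin_ext_free[OF f(1) subdiv_nclists] by (simp only: lin_ext_zero simp_thms)
  qed
qed

end

section \<open>Pointed partitions\<close>

lemma pp_leD:
  assumes "pp_le (P, Z) (P', Z')" "b \<in> P"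
  obtains b' where "b' \<in> insert Z' P'" "b \<subseteq> b'"
  using assms unfolding pp_le_def by blast

lemma pp_leD_pointed: "pp_le (P, Z) (P', Z') \<Longrightarrow> Z \<subseteq> Z'"
  by (simp add: pp_le_def)

lemma pp_le_refl: "pp_le \<pi> \<pi>"
  by (cases \<pi>) (auto simp: pp_le_def)

lemma pp_le_trans:
  assumes "pp_le \<pi>1 \<pi>2" "pp_le \<pi>2 \<pi>3"
  shows "pp_le \<pi>1 \<pi>3"
proof -
  obtain P1 Z1 P2 Z2 P3 Z3 where eq: "\<pi>1 = (P1, Z1)" "\<pi>2 = (P2, Z2)" "\<pi>3 = (P3, Z3)"
    by (metis surj_pair)
  have "\<exists>b'\<in>insert Z3 P3. b \<subseteq> b'" if "b \<in> P1" for b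
  proof -
    obtain b' where b': "b' \<in> insert Z2 P2" "b \<subseteq> b'"
      using assms(1) \<open>b \<in> P1\<close> unfolding eq by (rule pp_leD)
    show ?thesis
    proof (cases "b' = Z2")
      case True
      then show ?thesis using b' pp_leD_pointed[OF assms(2)[unfolded eq]] by blast
    next
      case False
      then have "b' \<in> P2" using b'(1) by simp
      with assms(2)[unfolded eq] obtain b'' where "b'' \<in> insert Z3 P3" "b' \<subseteq> b''"
        by (rule pp_leD)
      then show ?thesis using b' by blast
    qed
  qed
  then show ?thesis using assms by (auto simp: eq pp_le_def)
qed

lemma partition_on_unique: "partition_on A P \<Longrightarrow> b \<in> P \<Longrightarrow> b' \<in> P \<Longrightarrow> x \<in> b \<Longrightarrow> x \<in> b' \<Longrightarrow> b = b'"
  by (auto simp: partition_on_def disjoint_def)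

lemma pointed_partitions_finite: "(P, Z) \<in> pointed_partitions n \<Longrightarrow> finite P"
  by (auto simp: pointed_partitions_def intro: finite_elements[rotated])

text \<open>A point of a block \<open>b'\<close> of the coarser partition lies outside
  \<open>Z'\<close>, hence outside \<open>Z\<close>; its block in \<open>P\<close> can go neither
  into \<open>Z'\<close> nor into a block other than \<open>b'\<close>.\<close>

lemma pp_le_choice:
  assumes "(P, Z) \<in> pointed_partitions n" "(P', Z') \<in> pointed_partitions n" "pp_le (P, Z) (P', Z')"
  obtains f where "\<And>b'. b' \<in> P' \<Longrightarrow> f b' \<in> P \<and> f b' \<subseteq> b'" "inj_on f P'"
proof -
  have part: "partition_on ({1..n} - Z) P" "partition_on ({1..n} - Z') P'"
    using assms by (auto simp: pointed_partitions_def)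
  have "\<exists>b. b \<in> P \<and> b \<subseteq> b'" if b': "b' \<in> P'" for b'
  proof -
    obtain x where x: "x \<in> b'" using part(2) b' by (metis ex_in_conv partition_onD3)
    then have xn: "x \<in> {1..n}" "x \<notin> Z'" using partition_onD1[OF part(2)] b' by blast+
    moreover have "Z \<subseteq> Z'" using assms(3) by (simp add: pp_le_def)
    ultimately have "x \<in> \<Union> P" using partition_onD1[OF part(1)] by blast
    then obtain b where b: "b \<in> P" "x \<in> b" by blast
    from assms(3) b(1) obtain b'' where "b'' \<in> insert Z' P'" "b \<subseteq> b''" by (rule pp_leD)
    moreover from this have "b'' = b'"
      using b x xn b' partition_on_unique[OF part(2), of b'' b' x] by auto
    ultimately show ?thesis using b by blast
  qed
  then obtain f where f: "\<And>b'. b' \<in> P' \<Longrightarrow> f b' \<in> P \<and> f b' \<subseteq> b'" by metis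
  moreover have "inj_on f P'"
  proof (rule inj_onI)
    fix a b assume ab: "a \<in> P'" "b \<in> P'" "f a = f b"
    then have "f a \<noteq> {}" using f partition_onD3[OF part(1)] by metis
    then show "a = b" using ab f partition_on_unique[OF part(2), of a b] by blast
  qed
  ultimately show ?thesis using that by blast
qed

text \<open>The number of non-pointed blocks serves as a strictly decreasing rank, from which both
  antisymmetry and the bound on chain lengths follow. In case of equality the chosen subblocks
  exhaust \<open>P\<close>.\<close>

lemma pp_le_card:
  assumes "(P, Z) \<in> pointed_partitions n" "(P', Z') \<in> pointed_partitions n" "pp_le (P, Z) (P', Z')"
  shows "card P' \<le> card P"
    and "card P' = card P \<Longrightarrow> (P, Z) = (P', Z')"
proof -
  obtain f where f: "\<And>b'. b' \<in> P' \<Longrightarrow> f b' \<in> P \<and> f b' \<subseteq> b'" and inj: "inj_on f P'"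
    using pp_le_choice[OF assms] by blast
  have fin: "finite P" using assms(1) by (rule pointed_partitions_finite)
  have sub: "f ` P' \<subseteq> P" using f by auto
  show "card P' \<le> card P" using inj sub fin by (rule card_inj_on_le)
  have part: "partition_on ({1..n} - Z) P" "partition_on ({1..n} - Z') P'"
    and Zn: "Z \<subseteq> {1..n}" "Z' \<subseteq> {1..n}"
    using assms by (auto simp: pointed_partitions_def)
  assume eq: "card P' = card P"
  then have im: "f ` P' = P" using card_image[OF inj] card_subset_eq[OF fin sub] by simp
  have ZZ: "Z = Z'"
  proof
    show "Z \<subseteq> Z'" using assms(3) by (auto simp: pp_le_def)
    show "Z' \<subseteq> Z"
    proof
      fix x assume x: "x \<in> Z'"
      show "x \<in> Z"
      proof (rule ccontr)
        assume "x \<notin> Z"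
        then have "x \<in> \<Union> P" using x Zn partition_onD1[OF part(1)] by blast
        then obtain b where "b \<in> P'" "x \<in> f b" using im by blast
        then have "x \<in> \<Union> P'" using f by blast
        then show False using x partition_onD1[OF part(2)] by blast
      qed
    qed
  qed
  have fb: "f b = b" if b: "b \<in> P'" for b
  proof
    show "f b \<subseteq> b" using f b by blast
    show "b \<subseteq> f b"
    proof
      fix x assume x: "x \<in> b"
      then have "x \<in> \<Union> P" using b partition_onD1[OF part(1)] partition_onD1[OF part(2)] ZZ by blast
      then obtain b2 where b2: "b2 \<in> P'" "x \<in> f b2" using im by blast
      then have "b2 = b" using f x b partition_on_unique[OF part(2), of b2 b x] by blast
      then show "x \<in> f b" using b2 by simp
    qed
  qed
  have "f ` P' = P'" using fb by force
  then show "(P, Z) = (P', Z')" using im ZZ by simp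
qed

lemma pp_le_antisym:
  assumes "\<pi> \<in> pointed_partitions n" "\<pi>' \<in> pointed_partitions n" "pp_le \<pi> \<pi>'" "pp_le \<pi>' \<pi>"
  shows "\<pi> = \<pi>'"
  using assms pp_le_card[of "fst \<pi>" "snd \<pi>" n "fst \<pi>'" "snd \<pi>'"]
    pp_le_card(1)[of "fst \<pi>'" "snd \<pi>'" n "fst \<pi>" "snd \<pi>"] by simp

section \<open>Chains of subsets\<close>

text \<open>The possible sizes of the pointed block: in a coarsening of \<open>c\<close> the last
  run is a final segment. The index \<open>0\<close> contributes \<open>n\<close>, which
  \<open>proper_subsets\<close> excludes.\<close>

definition tail_sums :: "nat list \<Rightarrow> nat set"
  where "tail_sums c = {sum_list (drop i c) | i. i < length c}"

definition proper_subsets :: "nat \<Rightarrow> nat set \<Rightarrow> nat set set"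
  where "proper_subsets n S = {Z. Z \<subseteq> {1..n} \<and> Z \<noteq> {1..n} \<and> card Z \<in> S}"

abbreviation flags :: "nat \<Rightarrow> nat list \<Rightarrow> nat set list set"
  where "flags n c \<equiv> clists (proper_subsets n (tail_sums c)) (\<subseteq>)"

fun gaps :: "nat \<Rightarrow> nat set list \<Rightarrow> nat set set"
  where
    "gaps n [] = {}"
  | "gaps n [Z] = {{1..n} - Z}"
  | "gaps n (Z # Z' # zs) = insert (Z' - Z) (gaps n (Z' # zs))"

definition flag_partition :: "nat \<Rightarrow> nat set list \<Rightarrow> pointed_partition"
  where "flag_partition n ys = (gaps n ys, hd ys)"

lemma gaps_partition:
  "ys \<in> clists (proper_subsets n S) (\<subseteq>) \<Longrightarrow> ys \<noteq> [] \<Longrightarrow> partition_on ({1..n} - hd ys) (gaps n ys)"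
proof (induction n ys rule: gaps.induct)
  case (2 n Z)
  then have "{1..n} - Z \<noteq> {}" by (auto simp: clists_Cons proper_subsets_def)
  then show ?case by (simp add: partition_on_space)
next
  case (3 n Z Z' zs)
  then have IH: "partition_on ({1..n} - Z') (gaps n (Z' # zs))" and Z: "Z \<subset> Z'" "Z' \<subseteq> {1..n}"
    by (auto simp: clists_Cons proper_subsets_def)
  have eq: "{1..n} - Z = (Z' - Z) \<union> ({1..n} - Z')" using Z by auto
  have "partition_on ({1..n} - Z) (insert (Z' - Z) (gaps n (Z' # zs)))"
    unfolding eq using IH Z by (subst partition_on_insert) (auto simp: disjnt_def partition_on_def)
  then show ?case by simp
qed simp

text \<open>A gap lies between two consecutive sets, so every set of the flag is on one side of it.
  This feeds \<open>le_flag_partition\<close>.\<close>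

lemma gaps_dichotomy:
  "ys \<in> clists (proper_subsets n S) (\<subseteq>) \<Longrightarrow> b \<in> gaps n ys \<Longrightarrow> Z \<in> set ys \<Longrightarrow> b \<subseteq> Z \<or> b \<inter> Z = {}"
proof (induction n ys rule: gaps.induct)
  case (3 n Y Y' zs)
  have Y: "Y \<subseteq> Y'" "\<And>W. W \<in> set (Y' # zs) \<Longrightarrow> Y' \<subseteq> W"
    using "3.prems" by (auto simp: clists_Cons)
  have F: "Y' # zs \<in> clists (proper_subsets n S) (\<subseteq>)" using "3.prems" by (simp add: clists_Cons)
  consider "b = Y' - Y" | "b \<in> gaps n (Y' # zs)" "Z = Y" | "b \<in> gaps n (Y' # zs)" "Z \<in> set (Y' # zs)"
    using "3.prems"(2,3) by auto
  then show ?case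
  proof cases
    case 1
    then show ?thesis using Y "3.prems"(3) by (cases "Z = Y") auto
  next
    case 2
    then have "b \<subseteq> {1..n} - Y'" using partition_onD1[OF gaps_partition[OF F]] by auto
    then show ?thesis using Y 2 by blast
  next
    case 3
    then show ?thesis using "3.IH" F by blast
  qed
qed auto

lemma card_gaps:
  "ys \<in> clists (proper_subsets n S) (\<subseteq>) \<Longrightarrow> card (gaps n ys) = length ys \<and> finite (gaps n ys)"
proof (induction n ys rule: gaps.induct)
  case (3 n Z Z' zs)
  have F: "Z' # zs \<in> clists (proper_subsets n S) (\<subseteq>)" and Z: "Z \<subset> Z'"
    using "3.prems" by (auto simp: clists_Cons)
  have "Z' - Z \<notin> gaps n (Z' # zs)"
    using partition_onD1[OF gaps_partition[OF F]] Z by auto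
  then show ?case using "3.IH"[OF F] by simp
qed auto

text \<open>A block that no set of the flag cuts lies in the piece belonging to the first set that
  contains it, or in the final complement. Both comparisons demanded of \<open>s\<close> by
  \<open>chain_retraction\<close> are instances.\<close>

lemma le_flag_partition:
  assumes "ys \<noteq> []" "Z \<subseteq> hd ys"
    and "\<And>b Y. b \<in> P \<Longrightarrow> Y \<in> set ys \<Longrightarrow> b \<subseteq> Y \<or> b \<inter> Y = {}"
    and "\<And>b. b \<in> P \<Longrightarrow> b \<subseteq> {1..n}"
  shows "pp_le (P, Z) (flag_partition n ys)"
proof -
  have "\<exists>b'\<in>insert (hd ys) (gaps n ys). b \<subseteq> b'"
    if "ys \<noteq> []" "b \<subseteq> {1..n}" "\<And>Y. Y \<in> set ys \<Longrightarrow> b \<subseteq> Y \<or> b \<inter> Y = {}" for b ys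
    using that
  proof (induction n ys rule: gaps.induct)
    case (3 n Y Y' zs)
    have "\<exists>b'\<in>insert (hd (Y' # zs)) (gaps n (Y' # zs)). b \<subseteq> b'"
      by (rule "3.IH") (use "3.prems" in auto)
    moreover have "b \<subseteq> Y' - Y" if "b \<subseteq> Y'" "\<not> b \<subseteq> Y" using that "3.prems"(3)[of Y] by auto
    ultimately show ?case by auto
  qed auto
  then show ?thesis using assms unfolding pp_le_def flag_partition_def by simp
qed

lemma proper_subset_card: "Z \<in> proper_subsets n S \<Longrightarrow> card Z < n"
  using psubset_card_mono[of "{1..n}" Z] by (auto simp: proper_subsets_def)

text \<open>The sizes in a flag are tail sums, so its sets cut \<open>c\<close> into runs. The
  induction goes from the largest set down: \<open>l\<close> is the final segment not yet cut, and
  each smaller set cuts it once more. Types are multisets, so the order of the gaps is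
  immaterial.\<close>

lemma flag_runs:
  assumes "sum_list c = n"
  shows "ys \<in> flags n c \<Longrightarrow> ys \<noteq> [] \<Longrightarrow>
    \<exists>bl l. [] \<notin> set (bl @ [l]) \<and> concat (bl @ [l]) = c \<and> sum_list l = card (hd ys) \<and>
      mset (map sum_list bl) = image_mset card (mset_set (gaps n ys))"
proof (induction ys)
  case (Cons Z zs)
  then have Zp: "Z \<in> proper_subsets n (tail_sums c)" by (simp add: clists_Cons)
  then obtain i where i: "i < length c" "card Z = sum_list (drop i c)"
    by (auto simp: proper_subsets_def tail_sums_def)
  show ?case
  proof (cases zs)
    case Nil
    \<comment> \<open>\<open>i = 0\<close> would give \<open>Z\<close> the size \<open>n\<close>; so
      the prefix cut off is a nonempty run.\<close>
    have "i \<noteq> 0" using proper_subset_card[OF Zp] i assms by (cases i) auto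
    moreover have "sum_list (take i c) + sum_list (drop i c) = n"
      using assms by (metis append_take_drop_id sum_list_append)
    then have "sum_list (take i c) = card ({1..n} - Z)"
      using Zp i by (subst card_Diff_subset) (auto simp: proper_subsets_def intro: finite_subset)
    ultimately show ?thesis using i Nil
      by (intro exI[of _ "[take i c]"] exI[of _ "drop i c"]) (auto simp: mset_set_empty_iff)
  next
    case (Cons Z' zs')
    with Cons.prems have ch: "zs \<in> flags n c" "zs \<noteq> []" and sub: "Z \<subset> Z'" "Z' \<in> proper_subsets n (tail_sums c)"
      by (auto simp: clists_Cons)
    obtain bl l where bl: "[] \<notin> set (bl @ [l])" "concat (bl @ [l]) = c" "sum_list l = card Z'"
        "mset (map sum_list bl) = image_mset card (mset_set (gaps n zs))"
      using Cons.IH[OF ch] Cons by auto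
    have fin: "finite Z'" using sub by (auto simp: proper_subsets_def intro: finite_subset)
    have lt: "card Z < card Z'" using sub fin by (simp add: psubset_card_mono)
    \<comment> \<open>The position in \<open>c\<close> where \<open>l\<close> begins. A smaller set
      has a smaller tail sum, so the new cut falls strictly inside \<open>l\<close>.\<close>
    define m where "m = length (concat bl)"
    have c: "c = concat bl @ l" using bl by simp
    have im: "m < i"
    proof (rule ccontr)
      assume "\<not> m < i"
      then have "drop i c = drop i (concat bl) @ l" by (simp add: c m_def)
      then show False using i lt bl by simp
    qed
    define j where "j = i - m"
    have d: "drop i c = drop j l" using im by (simp add: c m_def j_def)
    have j: "0 < j" "j < length l" using im i by (auto simp: j_def c m_def)
    have "sum_list (take j l) + sum_list (drop j l) = card Z'"
      using bl by (metis append_take_drop_id sum_list_append)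
    then have s: "sum_list (take j l) = card (Z' - Z)"
      using i d sub fin by (subst card_Diff_subset) (auto intro: finite_subset)
    have "partition_on ({1..n} - Z') (gaps n zs)"
      using gaps_partition[OF ch] Cons by simp
    then have nin: "Z' - Z \<notin> gaps n zs" using sub by (auto simp: partition_on_def)
    have "finite (gaps n zs)" using card_gaps[OF ch(1)] by simp
    then have "image_mset card (mset_set (gaps n (Z # zs)))
        = add_mset (card (Z' - Z)) (image_mset card (mset_set (gaps n zs)))"
      using nin Cons by simp
    then show ?thesis
      using bl j d i s by (intro exI[of _ "bl @ [take j l]"] exI[of _ "drop j l"]) auto
  qed
qed simp

section \<open>Proper partitions of admissible type and the lengths of their chains\<close>

definition proper_partitions :: "nat \<Rightarrow> nat list \<Rightarrow> pointed_partition set"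
  where "proper_partitions n c = restricted_partitions n c - {pp_top n}"

lemma sum_list_concat: "sum_list (concat xss) = sum_list (map sum_list xss)"
  for xss :: "'a::monoid_add list list"
  by (induction xss) auto

lemma flag_partition_mem:
  assumes "sum_list c = n" "ys \<in> flags n c" "ys \<noteq> []"
  shows "flag_partition n ys \<in> proper_partitions n c"
proof -
  obtain bl l where bl: "[] \<notin> set (bl @ [l])" "concat (bl @ [l]) = c" "sum_list l = card (hd ys)"
      "mset (map sum_list bl) = image_mset card (mset_set (gaps n ys))"
    using flag_runs[OF assms] by blast
  have part: "partition_on ({1..n} - hd ys) (gaps n ys)" using gaps_partition assms by blast
  have fin: "finite (gaps n ys)" and ne: "gaps n ys \<noteq> {}"
    using card_gaps[OF assms(2)] assms(3) by auto
  define d where "d = map sum_list (bl @ [l])"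
  have "1 \<le> x" if "x \<in> set (map sum_list bl)" for x
  proof -
    have "x \<in># image_mset card (mset_set (gaps n ys))" using that bl(4) by (metis set_mset_mset)
    then obtain b where b: "b \<in> gaps n ys" "x = card b" using fin by auto
    then have "b \<noteq> {}" "b \<subseteq> {1..n}" using partition_onD1[OF part] partition_onD3[OF part] by blast+
    then have "card b > 0" by (simp add: card_gt_0_iff finite_subset[of b "{1..n}"])
    then show ?thesis using b by simp
  qed
  moreover have "sum_list d = n"
    using arg_cong[OF bl(2), of sum_list] assms(1) by (simp add: d_def sum_list_concat)
  ultimately have "pointed_composition n d"
    by (simp add: pointed_composition_def d_def butlast_append)
  moreover have "composition_le c d"
    unfolding composition_le_def d_def using bl by blast
  moreover have "pp_type (flag_partition n ys) = composition_type d"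
    using bl by (simp add: pp_type_def flag_partition_def composition_type_def d_def butlast_append)
  moreover have "hd ys \<subseteq> {1..n}"
    using assms(2,3) by (cases ys) (auto simp: clists_Cons proper_subsets_def)
  ultimately show ?thesis
    using part ne
    by (auto simp: proper_partitions_def restricted_partitions_def pointed_partitions_def
        flag_partition_def pp_top_def)
qed

lemma proper_partitions_pointed: "\<pi> \<in> proper_partitions n c \<Longrightarrow> \<pi> \<in> pointed_partitions n"
  by (simp add: proper_partitions_def restricted_partitions_def)

lemma pointed_block_mem:
  assumes "\<pi> \<in> proper_partitions n c"
  shows "snd \<pi> \<in> proper_subsets n (tail_sums c)"
proof -
  obtain P Z where \<pi>: "\<pi> = (P, Z)" by (cases \<pi>)
  from assms obtain d where d: "pointed_composition n d" "composition_le c d" "pp_type \<pi> = composition_type d"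
    by (auto simp: proper_partitions_def restricted_partitions_def)
  then obtain runs where runs: "[] \<notin> set runs" "concat runs = c" "map sum_list runs = d"
    by (auto simp: composition_le_def)
  have "d \<noteq> []" using d by (simp add: pointed_composition_def)
  then have ne: "runs \<noteq> []" using runs by auto
  have "card Z = sum_list (last runs)"
    using d(3) \<pi> runs(3) ne by (auto simp: pp_type_def composition_type_def last_map)
  moreover have cc: "c = concat (butlast runs) @ last runs"
    using ne runs(2) by (metis append_butlast_last_id concat_append concat.simps append_Nil2)
  moreover have "last runs \<noteq> []" using ne runs(1) by (metis last_in_set)
  ultimately have "card Z \<in> tail_sums c"
    unfolding tail_sums_def by (auto intro!: exI[of _ "length (concat (butlast runs))"])
  moreover have Z: "Z \<subseteq> {1..n}" "partition_on ({1..n} - Z) P"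
    using proper_partitions_pointed[OF assms] \<pi> by (auto simp: pointed_partitions_def)
  moreover have "Z \<noteq> {1..n}"
  proof
    assume "Z = {1..n}"
    with Z have "P = {}" by (simp add: partition_on_empty)
    with \<open>Z = {1..n}\<close> show False using assms \<pi> by (simp add: proper_partitions_def pp_top_def)
  qed
  ultimately show ?thesis by (simp add: \<pi> proper_subsets_def)
qed

text \<open>A coarsening of \<open>c\<close> has at most \<open>length c\<close> parts, the last of
  which is the pointed number; and only the top has no other block.\<close>

lemma proper_partitions_card:
  assumes "(P, Z) \<in> proper_partitions n c"
  shows "1 \<le> card P" "card P < length c"
proof -
  from assms obtain d where d: "pointed_composition n d" "composition_le c d" "pp_type (P, Z) = composition_type d"
    by (auto simp: proper_partitions_def restricted_partitions_def)
  then obtain runs where runs: "[] \<notin> set runs" "concat runs = c" "map sum_list runs = d"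
    by (auto simp: composition_le_def)
  have "length runs \<le> length (concat runs)"
    using runs(1)
  proof (induction runs)
    case (Cons r rs)
    then have "length r \<ge> 1" by (cases r) auto
    then show ?case using Cons by simp
  qed simp
  moreover have "card P = length d - 1"
    using arg_cong[OF d(3), of "\<lambda>t. size (fst t)"] by (simp add: pp_type_def composition_type_def)
  moreover have "d \<noteq> []" using d by (simp add: pointed_composition_def)
  ultimately show "card P < length c" using runs by (cases d) auto
  have p: "(P, Z) \<in> pointed_partitions n" using assms by (rule proper_partitions_pointed)
  have "P \<noteq> {}"
  proof
    assume "P = {}"
    then have "Z \<subseteq> {1..n}" "partition_on ({1..n} - Z) {}" using p by (auto simp: pointed_partitions_def)
    then have "Z = {1..n}" using partition_onD1[of "{1..n} - Z" "{}"] by blast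
    then show False using assms \<open>P = {}\<close> by (simp add: proper_partitions_def pp_top_def)
  qed
  then show "1 \<le> card P" using pointed_partitions_finite[OF p] by (simp add: Suc_le_eq card_gt_0_iff)
qed

text \<open>Each strict step loses a non-pointed block, and at least one is left at the end.\<close>

lemma clists_length_le:
  assumes "w \<in> clists (proper_partitions n c) pp_le" "w \<noteq> []"
  shows "length w \<le> card (fst (hd w))"
  using assms
proof (induction w)
  case (Cons \<pi> w)
  show ?case
  proof (cases w)
    case Nil
    then show ?thesis using Cons proper_partitions_card(1)[of "fst \<pi>" "snd \<pi>"] by (simp add: clists_Cons)
  next
    case w: (Cons \<pi>' w')
    have "pp_le \<pi> \<pi>'" "\<pi> \<noteq> \<pi>'" "\<pi> \<in> pointed_partitions n" "\<pi>' \<in> pointed_partitions n"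
      using Cons.prems w by (auto simp: clists_Cons proper_partitions_pointed)
    then have "card (fst \<pi>') < card (fst \<pi>)"
      using pp_le_card[of "fst \<pi>" "snd \<pi>" n "fst \<pi>'" "snd \<pi>'"]
      by (metis le_neq_implies_less prod.collapse)
    moreover have "length w \<le> card (fst (hd w))" using Cons w by (simp add: clists_Cons)
    ultimately show ?thesis using w by simp
  qed
qed simp

lemma no_long_chains: "c \<noteq> [] \<Longrightarrow> nclists (proper_partitions n c) pp_le (length c) = {}"
proof (rule ccontr)
  assume c: "c \<noteq> []" and "nclists (proper_partitions n c) pp_le (length c) \<noteq> {}"
  then obtain w where w: "w \<in> clists (proper_partitions n c) pp_le" "length w = length c"
    by (auto simp: nclists_def)
  then have ne: "w \<noteq> []" using c by auto
  then have "hd w \<in> proper_partitions n c" using w by (cases w) (auto simp: clists_Cons)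
  then show False
    using clists_length_le[OF w(1) ne] proper_partitions_card(2)[of "fst (hd w)" "snd (hd w)" n c] w
    by simp
qed

lemma chain_retraction_flags:
  assumes "sum_list c = n"
  shows "chain_retraction (proper_partitions n c) pp_le (proper_subsets n (tail_sums c)) (\<subseteq>)
    snd (flag_partition n)"
proof
  fix \<pi> \<pi>' :: pointed_partition
  assume "\<pi> \<in> proper_partitions n c" "\<pi>' \<in> proper_partitions n c" "pp_le \<pi> \<pi>'" "pp_le \<pi>' \<pi>"
  then show "\<pi> = \<pi>'" by (auto intro: pp_le_antisym proper_partitions_pointed)
next
  fix ys i assume ys: "ys \<in> flags n c" "i < length ys" "del i ys \<noteq> []"
  have ne: "ys \<noteq> []" using ys by auto
  have dF: "del i ys \<in> flags n c" using ys by (simp add: clists_del)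
  \<comment> \<open>Dropping a set coarsens: each gap of \<open>ys\<close> still lies on one side of
    every remaining set.\<close>
  have "pp_le (gaps n ys, hd ys) (flag_partition n (del i ys))"
  proof (rule le_flag_partition)
    have "hd (del i ys) \<in> set ys" using ys set_del_subset[of i ys] by (meson hd_in_set subsetD)
    then show "hd ys \<subseteq> hd (del i ys)" using ys ne by (cases ys) (auto simp: clists_Cons)
    show "b \<subseteq> Y \<or> b \<inter> Y = {}" if "b \<in> gaps n ys" "Y \<in> set (del i ys)" for b Y
      using that gaps_dichotomy[OF ys(1)] set_del_subset[of i ys] by blast
    show "b \<subseteq> {1..n}" if "b \<in> gaps n ys" for b
      using that gaps_partition[OF ys(1) ne] by (auto simp: partition_on_def)
  qed (use ys in auto)
  \<comment> \<open>Strictness: the number of gaps equals the length of the flag.\<close>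
  moreover have "gaps n ys \<noteq> gaps n (del i ys)"
    using card_gaps[OF ys(1)] card_gaps[OF dF] ys(2) length_del[OF ys(2)] by auto
  ultimately show "pp_le (flag_partition n ys) (flag_partition n (del i ys)) \<and>
      flag_partition n ys \<noteq> flag_partition n (del i ys)"
    by (auto simp: flag_partition_def)
next
  fix w assume w: "w \<in> clists (proper_partitions n c) pp_le" "w \<noteq> []"
  obtain P Z where h: "hd w = (P, Z)" by (cases "hd w")
  have le: "pp_le (P, Z) x" if "x \<in> set w" for x
    using w that h by (cases w) (auto simp: clists_Cons pp_le_refl)
  \<comment> \<open>Each set of the projected flag is the pointed block of a partition above
    \<open>hd w\<close>, so a block of \<open>hd w\<close> is absorbed by it or stays
    outside.\<close>
  have "pp_le (P, Z) (flag_partition n (map snd w))"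
  proof (rule le_flag_partition)
    show "Z \<subseteq> hd (map snd w)" using w h by (simp add: hd_map)
    show "b \<subseteq> Y \<or> b \<inter> Y = {}" if b: "b \<in> P" "Y \<in> set (map snd w)" for b Y
    proof -
      obtain P' where P': "(P', Y) \<in> set w" using b by auto
      then have "partition_on ({1..n} - Y) P'"
        using w clists_subset[OF w(1)] proper_partitions_pointed[of _ n c]
        by (force simp: pointed_partitions_def)
      then have P'n: "\<Union> P' = {1..n} - Y" by (rule partition_onD1[symmetric])
      obtain b' where b': "b' \<in> insert Y P'" "b \<subseteq> b'"
        using le[OF P'] b(1) by (rule pp_leD)
      show ?thesis
      proof (cases "b' = Y")
        case False
        then have "b' \<subseteq> {1..n} - Y" using b'(1) unfolding P'n[symmetric] by blast
        then show ?thesis using b'(2) by blast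
      qed (use b'(2) in simp)
    qed
    have "(P, Z) \<in> set w" using w h by (metis hd_in_set)
    then have "(P, Z) \<in> pointed_partitions n"
      using clists_subset[OF w(1)] proper_partitions_pointed by blast
    then show "b \<subseteq> {1..n}" if "b \<in> P" for b
      using that by (auto simp: pointed_partitions_def partition_on_def)
  qed (use w in simp)
  then show "pp_le (hd w) (flag_partition n (map snd w))" using h by simp
next
  fix ys assume ys: "ys \<in> flags n c" "ys \<noteq> []"
  then show "flag_partition n ys \<in> proper_partitions n c" by (rule flag_partition_mem[OF assms])
qed (auto simp: pp_le_refl pointed_block_mem flag_partition_def intro: pp_le_trans, auto simp: pp_le_def)

section \<open>Border strips\<close>

text \<open>Row \<open>0\<close> is the top one, hence belongs to the last part of \<open>c\<close>.
  \<open>link\<close> is what connectedness and the absence of squares amount to: consecutive rows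
  overlap in exactly the column \<open>\<mu> i\<close>.\<close>

locale border_strip =
  fixes n :: nat and c :: "nat list" and B :: "box set" and \<mu> \<kappa> :: "nat \<Rightarrow> nat"
  assumes c_ne: "c \<noteq> []" and c_pos: "\<forall>x\<in>set c. 1 \<le> x" and c_sum: "sum_list c = n"
    and B_iff: "(i, j) \<in> B \<longleftrightarrow> i < length c \<and> \<mu> i \<le> j \<and> j < \<kappa> i"
    and width: "i < length c \<Longrightarrow> \<kappa> i = \<mu> i + c ! (length c - 1 - i)"
    and link: "Suc i < length c \<Longrightarrow> \<kappa> (Suc i) = Suc (\<mu> i)"

lemma border_strip_of_imp:
  assumes "border_strip_of c B" and c: "c \<noteq> []" "\<forall>x\<in>set c. 1 \<le> x" "sum_list c = n"
  obtains \<mu> \<kappa> where "border_strip n c B \<mu> \<kappa>"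
proof -
  let ?k = "length c"
  from assms(1) obtain \<kappa> \<mu> where anti: "antimono \<kappa>" "antimono \<mu>"
    and B: "B = {(i, j). \<mu> i \<le> j \<and> j < \<kappa> i}"
    unfolding border_strip_of_def skew_shape_def partition_shape_def by blast
  have rows: "fst ` B = {..<?k}"
    and cards: "\<And>i. i < ?k \<Longrightarrow> card {j. (?k - 1 - i, j) \<in> B} = c ! i"
    and sq: "\<And>i j. \<not> {(i, j), (i, Suc j), (Suc i, j), (Suc i, Suc j)} \<subseteq> B"
    and conn: "\<And>x y. x \<in> B \<Longrightarrow> y \<in> B \<Longrightarrow> (x, y) \<in> (adjacent_boxes \<inter> B \<times> B)\<^sup>*"
    using assms(1) unfolding border_strip_of_def connected_shape_def by blast+
  have B_iff: "(i, j) \<in> B \<longleftrightarrow> i < ?k \<and> \<mu> i \<le> j \<and> j < \<kappa> i" for i j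
  proof -
    have "i < ?k" if "(i, j) \<in> B" using rows that by (metis fst_conv image_eqI lessThan_iff)
    then show ?thesis by (auto simp: B)
  qed
  have width: "\<kappa> i = \<mu> i + c ! (?k - 1 - i)" and lt: "\<mu> i < \<kappa> i" if i: "i < ?k" for i
  proof -
    have "i \<in> fst ` B" using rows i by simp
    then show "\<mu> i < \<kappa> i" by (auto simp: B)
    have "{j. (?k - 1 - (?k - 1 - i), j) \<in> B} = {\<mu> i..<\<kappa> i}"
      using i by (auto simp: B)
    then have "c ! (?k - 1 - i) = \<kappa> i - \<mu> i"
      using cards[of "?k - 1 - i"] i by simp
    with \<open>\<mu> i < \<kappa> i\<close> show "\<kappa> i = \<mu> i + c ! (?k - 1 - i)" by simp
  qed
  have link: "\<kappa> (Suc i) = Suc (\<mu> i)" if i: "Suc i < ?k" for i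
  proof (rule antisym)
    have "\<kappa> (Suc i) \<le> \<kappa> i" "\<mu> (Suc i) \<le> \<mu> i" using anti by (simp_all add: antimono_def)
    \<comment> \<open>Two common columns would produce a square of four boxes, as row ends weakly
      decrease downwards.\<close>
    then show "\<kappa> (Suc i) \<le> Suc (\<mu> i)"
      using sq[of i "\<mu> i"] i lt[of i] by (auto simp: B_iff)
    show "Suc (\<mu> i) \<le> \<kappa> (Suc i)"
    proof (rule ccontr)
      assume neg: "\<not> Suc (\<mu> i) \<le> \<kappa> (Suc i)"
      have "(Suc i, \<mu> (Suc i)) \<in> B" "(i, \<mu> i) \<in> B" using i lt by (auto simp: B_iff)
      then have "((Suc i, \<mu> (Suc i)), (i, \<mu> i)) \<in> (adjacent_boxes \<inter> B \<times> B)\<^sup>*" by (rule conn)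
      \<comment> \<open>Without a common column, a path that starts in row \<open>Suc i\<close> can
        never climb to row \<open>i\<close>; the invariant is that its row index exceeds
        \<open>i\<close>.\<close>
      then have "i < fst (i, \<mu> i)"
      proof (induction rule: rtrancl_induct)
        case (step y z)
        from step(2,3) neg show ?case
          by (cases y; cases z; cases "fst z = i") (auto simp: adjacent_boxes_def B_iff)
      qed simp
      then show False by simp
    qed
  qed
  show ?thesis
    by (rule that[of \<mu> \<kappa>], unfold_locales) (fact c B_iff width link)+
qed

section \<open>Tableaux and their flags of subsets\<close>

context border_strip
begin

definition low :: "nat \<Rightarrow> box set"
  where "low j = {x \<in> B. fst x \<le> j}"

lemma low_subset: "low j \<subseteq> B"
  by (auto simp: low_def)

lemma c_nth_pos: "i < length c \<Longrightarrow> 1 \<le> c ! i"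
  using c_pos by simp

lemma \<mu>_less_\<kappa>: "i < length c \<Longrightarrow> \<mu> i < \<kappa> i"
proof -
  assume i: "i < length c"
  then have "length c - 1 - i < length c" by arith
  then show ?thesis using width[OF i] c_nth_pos[of "length c - 1 - i"] by simp
qed

lemma \<mu>_Suc: "Suc i < length c \<Longrightarrow> \<mu> (Suc i) \<le> \<mu> i"
  using \<mu>_less_\<kappa>[of "Suc i"] link[of i] by simp

lemma \<kappa>_antimono: "i \<le> j \<Longrightarrow> j < length c \<Longrightarrow> \<kappa> j \<le> \<kappa> i"
proof (induction j rule: dec_induct)
  case (step j)
  then show ?case using link[of j] \<mu>_less_\<kappa>[of j] by simp
qed simp

lemma row_eq: "i < length c \<Longrightarrow> {x \<in> B. fst x = i} = Pair i ` {\<mu> i..<\<kappa> i}"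
  by (auto simp: B_iff)

lemma card_row: "i < length c \<Longrightarrow> card {x \<in> B. fst x = i} = c ! (length c - 1 - i)"
  by (simp add: row_eq card_image inj_on_def width)

lemma finite_B: "finite B"
proof -
  have "B \<subseteq> (\<Union>i<length c. Pair i ` {\<mu> i..<\<kappa> i})" by (auto simp: B_iff)
  then show ?thesis by (rule finite_subset) auto
qed

lemma low_0: "low 0 = {x \<in> B. fst x = 0}"
  by (auto simp: low_def)

lemma low_Suc: "low (Suc j) = low j \<union> {x \<in> B. fst x = Suc j}"
  by (auto simp: low_def)

lemma low_last: "low (length c - 1) = B"
  using c_ne by (cases c) (auto simp: low_def B_iff)

lemma card_low: "j < length c \<Longrightarrow> card (low j) = sum_list (drop (length c - 1 - j) c)"
proof (induction j)
  case 0
  have "drop (length c - 1) c = [c ! (length c - 1)]"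
    using c_ne Cons_nth_drop_Suc[of "length c - 1" c] by (cases c) auto
  then show ?case using card_row[of 0] 0 by (simp add: low_0)
next
  case (Suc j)
  have d: "drop (length c - 1 - Suc j) c = c ! (length c - 1 - Suc j) # drop (length c - 1 - j) c"
    using Suc.prems Cons_nth_drop_Suc[of "length c - 1 - Suc j" c] by (simp add: Suc_diff_Suc)
  have "card (low (Suc j)) = card (low j) + card {x \<in> B. fst x = Suc j}"
    unfolding low_Suc using finite_B
    by (intro card_Un_disjoint) (auto simp: low_def)
  then show ?case using Suc card_row[of "Suc j"] d by simp
qed

lemma card_B: "card B = n"
  using card_low[of "length c - 1"] c_ne c_sum unfolding low_last by simp

lemma low_psubset:
  assumes "i < j" "j < length c"
  shows "low i \<subset> low j"
proof -
  have "(j, \<mu> j) \<in> low j" "(j, \<mu> j) \<notin> low i"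
    using assms \<mu>_less_\<kappa> by (auto simp: low_def B_iff)
  moreover have "low i \<subseteq> low j" using assms by (auto simp: low_def)
  ultimately show ?thesis by blast
qed

text \<open>Accumulating rows from the top makes the sizes tail sums of \<open>c\<close>. The union
  of all rows is left out, being \<open>[n]\<close> for every tableau, so
  \<open>length c - 1\<close> sets remain.\<close>

definition flag :: "(box \<Rightarrow> nat) \<Rightarrow> nat set list"
  where "flag t = map (\<lambda>j. t ` low j) [0..<length c - 1]"

abbreviation "top_flags \<equiv> nclists (proper_subsets n (tail_sums c)) (\<subseteq>) (length c - 1)"

lemma tableauxD:
  assumes "t \<in> tableaux B n"
  shows "inj_on t B" "t ` B = {1..n}"
  using assms by (auto simp: tableaux_def bij_betw_def)

lemma flag_top_flags:
  assumes t: "t \<in> tableaux B n"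
  shows "flag t \<in> top_flags"
proof -
  have im: "t ` low i \<subset> t ` low j" if "i < j" "j < length c" for i j
    using low_psubset[OF that] inj_on_subset[OF tableauxD(1)[OF t] low_subset]
    by (intro image_strict_mono)
  have "t ` low j \<in> proper_subsets n (tail_sums c)" if j: "j < length c - 1" for j
  proof -
    have "t ` low j \<subset> {1..n}"
      using im[of j "length c - 1"] j c_ne unfolding low_last tableauxD(2)[OF t] by simp
    moreover have "card (t ` low j) = sum_list (drop (length c - 1 - j) c)"
      using card_low[of j] j tableauxD(1)[OF t] low_subset[of j]
      by (subst card_image) (auto intro: inj_on_subset)
    ultimately show ?thesis
      using j unfolding proper_subsets_def tail_sums_def by auto
  qed
  then have "set (flag t) \<subseteq> proper_subsets n (tail_sums c)" by (auto simp: flag_def)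
  moreover have "sorted_wrt (\<lambda>X Y. X \<subseteq> Y \<and> X \<noteq> Y) (flag t)"
    unfolding flag_def sorted_wrt_iff_nth_less
  proof (intro allI impI)
    fix i j assume ij: "i < j" "j < length (map (\<lambda>j. t ` low j) [0..<length c - 1])"
    then have "t ` low i \<subset> t ` low j" by (intro im) auto
    then show "map (\<lambda>j. t ` low j) [0..<length c - 1] ! i \<subseteq> map (\<lambda>j. t ` low j) [0..<length c - 1] ! j \<and>
        map (\<lambda>j. t ` low j) [0..<length c - 1] ! i \<noteq> map (\<lambda>j. t ` low j) [0..<length c - 1] ! j"
      using ij by auto
  qed
  ultimately show ?thesis
    by (simp add: nclists_def clists_def) (simp add: flag_def)
qed

lemma flag_act: "flag (restrict (\<sigma> \<circ> t) B) = map ((`) \<sigma>) (flag t)"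
proof -
  have "restrict (\<sigma> \<circ> t) B ` low j = \<sigma> ` t ` low j" for j
    using low_subset[of j] by (force simp: image_iff)
  then show ?thesis by (simp add: flag_def)
qed

lemma act_tableaux:
  assumes "t \<in> tableaux B n" "\<sigma> permutes {1..n}"
  shows "restrict (\<sigma> \<circ> t) B \<in> tableaux B n"
  using assms bij_betw_trans[of t B "{1..n}" \<sigma> "{1..n}"] permutes_imp_bij[of \<sigma> "{1..n}"]
  by (auto simp: tableaux_def cong: bij_betw_cong)

text \<open>The flag determines the row of an entry: it is the least \<open>j\<close> whose set
  contains it, or the bottom row if there is none.\<close>

lemma flag_eq_imp_row_eq:
  assumes t: "t \<in> tableaux B n" "t' \<in> tableaux B n" and eq: "flag t = flag t'"
    and x: "x \<in> B" "y \<in> B" "t x = t' y"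
  shows "fst x = fst y"
proof -
  have im: "t ` low j = t' ` low j" if "j < length c - 1" for j
    using arg_cong[OF eq, of "\<lambda>ys. ys ! j"] that by (simp add: flag_def)
  have iff: "fst z \<le> j \<longleftrightarrow> s z \<in> s ` low j" if "s \<in> tableaux B n" "z \<in> B" for s z j
    using inj_on_image_mem_iff[OF tableauxD(1)[OF that(1)] that(2) low_subset] that(2)
    by (simp add: low_def)
  have "fst x \<le> j \<longleftrightarrow> fst y \<le> j" if "j < length c - 1" for j
    using iff[OF t(1) x(1)] iff[OF t(2) x(2)] im[OF that] x(3) by simp
  moreover have "fst x \<le> length c - 1" "fst y \<le> length c - 1"
    using x by (cases x, cases y, auto simp: B_iff)+
  ultimately show ?thesis by (metis le_antisym le_neq_implies_less le_refl)
qed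

definition flag_tabloid :: "nat set list \<Rightarrow> (box \<Rightarrow> nat) set"
  where "flag_tabloid ys = {t \<in> tableaux B n. flag t = ys}"

text \<open>Row permutations fix every \<open>low j\<close>. Conversely, equal flags place each
  number in the same row, so matching equal entries of \<open>t\<close> and \<open>t'\<close> is a
  row-preserving permutation of the boxes.\<close>

lemma tabloid_eq:
  assumes t: "t \<in> tableaux B n"
  shows "tabloid B n t = flag_tabloid (flag t)"
proof (intro equalityI subsetI)
  fix t' assume "t' \<in> tabloid B n t"
  then obtain \<rho> where t': "t' \<in> tableaux B n" and \<rho>: "\<rho> permutes B" "\<forall>x\<in>B. fst (\<rho> x) = fst x" "t' = t \<circ> \<rho>"
    by (auto simp: tabloid_def row_equiv_def)
  have "\<rho> ` low j = low j" for j
  proof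
    show "\<rho> ` low j \<subseteq> low j"
      using \<rho> permutes_in_image[OF \<rho>(1)] by (auto simp: low_def)
    show "low j \<subseteq> \<rho> ` low j"
    proof
      fix y assume y: "y \<in> low j"
      then obtain x where "x \<in> B" "y = \<rho> x"
        using permutes_image[OF \<rho>(1)] low_subset by blast
      then show "y \<in> \<rho> ` low j" using \<rho>(2) y by (auto simp: low_def)
    qed
  qed
  then have "flag t' = flag t" unfolding flag_def \<rho>(3) by (metis image_comp)
  then show "t' \<in> flag_tabloid (flag t)" using t' by (simp add: flag_tabloid_def)
next
  fix t' assume "t' \<in> flag_tabloid (flag t)"
  then have t': "t' \<in> tableaux B n" and eq: "flag t' = flag t" by (auto simp: flag_tabloid_def)
  define \<rho> where "\<rho> x = (if x \<in> B then inv_into B t (t' x) else x)" for x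
  have bt: "bij_betw t B {1..n}" "bij_betw t' B {1..n}" using t t' by (auto simp: tableaux_def)
  have "bij_betw (inv_into B t \<circ> t') B B"
    using bt(2) bij_betw_inv_into[OF bt(1)] by (rule bij_betw_trans)
  then have "bij_betw \<rho> B B" by (rule bij_betw_cong[THEN iffD1, rotated]) (simp add: \<rho>_def)
  then have "\<rho> permutes B" by (rule bij_imp_permutes) (simp add: \<rho>_def)
  moreover have t\<rho>: "t (\<rho> x) = t' x" "\<rho> x \<in> B" if "x \<in> B" for x
  proof -
    have "t' x \<in> t ` B" using tableauxD(2)[OF t] tableauxD(2)[OF t'] that by blast
    then show "t (\<rho> x) = t' x" "\<rho> x \<in> B"
      using that by (simp_all add: \<rho>_def f_inv_into_f inv_into_into)
  qed
  moreover have "fst (\<rho> x) = fst x" if "x \<in> B" for x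
    using flag_eq_imp_row_eq[OF t t' eq[symmetric] t\<rho>(2)[OF that] that t\<rho>(1)[OF that]] .
  moreover have "t' = t \<circ> \<rho>"
  proof
    fix x
    show "t' x = (t \<circ> \<rho>) x"
      using t\<rho>(1) t t' extensional_arb[of t B x] extensional_arb[of t' B x]
      by (cases "x \<in> B") (simp_all add: \<rho>_def tableaux_def)
  qed
  ultimately show "t' \<in> tabloid B n t" using t t' by (auto simp: tabloid_def row_equiv_def)
qed

lemma flag_tabloid_act:
  assumes \<sigma>: "\<sigma> permutes {1..n}"
  shows "tabloid_act B \<sigma> (flag_tabloid ys) = flag_tabloid (map ((`) \<sigma>) ys)"
proof (intro equalityI subsetI)
  fix t assume "t \<in> tabloid_act B \<sigma> (flag_tabloid ys)"
  then show "t \<in> flag_tabloid (map ((`) \<sigma>) ys)"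
    using act_tableaux[OF _ \<sigma>] by (auto simp: tabloid_act_def flag_tabloid_def flag_act)
next
  fix t assume "t \<in> flag_tabloid (map ((`) \<sigma>) ys)"
  then have t: "t \<in> tableaux B n" "flag t = map ((`) \<sigma>) ys" by (auto simp: flag_tabloid_def)
  let ?t = "restrict (inv_into UNIV \<sigma> \<circ> t) B"
  have "?t \<in> tableaux B n" by (rule act_tableaux[OF t(1) permutes_inv[OF \<sigma>]])
  moreover have "flag ?t = ys"
    using permutes_inverses(2)[OF \<sigma>] unfolding flag_act t(2)
    by (simp add: image_comp comp_def map_idI)
  moreover have "restrict (\<sigma> \<circ> ?t) B = t"
    using t(1) permutes_inverses(1)[OF \<sigma>] by (auto simp: tableaux_def extensional_def fun_eq_iff)
  ultimately show "t \<in> tabloid_act B \<sigma> (flag_tabloid ys)"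
    unfolding tabloid_act_def flag_tabloid_def by (intro image_eqI[of _ _ ?t]) simp_all
qed

end

text \<open>Composition with \<open>\<tau>\<close> matches even with odd elements of
  \<open>C\<close>. Showing only that the sum equals its own negative would be inconclusive in
  characteristic 2.\<close>

lemma sum_sign_cancel:
  fixes g :: "(nat \<Rightarrow> nat) \<Rightarrow> 'x \<Rightarrow> 'k::field"
  assumes fin: "finite C" and \<tau>: "\<tau> \<circ> \<tau> = id"
    and C: "\<And>\<gamma>. \<gamma> \<in> C \<Longrightarrow> \<gamma> \<circ> \<tau> \<in> C \<and> sign (\<gamma> \<circ> \<tau>) = - sign \<gamma> \<and> g (\<gamma> \<circ> \<tau>) = g \<gamma>"
  shows "(\<Sum>\<gamma>\<in>C. fscale (of_int (sign \<gamma>)) (g \<gamma>)) = 0"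
proof -
  let ?E = "{\<gamma> \<in> C. sign \<gamma> = 1}" and ?O = "{\<gamma> \<in> C. sign \<gamma> = -1}"
  have split: "C = ?E \<union> ?O" by (auto intro: sign_cases)
  have inv: "\<gamma> \<circ> \<tau> \<circ> \<tau> = \<gamma>" for \<gamma> :: "nat \<Rightarrow> nat" using \<tau> by (simp add: comp_assoc)
  have bij: "bij_betw (\<lambda>\<gamma>. \<gamma> \<circ> \<tau>) ?E ?O"
    by (rule bij_betw_byWitness[of _ "\<lambda>\<gamma>. \<gamma> \<circ> \<tau>"]) (use C inv in auto)
  have "(\<Sum>\<gamma>\<in>?O. fscale (of_int (sign \<gamma>)) (g \<gamma>))
      = (\<Sum>\<gamma>\<in>?E. fscale (of_int (sign (\<gamma> \<circ> \<tau>))) (g (\<gamma> \<circ> \<tau>)))"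
    by (rule sum.reindex_bij_betw[OF bij, symmetric])
  also have "\<dots> = (\<Sum>\<gamma>\<in>?E. - fscale (of_int (sign \<gamma>)) (g \<gamma>))"
    using C by (intro sum.cong) (auto simp: fun_eq_iff)
  also have "\<dots> = - (\<Sum>\<gamma>\<in>?E. fscale (of_int (sign \<gamma>)) (g \<gamma>))"
    by (rule sum_negf)
  finally have "(\<Sum>\<gamma>\<in>?O. fscale (of_int (sign \<gamma>)) (g \<gamma>))
      = - (\<Sum>\<gamma>\<in>?E. fscale (of_int (sign \<gamma>)) (g \<gamma>))" .
  moreover have "(\<Sum>\<gamma>\<in>C. fscale (of_int (sign \<gamma>)) (g \<gamma>))
      = (\<Sum>\<gamma>\<in>?E. fscale (of_int (sign \<gamma>)) (g \<gamma>)) + (\<Sum>\<gamma>\<in>?O. fscale (of_int (sign \<gamma>)) (g \<gamma>))"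
    using fin by (subst split, subst sum.union_disjoint) auto
  ultimately show ?thesis by simp
qed

lemma del_map_upt_cong:
  assumes "\<And>j. j < m \<Longrightarrow> j \<noteq> i \<Longrightarrow> f j = g j" "i < m"
  shows "del i (map f [0..<m]) = del i (map g [0..<m])"
  using assms by (auto simp: del_def take_map drop_map drop_upt take_upt)

text \<open>The common part cancels, and what is left has equally many elements on both sides. This
  drives both weight comparisons: within a column of a tableau, and between two flags differing in
  one set.\<close>

lemma sum_less_exchange:
  fixes U U' :: "nat set"
  assumes fin: "finite U" "finite U'" and card: "card U = card U'" and ne: "U \<noteq> U'"
    and less: "\<And>a b. a \<in> U - U' \<Longrightarrow> b \<in> U' - U \<Longrightarrow> a < b"
  shows "\<Sum>U < \<Sum>U'"
proof -
  have c: "card (U - U') = card (U' - U)"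
    using card_Diff_subset_Int[of U U'] card_Diff_subset_Int[of U' U] fin card by (simp add: Int_commute)
  have U: "\<Sum>U = \<Sum>(U - U') + \<Sum>(U \<inter> U')" and U': "\<Sum>U' = \<Sum>(U' - U) + \<Sum>(U \<inter> U')"
    using sum.Int_Diff[OF fin(1), of "\<lambda>x. x" U'] sum.Int_Diff[OF fin(2), of "\<lambda>x. x" U]
    by (simp_all add: Int_commute)
  have "U - U' \<noteq> {}"
  proof
    assume "U - U' = {}"
    then have "U \<subseteq> U'" by blast
    then show False using card_subset_eq[OF fin(2)] card ne by blast
  qed
  then have pos: "card (U - U') > 0" and Max: "Max (U - U') \<in> U - U'"
    using fin Max_in[of "U - U'"] by (simp_all add: card_gt_0_iff)
  have "\<Sum>(U - U') \<le> of_nat (card (U - U')) * Max (U - U')"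
    using fin by (intro sum_bounded_above) auto
  \<comment> \<open>Every element of \<open>U' - U\<close> exceeds the maximum of
    \<open>U - U'\<close>, hence is at least its successor.\<close>
  also have "\<dots> < of_nat (card (U' - U)) * Suc (Max (U - U'))"
    using pos c by simp
  also have "\<dots> \<le> \<Sum>(U' - U)"
    using less[OF Max] by (intro sum_bounded_below) (auto simp: Suc_le_eq)
  finally show ?thesis using U U' by simp
qed

section \<open>Polytabloids as cycles of flags\<close>

context border_strip
begin

definition flag_polytabloid :: "(box \<Rightarrow> nat) \<Rightarrow> nat set list \<Rightarrow> 'k::field"
  where "flag_polytabloid t = (\<Sum>\<gamma>\<in>column_stabilizer B n t.
    fscale (of_int (sign \<gamma>)) (basis_vec (map ((`) \<gamma>) (flag t))))"

lemma finite_column_stabilizer: "finite (column_stabilizer B n t)"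
  by (rule finite_subset[OF _ finite_permutations[of "{1..n}"]]) (auto simp: column_stabilizer_def)

lemma column_stabilizerD:
  assumes "\<gamma> \<in> column_stabilizer B n t"
  shows "\<gamma> permutes {1..n}" "\<gamma> ` t ` {x \<in> B. snd x = q} = t ` {x \<in> B. snd x = q}"
  using assms by (auto simp: column_stabilizer_def)

lemma id_column_stabilizer: "id \<in> column_stabilizer B n t"
  by (simp add: column_stabilizer_def permutes_id)

lemma map_flag_top_flags:
  assumes "t \<in> tableaux B n" "\<gamma> permutes {1..n}"
  shows "map ((`) \<gamma>) (flag t) \<in> top_flags"
  using flag_top_flags[OF act_tableaux[OF assms]] by (simp only: flag_act)

lemma flag_polytabloid_free:
  assumes "t \<in> tableaux B n"
  shows "flag_polytabloid t \<in> free_space top_flags"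
  unfolding flag_polytabloid_def using assms
  by (intro free_space_sum free_space_scale free_space_basis map_flag_top_flags)
    (auto dest: column_stabilizerD)

text \<open>
  Consecutive rows share a column, and exchanging its two entries there changes only one set of
  the flag.
\<close>

lemma flag_polytabloid_face:
  assumes t: "t \<in> tableaux B n" and i: "i < length c - 1"
  shows "(\<Sum>\<gamma>\<in>column_stabilizer B n t.
    fscale (of_int (sign \<gamma>)) (basis_vec (del i (map ((`) \<gamma>) (flag t))) :: nat set list \<Rightarrow> 'k::field)) = 0"
proof (rule sum_sign_cancel[OF finite_column_stabilizer])
  let ?x = "(i, \<mu> i)" and ?y = "(Suc i, \<mu> i)"
  let ?\<tau> = "transpose (t ?x) (t ?y)"
  have xy: "?x \<in> B" "?y \<in> B"
    using i \<mu>_less_\<kappa>[of i] link[of i] \<mu>_Suc[of i] by (auto simp: B_iff)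
  note inj = tableauxD(1)[OF t] and im = tableauxD(2)[OF t]
  have ne: "t ?x \<noteq> t ?y" using inj_onD[OF inj _ xy] by auto
  have mem: "t ?x \<in> {1..n}" "t ?y \<in> {1..n}" using xy im by blast+
  have perm: "?\<tau> permutes {1..n}" using mem by (rule permutes_swap_id)
  have stable: "?\<tau> ` t ` A = t ` A" if "A \<subseteq> B" "?x \<in> A \<longleftrightarrow> ?y \<in> A" for A
    using inj_on_image_mem_iff[OF inj xy(1) that(1)] inj_on_image_mem_iff[OF inj xy(2) that(1)] that(2)
    by (intro transpose_image_eq) simp
  show "?\<tau> \<circ> ?\<tau> = id" by simp
  fix \<gamma> assume \<gamma>: "\<gamma> \<in> column_stabilizer B n t"
  have "?\<tau> ` t ` {x \<in> B. snd x = q} = t ` {x \<in> B. snd x = q}" for q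
    using xy by (intro stable) auto
  then have "(\<gamma> \<circ> ?\<tau>) ` t ` {x \<in> B. snd x = q} = t ` {x \<in> B. snd x = q}" for q
    using column_stabilizerD(2)[OF \<gamma>] by (metis image_comp)
  moreover have "\<gamma> \<circ> ?\<tau> permutes {1..n}"
    using perm column_stabilizerD(1)[OF \<gamma>] by (rule permutes_compose)
  ultimately have "\<gamma> \<circ> ?\<tau> \<in> column_stabilizer B n t"
    by (simp only: column_stabilizer_def mem_Collect_eq simp_thms)
  moreover have "sign (\<gamma> \<circ> ?\<tau>) = - sign \<gamma>"
    using ne column_stabilizerD(1)[OF \<gamma>]
      permutation_permutes[of \<gamma>] sign_compose[of \<gamma> ?\<tau>] sign_swap_id[of "t ?x" "t ?y"]
    by (metis finite_atLeastAtMost mult.right_neutral mult_minus_right permutation_swap_id)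
  moreover have "del i (map ((`) (\<gamma> \<circ> ?\<tau>)) (flag t)) = del i (map ((`) \<gamma>) (flag t))"
  proof -
    \<comment> \<open>\<open>?x\<close> and \<open>?y\<close> lie in rows \<open>i\<close> and
      \<open>Suc i\<close>, so \<open>low i\<close> is the only one that separates them.\<close>
    have "?\<tau> ` t ` low j = t ` low j" if "j \<noteq> i" for j
      using xy that by (intro stable low_subset) (auto simp: low_def)
    then have "(\<gamma> \<circ> ?\<tau>) ` t ` low j = \<gamma> ` t ` low j" if "j \<noteq> i" for j
      using that by (metis image_comp)
    then show ?thesis
      unfolding flag_def map_map using i by (intro del_map_upt_cong) (simp_all only: o_apply)
  qed
  ultimately show "\<gamma> \<circ> ?\<tau> \<in> column_stabilizer B n t \<and> sign (\<gamma> \<circ> ?\<tau>) = - sign \<gamma> \<and>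
      basis_vec (del i (map ((`) (\<gamma> \<circ> ?\<tau>)) (flag t)))
      = (basis_vec (del i (map ((`) \<gamma>) (flag t))) :: nat set list \<Rightarrow> 'k)"
    by simp
qed

lemma boundary_flag_polytabloid:
  assumes t: "t \<in> tableaux B n"
  shows "boundary (flag_polytabloid t) = (0 :: nat set list \<Rightarrow> 'k::field)"
proof -
  let ?C = "column_stabilizer B n t"
  let ?d = "\<lambda>i \<gamma>. basis_vec (del i (map ((`) \<gamma>) (flag t))) :: nat set list \<Rightarrow> 'k"
  have "boundary (flag_polytabloid t)
      = (\<Sum>\<gamma>\<in>?C. fscale (of_int (sign \<gamma>)) (bd (map ((`) \<gamma>) (flag t)) :: nat set list \<Rightarrow> 'k))"
    unfolding flag_polytabloid_def boundary_eq
    by (subst lin_ext_sum) (simp_all add: lin_ext_scale free_space_scale free_space_basis)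
  also have "\<dots> = (\<Sum>\<gamma>\<in>?C. \<Sum>i<length c - 1. fscale (of_int (sign \<gamma>)) (fscale ((-1) ^ i) (?d i \<gamma>)))"
    unfolding bd_def by (simp add: fun_space.scale_sum_right flag_def)
  also have "\<dots> = (\<Sum>i<length c - 1. \<Sum>\<gamma>\<in>?C. fscale ((-1) ^ i) (fscale (of_int (sign \<gamma>)) (?d i \<gamma>)))"
    by (subst sum.swap) (simp add: mult.commute)
  also have "\<dots> = (\<Sum>i<length c - 1. fscale ((-1) ^ i) (\<Sum>\<gamma>\<in>?C. fscale (of_int (sign \<gamma>)) (?d i \<gamma>)))"
    by (simp only: fun_space.scale_sum_right)
  also have "\<dots> = (\<Sum>i<length c - 1. fscale ((-1) ^ i) 0)"
    using flag_polytabloid_face[OF t] by (intro sum.cong refl arg_cong2[of _ _ _ _ fscale]) auto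
  also have "\<dots> = 0" by (simp only: fun_space.scale_zero_right sum.neutral_const)
  finally show ?thesis .
qed

section \<open>Row-sorted fillings of maximal flags\<close>

definition level :: "nat set list \<Rightarrow> nat \<Rightarrow> nat set"
  where "level ys j = (if j < length c - 1 then ys ! j else {1..n})"

text \<open>Since \<open>level\<close> completes the flag by \<open>[n]\<close>, these are the row
  contents of the tabloid belonging to \<open>ys\<close>, bottom row included.\<close>

definition block :: "nat set list \<Rightarrow> nat \<Rightarrow> nat set"
  where "block ys j = level ys j - (if j = 0 then {} else level ys (j - 1))"

lemma tail_sum_less: "i < j \<Longrightarrow> j \<le> length c \<Longrightarrow> sum_list (drop j c) < sum_list (drop i c)"
proof (induction j rule: less_Suc_induct)
  case (1 i)
  then show ?case using c_nth_pos[of i] by (subst Cons_nth_drop_Suc[symmetric, of i]) auto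
qed auto

text \<open>The set sizes of a maximal flag are forced, because there are only \<open>length c - 1\<close> admissible ones.\<close>

lemma card_top_flag:
  assumes ys: "ys \<in> top_flags" and j: "j < length c - 1"
  shows "card (ys ! j) = sum_list (drop (length c - 1 - j) c)"
proof -
  let ?m = "length c - 1"
  define T where "T j = sum_list (drop (?m - j) c)" for j
  have len: "length ys = ?m" and ch: "ys \<in> flags n c" using ys by (auto simp: nclists_def)
  have T: "T i < T j" if "i < j" "j \<le> ?m" for i j
    using tail_sum_less[of "?m - j" "?m - i"] that c_ne unfolding T_def by (cases c) auto
  have sub: "set (map card ys) \<subseteq> T ` {..<?m}"
  proof
    fix a assume "a \<in> set (map card ys)"
    then obtain Z where Z: "Z \<in> proper_subsets n (tail_sums c)" "a = card Z"
      using clists_subset[OF ch] by auto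
    then obtain i where i: "i < length c" "a = sum_list (drop i c)"
      by (auto simp: proper_subsets_def tail_sums_def)
    \<comment> \<open>Size \<open>n\<close> drops out, leaving exactly \<open>?m\<close> admissible
      sizes.\<close>
    have "i \<noteq> 0" using proper_subset_card[OF Z(1)] Z(2) i(2) c_sum by (cases i) auto
    then show "a \<in> T ` {..<?m}"
      using i by (intro image_eqI[of _ _ "?m - i"]) (auto simp: T_def)
  qed
  have s1: "sorted_wrt (<) (map card ys)"
  proof -
    have "card X < card Y" if "X \<in> set ys" "Y \<in> set ys" "X \<subseteq> Y \<and> X \<noteq> Y" for X Y
    proof (rule psubset_card_mono)
      have "Y \<subseteq> {1..n}" using that clists_subset[OF ch] by (auto simp: proper_subsets_def)
      then show "finite Y" by (rule finite_subset) simp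
    qed (use that in blast)
    then show ?thesis
      using ch by (simp add: clists_def sorted_wrt_iff_nth_less)
  qed
  have s2: "sorted_wrt (<) (map T [0..<?m])"
    unfolding sorted_wrt_iff_nth_less using T by simp
  have s3: "set (map card ys) = set (map T [0..<?m])"
  proof (rule card_subset_eq)
    show "set (map card ys) \<subseteq> set (map T [0..<?m])" using sub by auto
    have "card (set (map card ys)) = ?m"
      using s1 len distinct_card[of "map card ys"] unfolding strict_sorted_iff by simp
    moreover have "card (set (map T [0..<?m])) = ?m"
      using s2 distinct_card[of "map T [0..<?m]"] unfolding strict_sorted_iff by simp
    ultimately show "card (set (map card ys)) = card (set (map T [0..<?m]))" by simp
  qed simp
  have "map card ys = map T [0..<?m]"
    by (rule strict_sorted_equal[OF s2 s1 s3])
  then have "map card ys ! j = map T [0..<?m] ! j" by simp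
  then show ?thesis using j len by (simp add: T_def)
qed

lemma level_subset:
  assumes "ys \<in> top_flags"
  shows "level ys j \<subseteq> {1..n}"
proof (cases "j < length c - 1")
  case True
  then have "ys ! j \<in> proper_subsets n (tail_sums c)"
    using assms by (auto simp: nclists_def dest!: clists_subset)
  then show ?thesis using True by (simp add: level_def proper_subsets_def)
qed (simp add: level_def)

lemma card_level:
  assumes "ys \<in> top_flags" "j < length c"
  shows "card (level ys j) = sum_list (drop (length c - 1 - j) c)"
proof (cases "j < length c - 1")
  case False
  then have "j = length c - 1" using assms(2) by simp
  then show ?thesis using c_sum by (simp add: level_def)
qed (use card_top_flag[OF assms(1)] in \<open>simp add: level_def\<close>)

lemma level_mono:
  assumes ys: "ys \<in> top_flags" and ij: "i \<le> j"
  shows "level ys i \<subseteq> level ys j"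
proof (cases "i < j \<and> j < length c - 1")
  case True
  then have "ys ! i \<subseteq> ys ! j"
    using ys by (auto simp: nclists_def clists_def sorted_wrt_iff_nth_less)
  then show ?thesis using True by (simp add: level_def)
next
  case False
  then show ?thesis using ij level_subset[OF ys, of i] by (auto simp: level_def)
qed

lemma finite_block: "ys \<in> top_flags \<Longrightarrow> finite (block ys j)"
  unfolding block_def using level_subset[of ys j] by (auto intro: finite_subset)

lemma card_block:
  assumes ys: "ys \<in> top_flags" and j: "j < length c"
  shows "card (block ys j) = c ! (length c - 1 - j)"
proof (cases j)
  case 0
  have "drop (length c - 1) c = [c ! (length c - 1)]"
    using c_ne Cons_nth_drop_Suc[of "length c - 1" c] by (cases c) auto
  then show ?thesis using card_level[OF ys j] 0 by (simp add: block_def)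
next
  case (Suc i)
  have "drop (length c - 1 - j) c = c ! (length c - 1 - j) # drop (length c - 1 - i) c"
    using j Suc Cons_nth_drop_Suc[of "length c - 1 - j" c] by (simp add: Suc_diff_Suc)
  moreover have "card (block ys j) = card (level ys j) - card (level ys i)"
    using Suc level_mono[OF ys, of i j] level_subset[OF ys, of i]
    by (auto simp: block_def intro!: card_Diff_subset intro: finite_subset)
  ultimately show ?thesis using card_level[OF ys j] card_level[OF ys, of i] j Suc by simp
qed

lemma UN_block: "ys \<in> top_flags \<Longrightarrow> (\<Union>i\<in>{..j}. block ys i) = level ys j"
proof (induction j)
  case 0
  then show ?case by (simp add: block_def)
next
  case (Suc j)
  then show ?case using level_mono[OF Suc.prems, of j "Suc j"]
    by (auto simp: atMost_Suc block_def)
qed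

text \<open>Sorting the rows puts the least entry of row \<open>i\<close> at its left end and the
  greatest entry of row \<open>Suc i\<close> at its right end, which are the two boxes sharing
  column \<open>\<mu> i\<close>.\<close>

definition fill :: "nat set list \<Rightarrow> box \<Rightarrow> nat"
  where "fill ys = restrict (\<lambda>(i, q). sorted_list_of_set (block ys i) ! (q - \<mu> i)) B"

lemma fill_row:
  assumes ys: "ys \<in> top_flags" and i: "i < length c"
  shows "fill ys ` {x \<in> B. fst x = i} = block ys i"
proof -
  let ?xs = "sorted_list_of_set (block ys i)"
  have len: "length ?xs = \<kappa> i - \<mu> i" using card_block[OF ys i] width[OF i] by simp
  have "fill ys ` {x \<in> B. fst x = i} = (\<lambda>q. ?xs ! (q - \<mu> i)) ` {\<mu> i..<\<kappa> i}"
    unfolding row_eq[OF i] image_image using i by (intro image_cong) (auto simp: fill_def B_iff)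
  also have "\<dots> = (!) ?xs ` {0..<length ?xs}"
  proof -
    have "(\<lambda>q. q - \<mu> i) ` {\<mu> i..<\<kappa> i} = {0..<\<kappa> i - \<mu> i}"
      by (force simp: image_iff intro!: bexI[of _ "_ + \<mu> i"])
    then show ?thesis unfolding len by (metis image_image)
  qed
  also have "\<dots> = block ys i" using nth_image[of "length ?xs" ?xs] finite_block[OF ys] by (simp add: atLeast0LessThan)
  finally show ?thesis .
qed

lemma fill_low:
  assumes ys: "ys \<in> top_flags" and j: "j < length c"
  shows "fill ys ` low j = level ys j"
proof -
  have "low j = (\<Union>i\<in>{..j}. {x \<in> B. fst x = i})" by (auto simp: low_def)
  then have "fill ys ` low j = (\<Union>i\<in>{..j}. fill ys ` {x \<in> B. fst x = i})" by (simp add: image_UN)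
  also have "\<dots> = (\<Union>i\<in>{..j}. block ys i)" using j by (intro SUP_cong) (auto simp: fill_row[OF ys])
  finally show ?thesis using UN_block[OF ys] by simp
qed

lemma fill_tableau:
  assumes ys: "ys \<in> top_flags"
  shows "fill ys \<in> tableaux B n" "flag (fill ys) = ys"
proof -
  have im: "fill ys ` B = {1..n}"
    using fill_low[OF ys, of "length c - 1"] c_ne unfolding low_last by (simp add: level_def)
  then have "inj_on (fill ys) B" using card_B finite_B by (intro eq_card_imp_inj_on) auto
  then show "fill ys \<in> tableaux B n"
    using im by (auto simp: tableaux_def bij_betw_def fill_def)
  show "flag (fill ys) = ys"
    using ys fill_low[OF ys] by (intro nth_equalityI) (auto simp: flag_def level_def nclists_def)
qed

definition increasing :: "(box \<Rightarrow> nat) \<Rightarrow> bool"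
  where "increasing t \<longleftrightarrow> (\<forall>i. Suc i < length c \<longrightarrow> t (i, \<mu> i) < t (Suc i, \<mu> i))"

text \<open>A column may run through more than two rows, the middle ones having a single box; the
  conditions on consecutive rows are chained.\<close>

lemma increasingD:
  assumes inc: "increasing t"
  shows "i < i' \<Longrightarrow> (i, q) \<in> B \<Longrightarrow> (i', q) \<in> B \<Longrightarrow> t (i, q) < t (i', q)"
proof (induction i' rule: less_Suc_induct)
  case (1 i)
  then have "q = \<mu> i" using link[of i] by (auto simp: B_iff)
  then show ?case using inc 1 by (auto simp: increasing_def B_iff)
next
  case (2 i j l)
  \<comment> \<open>Columns have no holes: left and right row ends both weakly decrease
    downwards.\<close>
  have "(j, q) \<in> B"
  proof -
    have jl: "i < j" "j < l" "l < length c" using 2 by (auto simp: B_iff)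
    have "\<mu> j \<le> \<mu> i"
      using \<kappa>_antimono[of i j] link[of "j - 1"] \<mu>_Suc[of "j - 1"] \<kappa>_antimono[of "Suc i" j] link[of i] link[of j]
        \<mu>_less_\<kappa>[of j] jl by simp
    then show ?thesis using 2 \<kappa>_antimono[of j l] jl by (auto simp: B_iff)
  qed
  then show ?case using 2 by auto
qed

text \<open>One pair \<open>a \<le> b\<close> suffices: the upper box of the shared column holds the
  minimum of its row, the lower box the maximum of its row.\<close>

lemma fill_increasing:
  assumes ys: "ys \<in> top_flags"
    and std: "\<And>i. Suc i < length c \<Longrightarrow> \<exists>a\<in>block ys i. \<exists>b\<in>block ys (Suc i). a \<le> b"
  shows "increasing (fill ys)"
  unfolding increasing_def
proof (intro allI impI)
  fix i assume i: "Suc i < length c"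
  obtain a b where ab: "a \<in> block ys i" "b \<in> block ys (Suc i)" "a \<le> b" using std[OF i] by blast
  let ?xs = "\<lambda>i. sorted_list_of_set (block ys i)"
  have xy: "(i, \<mu> i) \<in> B" "(Suc i, \<mu> i) \<in> B"
    using i \<mu>_less_\<kappa>[of i] link[of i] \<mu>_Suc[of i] by (auto simp: B_iff)
  have len: "length (?xs j) = \<kappa> j - \<mu> j" if "j < length c" for j
    using card_block[OF ys that] width[OF that] by simp
  have set: "set (?xs j) = block ys j" for j using finite_block[OF ys] by simp
  obtain p where p: "p < length (?xs i)" "a = ?xs i ! p" using ab(1) set by (metis in_set_conv_nth)
  obtain r where r: "r < length (?xs (Suc i))" "b = ?xs (Suc i) ! r" using ab(2) set by (metis in_set_conv_nth)
  have "fill ys (i, \<mu> i) = ?xs i ! 0" using xy by (simp add: fill_def)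
  also have "\<dots> \<le> a" unfolding p(2) using p(1) by (intro sorted_nth_mono) auto
  finally have 1: "fill ys (i, \<mu> i) \<le> a" .
  have "b \<le> ?xs (Suc i) ! (\<mu> i - \<mu> (Suc i))"
    unfolding r(2) using r(1) len[OF i] link[OF i] \<mu>_Suc[OF i]
    by (intro sorted_nth_mono) auto
  also have "\<dots> = fill ys (Suc i, \<mu> i)" using xy by (simp add: fill_def)
  finally have "fill ys (i, \<mu> i) \<le> fill ys (Suc i, \<mu> i)" using 1 ab(3) by simp
  moreover have "fill ys (i, \<mu> i) \<noteq> fill ys (Suc i, \<mu> i)"
    using inj_onD[OF tableauxD(1)[OF fill_tableau(1)[OF ys]] _ xy] by auto
  ultimately show "fill ys (i, \<mu> i) < fill ys (Suc i, \<mu> i)" by simp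
qed

end

lemma sum_less_if:
  fixes f g :: "'a \<Rightarrow> nat"
  assumes "finite A" "\<And>x. x \<in> A \<Longrightarrow> f x = g x \<or> f x < g x" "x0 \<in> A" "f x0 < g x0"
  shows "sum f A < sum g A"
proof (rule sum_strict_mono_ex1[OF assms(1)])
  show "\<forall>x\<in>A. f x \<le> g x" using assms(2) by fastforce
qed (use assms in blast)

section \<open>Weights and straightening of top cycles\<close>

context border_strip
begin

text \<open>An entry of row \<open>r\<close> is counted \<open>length c - 1 - r\<close> times, so
  the weight grows when larger numbers move up to earlier rows.\<close>

definition weight :: "nat set list \<Rightarrow> nat"
  where "weight ys = (\<Sum>j<length ys. \<Sum>(ys ! j))"

text \<open>Compared column by column: \<open>low j\<close> holds the upper part of a column, whose
  entries are its smallest ones in an increasing tableau, and \<open>\<gamma>\<close> replaces them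
  by equally many entries of the same column.\<close>

lemma column_stabilizer_sum:
  assumes t: "t \<in> tableaux B n" and inc: "increasing t" and \<gamma>: "\<gamma> \<in> column_stabilizer B n t"
    and ne: "\<gamma> ` t ` low j \<noteq> t ` low j"
  shows "\<Sum>(t ` low j) < \<Sum>(\<gamma> ` t ` low j)"
proof -
  note perm = column_stabilizerD(1)[OF \<gamma>] and inj = tableauxD(1)[OF t] and im = tableauxD(2)[OF t]
  \<comment> \<open>The column in which \<open>t\<close> places the number \<open>m\<close>;
    \<open>\<gamma>\<close> preserves it.\<close>
  define col where "col m = snd (inv_into B t m)" for m
  have col_t: "col (t x) = snd x" if "x \<in> B" for x using that inj by (simp add: col_def)
  have col_\<gamma>: "col (\<gamma> m) = col m" if m: "m \<in> {1..n}" for m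
  proof -
    obtain x where x: "x \<in> B" "m = t x" using m im by blast
    then have "\<gamma> m \<in> t ` {y \<in> B. snd y = snd x}"
      using column_stabilizerD(2)[OF \<gamma>, of "snd x"] by blast
    then show ?thesis using x col_t by auto
  qed
  define Z where "Z = t ` low j"
  define Z' where "Z' = \<gamma> ` Z"
  have Zn: "Z \<subseteq> {1..n}" using im low_subset unfolding Z_def by blast
  then have Z'n: "Z' \<subseteq> {1..n}" using permutes_image[OF perm] unfolding Z'_def by blast
  have fin: "finite Z" "finite Z'" using Zn Z'n finite_subset by blast+
  have finB: "finite (snd ` B)" using finite_B by simp
  have colB: "col m \<in> snd ` B" if "m \<in> {1..n}" for m
  proof -
    have "m \<in> t ` B" using that im by blast
    then show ?thesis using col_t by auto
  qed
  have strict: "\<Sum>{m \<in> Z. col m = q} < \<Sum>{m \<in> Z'. col m = q}"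
    if neq: "{m \<in> Z. col m = q} \<noteq> {m \<in> Z'. col m = q}" for q
  proof (rule sum_less_exchange[OF _ _ _ neq])
    show "finite {m \<in> Z. col m = q}" "finite {m \<in> Z'. col m = q}" using fin by auto
    have "{m \<in> Z'. col m = q} = \<gamma> ` {m \<in> Z. col m = q}"
      using col_\<gamma> Zn unfolding Z'_def by fastforce
    then show "card {m \<in> Z. col m = q} = card {m \<in> Z'. col m = q}"
      using permutes_inj[OF perm] by (simp add: card_image inj_on_subset)
  next
    fix a b assume a: "a \<in> {m \<in> Z. col m = q} - {m \<in> Z'. col m = q}"
      and b: "b \<in> {m \<in> Z'. col m = q} - {m \<in> Z. col m = q}"
    from a obtain x where x: "x \<in> low j" "a = t x" "col a = q" by (auto simp: Z_def)
    have "b \<in> t ` B" "col b = q" using b Z'n im by blast+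
    then obtain y where y: "y \<in> B" "b = t y" "col b = q" by blast
    have "y \<notin> low j" using b y by (auto simp: Z_def)
    moreover have "x \<in> B" using x low_subset by blast
    moreover have "snd x = q" "snd y = q" using x y col_t \<open>x \<in> B\<close> by auto
    ultimately show "a < b"
      using x y increasingD[OF inc, of "fst x" "fst y" q] by (cases x; cases y) (auto simp: low_def)
  qed
  have "\<exists>q\<in>snd ` B. {m \<in> Z. col m = q} \<noteq> {m \<in> Z'. col m = q}"
  proof (rule ccontr)
    assume "\<not> ?thesis"
    then have eq: "\<forall>q\<in>snd ` B. {k \<in> Z. col k = q} = {k \<in> Z'. col k = q}" by simp
    have "m \<in> Z \<longleftrightarrow> m \<in> Z'" if "m \<in> {1..n}" for m
    proof -
      have "m \<in> {k \<in> Z. col k = col m} \<longleftrightarrow> m \<in> {k \<in> Z'. col k = col m}"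
        unfolding eq[rule_format, OF colB[OF that]] ..
      then show ?thesis by simp
    qed
    then have "Z = Z'" using Zn Z'n by (metis subset_antisym subset_iff)
    then show False using ne by (simp add: Z_def Z'_def)
  qed
  then obtain q where q: "q \<in> snd ` B" "{m \<in> Z. col m = q} \<noteq> {m \<in> Z'. col m = q}" ..
  have "(\<Sum>q\<in>snd ` B. \<Sum>{m \<in> Z. col m = q}) < (\<Sum>q\<in>snd ` B. \<Sum>{m \<in> Z'. col m = q})"
  proof (rule sum_less_if)
    show "finite (snd ` B)" "q \<in> snd ` B" by (fact finB, fact q(1))
    show "\<Sum>{m \<in> Z. col m = q} < \<Sum>{m \<in> Z'. col m = q}" using q(2) by (rule strict)
    fix r
    show "\<Sum>{m \<in> Z. col m = r} = \<Sum>{m \<in> Z'. col m = r} \<or> \<Sum>{m \<in> Z. col m = r} < \<Sum>{m \<in> Z'. col m = r}"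
      using strict[of r] by (cases "{m \<in> Z. col m = r} = {m \<in> Z'. col m = r}") (simp only: simp_thms, simp)
  qed
  moreover have "(\<Sum>q\<in>snd ` B. \<Sum>{m \<in> A. col m = q}) = \<Sum>A" if A: "A \<subseteq> {1..n}" "finite A" for A
  proof (rule sum.group[OF A(2) finB])
    show "col ` A \<subseteq> snd ` B" using A(1) colB by (auto simp only: subset_iff)
  qed
  ultimately show ?thesis using Zn Z'n fin by (simp add: Z_def Z'_def)
qed

lemma weight_map_flag: "weight (map ((`) \<gamma>) (flag t)) = (\<Sum>j<length c - 1. \<Sum>(\<gamma> ` t ` low j))"
  by (simp add: weight_def flag_def)

lemma weight_flag: "weight (flag t) = (\<Sum>j<length c - 1. \<Sum>(t ` low j))"
  by (simp add: weight_def flag_def)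

text \<open>If no level changed, \<open>\<gamma>\<close> would fix the row of every entry as well as
  its column, hence be the identity. So some level changes, and each changed one gains.\<close>

lemma column_stabilizer_weight:
  assumes t: "t \<in> tableaux B n" and inc: "increasing t" and \<gamma>: "\<gamma> \<in> column_stabilizer B n t"
    and ne: "\<gamma> \<noteq> id"
  shows "weight (flag t) < weight (map ((`) \<gamma>) (flag t))"
proof -
  note perm = column_stabilizerD(1)[OF \<gamma>] and inj = tableauxD(1)[OF t] and im = tableauxD(2)[OF t]
  have "\<exists>j<length c - 1. \<gamma> ` t ` low j \<noteq> t ` low j"
  proof (rule ccontr)
    assume "\<not> ?thesis"
    then have "map ((`) \<gamma>) (flag t) = flag t" by (simp add: flag_def)
    then have eq: "flag (restrict (\<gamma> \<circ> t) B) = flag t" by (simp only: flag_act)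
    have "\<gamma> m = m" for m
    proof (cases "m \<in> {1..n}")
      case True
      then obtain x where x: "x \<in> B" "m = t x" using im by blast
      then have "\<gamma> m \<in> t ` {y \<in> B. snd y = snd x}"
        using column_stabilizerD(2)[OF \<gamma>, of "snd x"] by blast
      then obtain y where y: "y \<in> B" "snd y = snd x" "\<gamma> m = t y" by auto
      have "fst x = fst y"
        by (rule flag_eq_imp_row_eq[OF act_tableaux[OF t perm] t eq x(1) y(1)]) (use x y in simp)
      then have "x = y" using y(2) by (simp add: prod_eq_iff)
      then show ?thesis using x y by simp
    qed (rule permutes_not_in[OF perm])
    then show False using ne by auto
  qed
  then obtain j where "j \<in> {..<length c - 1}" "\<gamma> ` t ` low j \<noteq> t ` low j" by blast
  then show ?thesis
    unfolding weight_map_flag weight_flag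
    using column_stabilizer_sum[OF t inc \<gamma>]
    by (intro sum_less_if[of _ _ _ j] finite_lessThan) metis+
qed

lemma flag_polytabloid_apply:
  "flag_polytabloid t ys
    = (\<Sum>\<gamma>\<in>column_stabilizer B n t. if ys = map ((`) \<gamma>) (flag t) then of_int (sign \<gamma>) else 0)"
  unfolding flag_polytabloid_def sum_apply by (intro sum.cong refl) (simp add: basis_vec_apply)

text \<open>Every other term has a strictly larger weight, so the identity contributes alone and the
  coefficient is \<open>1\<close> in every characteristic.\<close>

lemma flag_polytabloid_leading:
  assumes t: "t \<in> tableaux B n" and inc: "increasing t"
  shows "flag_polytabloid t (flag t) = (1 :: 'k::field)"
proof -
  have "flag_polytabloid t (flag t) = (\<Sum>\<gamma>\<in>{id}.
      if flag t = map ((`) \<gamma>) (flag t) then of_int (sign \<gamma>) else (0 :: 'k))"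
    unfolding flag_polytabloid_apply
  proof (rule sum.mono_neutral_right[OF finite_column_stabilizer])
    show "\<forall>\<gamma>\<in>column_stabilizer B n t - {id}.
        (if flag t = map ((`) \<gamma>) (flag t) then of_int (sign \<gamma>) else (0 :: 'k)) = 0"
    proof
      fix \<gamma> assume "\<gamma> \<in> column_stabilizer B n t - {id}"
      then have "flag t \<noteq> map ((`) \<gamma>) (flag t)"
        using column_stabilizer_weight[OF t inc, of \<gamma>] by (metis DiffE insertI1 less_irrefl)
      then show "(if flag t = map ((`) \<gamma>) (flag t) then of_int (sign \<gamma>) else (0 :: 'k)) = 0"
        by (rule if_not_P)
    qed
  qed (simp add: id_column_stabilizer)
  then show ?thesis by (simp add: map_idI)
qed

lemma flag_polytabloid_support:
  assumes t: "t \<in> tableaux B n" and inc: "increasing t"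
    and ne: "flag_polytabloid t ys \<noteq> (0 :: 'k::field)" "ys \<noteq> flag t"
  shows "weight (flag t) < weight ys"
proof -
  have "\<exists>\<gamma>\<in>column_stabilizer B n t. ys = map ((`) \<gamma>) (flag t)"
  proof (rule ccontr)
    assume "\<not> ?thesis"
    then have "flag_polytabloid t ys = (0 :: 'k)"
      unfolding flag_polytabloid_apply by (intro sum.neutral) simp
    then show False using ne(1) by simp
  qed
  then obtain \<gamma> where \<gamma>: "\<gamma> \<in> column_stabilizer B n t" "ys = map ((`) \<gamma>) (flag t)"
    by blast
  then have "\<gamma> \<noteq> id" using ne(2) by auto
  then show ?thesis using column_stabilizer_weight[OF t inc \<gamma>(1)] \<gamma>(2) by simp
qed

lemma nth_del: "i < length xs \<Longrightarrow> j < length xs - 1 \<Longrightarrow> del i xs ! j = (if j < i then xs ! j else xs ! Suc j)"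
  by (auto simp: del_def nth_append)

text \<open>Sizes in a maximal flag depend only on the position; if the indices differed, the
  smaller one would mark a position where the two faces have sets of different size.\<close>

lemma del_eq_index:
  assumes xs: "xs \<in> top_flags" and ys: "ys \<in> top_flags" and i: "i < length c - 1" and j: "j < length c - 1"
    and eq: "del i xs = del j ys"
  shows "i = j"
proof -
  have len: "length xs = length c - 1" "length ys = length c - 1" using xs ys by (auto simp: nclists_def)
  have T: "sum_list (drop (length c - 1 - l) c) < sum_list (drop (length c - 1 - Suc l) c)"
    if "Suc l < length c - 1" for l
    using tail_sum_less[of "length c - 1 - Suc l" "length c - 1 - l"] that by simp
  have False if "i < j"
  proof -
    have "card (xs ! Suc i) = card (ys ! i)"
      using arg_cong[OF eq, of "\<lambda>zs. card (zs ! i)"] that j len by (simp add: nth_del)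
    then show False
      using card_top_flag[OF xs, of "Suc i"] card_top_flag[OF ys, of i] T[of i] that j by simp
  qed
  moreover have False if "j < i"
  proof -
    have "card (xs ! j) = card (ys ! Suc j)"
      using arg_cong[OF eq, of "\<lambda>zs. card (zs ! j)"] that i len by (simp add: nth_del)
    then show False
      using card_top_flag[OF xs, of j] card_top_flag[OF ys, of "Suc j"] T[of j] that i by simp
  qed
  ultimately show ?thesis by (meson linorder_neqE_nat)
qed

text \<open>The faces of a maximal flag have different size vectors, so nothing cancels between them.\<close>

lemma cycle_face_sum:
  fixes f :: "nat set list \<Rightarrow> 'k::field"
  assumes f: "f \<in> free_space top_flags" "boundary f = 0" and ys: "ys \<in> top_flags" and j: "j < length c - 1"
  shows "(\<Sum>xs | f xs \<noteq> 0 \<and> del j xs = del j ys. f xs) = 0"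
proof -
  have bd: "bd xs (del j ys) = (if del j xs = del j ys then (-1) ^ j else (0 :: 'k))" if xs: "xs \<in> top_flags" for xs
  proof -
    have len: "length xs = length c - 1" using xs by (simp add: nclists_def)
    have "bd xs (del j ys) = (\<Sum>i<length c - 1. (-1) ^ i * (if del j ys = del i xs then 1 else (0 :: 'k)))"
      unfolding bd_def sum_apply len by (simp add: basis_vec_apply)
    also have "\<dots> = (\<Sum>i<length c - 1. if i = j then (if del j xs = del j ys then (-1) ^ j else 0) else (0 :: 'k))"
    proof (intro sum.cong refl)
      fix i assume i: "i \<in> {..<length c - 1}"
      show "(-1) ^ i * (if del j ys = del i xs then 1 else (0 :: 'k))
          = (if i = j then (if del j xs = del j ys then (-1) ^ j else 0) else (0 :: 'k))"
      proof (cases "del j ys = del i xs")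
        case True
        then have "i = j" using del_eq_index[OF xs ys _ j] i by simp
        then show ?thesis using True by simp
      qed auto
    qed
    finally show ?thesis using j by simp
  qed
  have fin: "finite {xs. f xs \<noteq> 0}" using f(1) by (rule free_space_finite)
  have "0 = boundary f (del j ys)" using f(2) by simp
  also have "\<dots> = (\<Sum>xs | f xs \<noteq> 0. f xs * bd xs (del j ys))"
    unfolding boundary_eq lin_ext_def sum_apply by simp
  also have "\<dots> = (\<Sum>xs | f xs \<noteq> 0. (-1) ^ j * (if del j xs = del j ys then f xs else 0))"
    using free_space_support[OF f(1)] by (intro sum.cong) (auto simp: bd)
  also have "\<dots> = (-1) ^ j * (\<Sum>xs | f xs \<noteq> 0 \<and> del j xs = del j ys. f xs)"
    using fin by (simp add: sum_distrib_left[symmetric] sum.inter_filter[symmetric] Collect_conj_eq[symmetric])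
  finally show ?thesis by simp
qed

text \<open>If all of row \<open>Suc j\<close> were smaller than all of row \<open>j\<close>, the
  cycle condition at the \<open>j\<close>-th face would force another flag into the support that
  differs only in its \<open>j\<close>-th set. It trades entries of row \<open>j\<close> for those
  of row \<open>Suc j\<close>, so its weight is smaller.\<close>

lemma minimal_support_standard:
  fixes f :: "nat set list \<Rightarrow> 'k::field"
  assumes f: "f \<in> free_space top_flags" "boundary f = 0" and ys: "f ys \<noteq> 0"
    and min: "\<And>xs. f xs \<noteq> 0 \<Longrightarrow> weight ys \<le> weight xs" and j: "Suc j < length c"
  shows "\<exists>a\<in>block ys j. \<exists>b\<in>block ys (Suc j). a \<le> b"
proof (rule ccontr)
  assume neg: "\<not> ?thesis"
  have j': "j < length c - 1" using j by simp
  have yt: "ys \<in> top_flags" using f(1) ys by (rule free_space_support)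
  have fin: "finite {xs. f xs \<noteq> 0}" using f(1) by (rule free_space_finite)
  have "\<exists>xs. f xs \<noteq> 0 \<and> del j xs = del j ys \<and> xs \<noteq> ys"
  proof (rule ccontr)
    assume "\<not> ?thesis"
    then have "{xs. f xs \<noteq> 0 \<and> del j xs = del j ys} = {ys}" using ys by auto
    then show False using cycle_face_sum[OF f yt j'] ys by simp
  qed
  then obtain xs where xs: "f xs \<noteq> 0" "del j xs = del j ys" "xs \<noteq> ys" by blast
  have xt: "xs \<in> top_flags" using f(1) xs(1) by (rule free_space_support)
  have len: "length xs = length c - 1" "length ys = length c - 1" using xt yt by (auto simp: nclists_def)
  have same: "xs ! i = ys ! i" if "i < length c - 1" "i \<noteq> j" for i
  proof (cases "i < j")
    case True
    then show ?thesis
      using arg_cong[OF xs(2), of "\<lambda>zs. zs ! i"] that j' len by (simp add: nth_del)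
  next
    case False
    then have "i = Suc (i - 1)" "j \<le> i - 1" using that(2) by auto
    then show ?thesis
      using arg_cong[OF xs(2), of "\<lambda>zs. zs ! (i - 1)"] that j' len by (simp add: nth_del)
  qed
  have diff: "xs ! j \<noteq> ys ! j"
  proof
    assume "xs ! j = ys ! j"
    then have "xs ! i = ys ! i" if "i < length xs" for i
      using same[of i] that len by (cases "i = j") simp_all
    then have "xs = ys" using len by (intro nth_equalityI) simp_all
    then show False using xs by simp
  qed
  have lev: "level xs i = level ys i" if "i \<noteq> j" for i
    using same that by (simp add: level_def)
  have levj: "level xs j = xs ! j" "level ys j = ys ! j" using j' by (simp_all add: level_def)
  have "\<Sum>(xs ! j) < \<Sum>(ys ! j)"
  proof (rule sum_less_exchange[OF _ _ _ diff])
    show "finite (xs ! j)" "finite (ys ! j)"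
      using level_subset[OF xt, of j] level_subset[OF yt, of j] levj by (auto intro: finite_subset)
    show "card (xs ! j) = card (ys ! j)"
      using card_top_flag[OF xt j'] card_top_flag[OF yt j'] by simp
    fix a b assume a: "a \<in> xs ! j - ys ! j" and b: "b \<in> ys ! j - xs ! j"
    have "a \<in> level ys (Suc j)" using level_mono[OF xt, of j "Suc j"] lev[of "Suc j"] levj a by auto
    then have "a \<in> block ys (Suc j)" using a levj by (simp add: block_def)
    moreover have "b \<in> block ys j"
      using level_mono[OF xt, of "j - 1" j] lev[of "j - 1"] levj b by (auto simp: block_def)
    ultimately show "a < b" using neg by (auto simp: not_le)
  qed
  then have "weight xs < weight ys"
    unfolding weight_def len using same j'
    by (intro sum_less_if[of _ _ _ j] finite_lessThan) (metis lessThan_iff)+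
  then show False using min[OF xs(1)] by simp
qed

text \<open>The bound at which straightening stops.\<close>

lemma weight_le:
  assumes "ys \<in> top_flags"
  shows "weight ys \<le> (length c - 1) * \<Sum>{1..n}"
proof -
  have len: "length ys = length c - 1" using assms by (simp add: nclists_def)
  have "\<Sum>(ys ! j) \<le> \<Sum>{1..n}" if "j < length c - 1" for j
    using level_subset[OF assms, of j] that by (intro sum_mono2) (auto simp: level_def)
  then have "weight ys \<le> (\<Sum>j<length c - 1. \<Sum>{1..n})"
    unfolding weight_def len by (intro sum_mono) simp
  then show ?thesis by simp
qed

lemma top_cycles_subspace:
  "fun_space.subspace {f \<in> free_space top_flags. boundary f = (0 :: nat set list \<Rightarrow> 'k::field)}"
  unfolding fun_space.subspace_def
proof (intro conjI ballI allI)
  show "(0 :: nat set list \<Rightarrow> 'k) \<in> {f \<in> free_space top_flags. boundary f = 0}"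
    by (simp only: mem_Collect_eq free_space_zero boundary_eq lin_ext_zero simp_thms)
next
  fix f g :: "nat set list \<Rightarrow> 'k"
  assume fg: "f \<in> {f \<in> free_space top_flags. boundary f = 0}" "g \<in> {f \<in> free_space top_flags. boundary f = 0}"
  then have "boundary (f + g) = boundary f + boundary g"
    unfolding boundary_eq by (intro lin_ext_add) (auto intro: free_space_UNIV)
  then show "f + g \<in> {f \<in> free_space top_flags. boundary f = 0}"
    using fg by (simp only: mem_Collect_eq free_space_add add_0)
next
  fix a and f :: "nat set list \<Rightarrow> 'k"
  assume "f \<in> {f \<in> free_space top_flags. boundary f = 0}"
  then show "fscale a f \<in> {f \<in> free_space top_flags. boundary f = 0}"
    by (simp only: mem_Collect_eq free_space_scale boundary_eq lin_ext_scale fun_space.scale_zero_right)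
qed

text \<open>
  Straightening: subtract multiples of polytabloids of standard fillings to push the support of a
  cycle to ever larger weights.
\<close>

lemma straightening:
  fixes f :: "nat set list \<Rightarrow> 'k::field"
  assumes "f \<in> free_space top_flags" "boundary f = 0"
    and "\<And>ys. f ys \<noteq> 0 \<Longrightarrow> (length c - 1) * \<Sum>{1..n} < weight ys + d"
  shows "f \<in> fun_space.span (flag_polytabloid ` tableaux B n)"
  using assms
proof (induction d arbitrary: f)
  case 0
  have "f ys = 0" for ys
    using 0(3)[of ys] weight_le[OF free_space_support[OF 0(1)], of ys] by fastforce
  then have "f = 0" by (simp add: fun_eq_iff)
  then show ?case by (simp only: fun_space.span_zero)
next
  case (Suc d)
  define M where "M = (length c - 1) * \<Sum>{1..n}"
  \<comment> \<open>The layer of least weight that the hypothesis still permits; sums replace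
    subtraction of natural numbers. All its flags are minimal in the support, so their fillings are
    standard.\<close>
  define S where "S = {ys. f ys \<noteq> 0 \<and> weight ys + d = M}"
  define h where "h = (\<Sum>ys\<in>S. fscale (f ys) (flag_polytabloid (fill ys)))"
  let ?Z = "{f \<in> free_space top_flags. boundary f = (0 :: nat set list \<Rightarrow> 'k)}"
  have M: "M \<le> weight ys + d" if "f ys \<noteq> 0" for ys
    using Suc.prems(3)[OF that] by (simp add: M_def)
  have S: "ys \<in> top_flags" "fill ys \<in> tableaux B n" "flag (fill ys) = ys" "increasing (fill ys)"
    if ys: "ys \<in> S" for ys
  proof -
    have y: "f ys \<noteq> 0" "weight ys + d = M" using ys by (auto simp: S_def)
    show yt: "ys \<in> top_flags" using Suc.prems(1) y(1) by (rule free_space_support)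
    show "fill ys \<in> tableaux B n" "flag (fill ys) = ys" using fill_tableau[OF yt] by auto
    show "increasing (fill ys)"
    proof (rule fill_increasing[OF yt], rule minimal_support_standard[OF Suc.prems(1,2) y(1)])
      fix xs assume "f xs \<noteq> 0"
      then show "weight ys \<le> weight xs" using M[of xs] y(2) by simp
    qed
  qed
  have finS: "finite S"
    using free_space_finite[OF Suc.prems(1)] by (rule finite_subset[rotated]) (auto simp: S_def)
  have hspan: "h \<in> fun_space.span (flag_polytabloid ` tableaux B n)"
    unfolding h_def using S(2)
    by (intro fun_space.span_sum fun_space.span_scale fun_space.span_base imageI)
  have "h \<in> ?Z"
    unfolding h_def using S(2) flag_polytabloid_free boundary_flag_polytabloid
    by (intro fun_space.subspace_sum[OF top_cycles_subspace] fun_space.subspace_scale[OF top_cycles_subspace]) blast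
  then have "f - h \<in> ?Z"
    using Suc.prems by (intro fun_space.subspace_diff[OF top_cycles_subspace]) auto
  then have g: "f - h \<in> free_space top_flags" "boundary (f - h) = 0" by auto
  \<comment> \<open>Up to this weight \<open>h\<close> consists only of its leading terms, which
    reproduce the layer \<open>S\<close> of \<open>f\<close>; everything else in \<open>h\<close> is
    heavier.\<close>
  have "(f - h) ys = 0" if le: "weight ys + d \<le> M" for ys
  proof -
    have "h ys = (\<Sum>xs\<in>S. f xs * flag_polytabloid (fill xs) ys)"
      by (simp add: h_def sum_apply)
    also have "\<dots> = (\<Sum>xs\<in>S. if xs = ys then f xs else 0)"
    proof (intro sum.cong refl)
      fix xs assume xs: "xs \<in> S"
      show "f xs * flag_polytabloid (fill xs) ys = (if xs = ys then f xs else 0)"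
      proof (cases "xs = ys")
        case True
        then show ?thesis using flag_polytabloid_leading[OF S(2,4)[OF xs], where 'k = 'k] S(3)[OF xs] by simp
      next
        case False
        have "flag_polytabloid (fill xs) ys = (0 :: 'k)"
        proof (rule ccontr)
          assume "flag_polytabloid (fill xs) ys \<noteq> (0 :: 'k)"
          then have "weight xs < weight ys"
            using flag_polytabloid_support[OF S(2,4)[OF xs], of ys] S(3)[OF xs] False by simp
          then show False using xs le by (simp add: S_def)
        qed
        then show ?thesis using False by simp
      qed
    qed
    also have "\<dots> = (if ys \<in> S then f ys else 0)" using finS by simp
    also have "\<dots> = f ys" using M[of ys] le by (auto simp: S_def)
    finally show ?thesis by simp
  qed
  then have "(length c - 1) * \<Sum>{1..n} < weight ys + d" if "(f - h) ys \<noteq> 0" for ys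
    using that unfolding M_def by (meson not_le)
  then have "f - h \<in> fun_space.span (flag_polytabloid ` tableaux B n)"
    by (rule Suc.IH[OF g])
  then have "(f - h) + h \<in> fun_space.span (flag_polytabloid ` tableaux B n)"
    using hspan by (rule fun_space.span_add)
  then show ?case by (simp only: diff_add_cancel)
qed

lemma top_cycles_eq_span:
  "{f \<in> free_space top_flags. boundary f = (0 :: nat set list \<Rightarrow> 'k::field)}
    = fun_space.span (flag_polytabloid ` tableaux B n)" (is "?Z = _")
proof
  show "fun_space.span (flag_polytabloid ` tableaux B n) \<subseteq> ?Z"
    using flag_polytabloid_free boundary_flag_polytabloid
    by (intro fun_space.span_minimal top_cycles_subspace) blast
  show "?Z \<subseteq> fun_space.span (flag_polytabloid ` tableaux B n)"
    \<comment> \<open>With \<open>d\<close> beyond the bound, the weight condition holds for every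
      flag.\<close>
    by (auto intro: straightening[where d = "Suc ((length c - 1) * \<Sum>{1..n})"])
qed

end

section \<open>The isomorphism\<close>

text \<open>Cosets of \<open>{0}\<close> are singletons, and \<open>the_elem\<close> undoes the
  passage to the quotient.\<close>

lemma gmodule_quot_zero_isomorphic:
  assumes bij: "bij_betw \<phi> V W"
    and add: "\<And>x y. x \<in> V \<Longrightarrow> y \<in> V \<Longrightarrow> \<phi> (x + y) = \<phi> x + \<phi> y"
    and scale: "\<And>a x. x \<in> V \<Longrightarrow> \<phi> (fscale a x) = fscale a (\<phi> x)"
    and act: "\<And>g x. g \<in> carrier G \<Longrightarrow> x \<in> V \<Longrightarrow>
      \<phi> (lin_ext (\<lambda>x. basis_vec (\<alpha> g x)) x) = lin_ext (\<lambda>y. basis_vec (\<beta> g y)) (\<phi> x)"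
  shows "gmodule_isomorphic G (gmodule_quot (perm_gmodule \<alpha> V) {0}) (perm_gmodule \<beta> W)"
proof -
  let ?M = "perm_gmodule \<alpha> V" and ?\<psi> = "\<lambda>C. \<phi> (the_elem C)"
  have coset: "{0} +>\<^bsub>?M\<^esub> x = {x}" for x
    by (simp add: a_r_coset_def' perm_gmodule_def)
  have carrier: "carrier (gmodule_quot ?M {0}) = (\<lambda>x. {x}) ` V"
    unfolding gmodule_quot_def
    by (simp add: A_RCOSETS_def' coset) (auto simp: perm_gmodule_def)
  have "?\<psi> \<in> gmodule_hom G (gmodule_quot ?M {0}) (perm_gmodule \<beta> W)"
    unfolding gmodule_hom_def mem_Collect_eq
  proof (intro conjI allI ballI)
    show "?\<psi> \<in> hom (add_monoid (gmodule_quot ?M {0})) (add_monoid (perm_gmodule \<beta> W))"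
    proof (rule homI)
      fix C assume "C \<in> carrier (add_monoid (gmodule_quot ?M {0}))"
      then obtain x where "x \<in> V" "C = {x}" using carrier by auto
      then show "?\<psi> C \<in> carrier (add_monoid (perm_gmodule \<beta> W))"
        using bij_betwE[OF bij] by (simp add: perm_gmodule_def)
    next
      fix C D assume "C \<in> carrier (add_monoid (gmodule_quot ?M {0}))" "D \<in> carrier (add_monoid (gmodule_quot ?M {0}))"
      then obtain x y where xy: "x \<in> V" "C = {x}" "y \<in> V" "D = {y}" using carrier by auto
      have "C \<otimes>\<^bsub>add_monoid (gmodule_quot ?M {0})\<^esub> D = {x + y}"
        using xy by (simp add: gmodule_quot_def set_add_def' perm_gmodule_def)
      then show "?\<psi> (C \<otimes>\<^bsub>add_monoid (gmodule_quot ?M {0})\<^esub> D)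
          = ?\<psi> C \<otimes>\<^bsub>add_monoid (perm_gmodule \<beta> W)\<^esub> ?\<psi> D"
        using xy add by (simp add: perm_gmodule_def)
    qed
  next
    fix a C assume "C \<in> carrier (gmodule_quot ?M {0})"
    then obtain x where x: "x \<in> V" "C = {x}" using carrier by auto
    have "a \<odot>\<^bsub>gmodule_quot ?M {0}\<^esub> C = {fscale a x}"
      using x by (simp add: gmodule_quot_def coset) (simp add: perm_gmodule_def)
    then show "?\<psi> (a \<odot>\<^bsub>gmodule_quot ?M {0}\<^esub> C) = a \<odot>\<^bsub>perm_gmodule \<beta> W\<^esub> ?\<psi> C"
      using x scale by (simp add: perm_gmodule_def)
  next
    fix g C assume g: "g \<in> carrier G" and "C \<in> carrier (gmodule_quot ?M {0})"
    then obtain x where x: "x \<in> V" "C = {x}" using carrier by auto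
    have "gact (gmodule_quot ?M {0}) g C = {lin_ext (\<lambda>x. basis_vec (\<alpha> g x)) x}"
      using x by (simp add: gmodule_quot_def coset) (simp add: perm_gmodule_def)
    then show "?\<psi> (gact (gmodule_quot ?M {0}) g C) = gact (perm_gmodule \<beta> W) g (?\<psi> C)"
      using x act[OF g] by (simp add: perm_gmodule_def)
  qed
  moreover have "bij_betw ?\<psi> (carrier (gmodule_quot ?M {0})) (carrier (perm_gmodule \<beta> W))"
  proof -
    have "bij_betw the_elem ((\<lambda>x. {x}) ` V) V"
      by (rule bij_betw_byWitness[of _ "\<lambda>x. {x}"]) auto
    then have "bij_betw (\<phi> \<circ> the_elem) ((\<lambda>x. {x}) ` V) W" using bij by (rule bij_betw_trans)
    then show ?thesis unfolding carrier by (simp add: perm_gmodule_def comp_def)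
  qed
  ultimately show ?thesis unfolding gmodule_isomorphic_def by blast
qed

lemma subspace_lin_ext_image:
  assumes V: "fun_space.subspace V" "V \<subseteq> free_space UNIV"
  shows "fun_space.subspace (lin_ext T ` V)"
  unfolding fun_space.subspace_def
proof (intro conjI ballI allI)
  show "0 \<in> lin_ext T ` V"
    using fun_space.subspace_0[OF V(1)] lin_ext_zero by (metis imageI)
next
  fix x y assume "x \<in> lin_ext T ` V" "y \<in> lin_ext T ` V"
  then obtain f g where fg: "f \<in> V" "x = lin_ext T f" "g \<in> V" "y = lin_ext T g" by (elim imageE)
  then have "x + y = lin_ext T (f + g)" using lin_ext_add V(2) by (metis subsetD)
  then show "x + y \<in> lin_ext T ` V"
    using fun_space.subspace_add[OF V(1) fg(1,3)] by (simp only: imageI)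
next
  fix a x assume "x \<in> lin_ext T ` V"
  then obtain f where f: "x = lin_ext T f" "f \<in> V" by (elim imageE)
  show "fscale a x \<in> lin_ext T ` V"
    unfolding f(1) lin_ext_scale[symmetric] using fun_space.subspace_scale[OF V(1) f(2)] by (rule imageI)
qed

text \<open>Members of an increasing list are pairwise comparable, with reflexivity covering the
  diagonal; \<open>m\<close> vertices give dimension \<open>m - 1\<close>.\<close>

lemma simplices_order_complex:
  assumes "\<And>x. x \<in> P \<Longrightarrow> r x x"
  shows "simplices (order_complex P r) r (int m - 1) = nclists P r m"
proof -
  have "r x y \<or> r y x" if "xs \<in> clists P r" "x \<in> set xs" "y \<in> set xs" for x y xs
    using that assms by (induction xs) (auto simp: clists_Cons)
  then show ?thesis
    by (auto simp: simplices_def order_complex_def nclists_def clists_def)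
qed

lemma reduced_homology_top:
  assumes "\<And>x. x \<in> P \<Longrightarrow> r x x" and "nclists P r (Suc m) = {}"
  shows "(reduced_homology (order_complex P r) r \<alpha> (int m - 1) :: ('g, 'k::field, _) gmodule)
    = gmodule_quot (perm_gmodule (\<lambda>g. map (\<alpha> g)) {f \<in> free_space (nclists P r m). boundary f = 0}) {0}"
proof -
  have "(boundaries (order_complex P r) r (int m - 1) :: ('a list \<Rightarrow> 'k) set) = {0}"
  proof -
    have "int m - 1 + 1 = int (Suc m) - 1" by simp
    then have "simplices (order_complex P r) r (int m - 1 + 1) = {}"
      using simplices_order_complex[where P = P and r = r and m = "Suc m", OF assms(1)] assms(2)
      by (simp only:)
    then show ?thesis
      unfolding boundaries_def boundary_eq
      by (simp only: free_space_empty image_insert image_empty lin_ext_zero)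
  qed
  moreover have "simplices (order_complex P r) r (int m - 1) = nclists P r m"
    using assms(1) by (rule simplices_order_complex)
  ultimately show ?thesis
    unfolding reduced_homology_def cycles_def by (simp only:)
qed

lemma specht_module_eq:
  "specht_module B n = perm_gmodule (tabloid_act B) (fun_space.span (polytabloid B n ` tableaux B n))"
  by (simp add: specht_module_def tabloid_gmodule_def perm_gmodule_def)

text \<open>The pointed block is relabelled along with the partition, and injectivity of
  \<open>\<sigma>\<close> means that relabelling neither creates nor removes collapsed
  chains.\<close>

lemma push_act:
  assumes "inj \<sigma>"
  shows "lin_ext (push snd) (basis_vec (map (pp_act \<sigma>) w))
    = lin_ext (\<lambda>ys. basis_vec (map ((`) \<sigma>) ys)) (push snd w :: nat set list \<Rightarrow> 'k::field)"
proof -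
  have snd: "snd (pp_act \<sigma> \<pi>) = \<sigma> ` snd \<pi>" for \<pi> by (simp add: pp_act_def split: prod.split)
  have eq: "map snd (map (pp_act \<sigma>) w) = map ((`) \<sigma>) (map snd w)" by (simp add: snd)
  have dist: "distinct (map ((`) \<sigma>) (map snd w)) \<longleftrightarrow> distinct (map snd w)"
    unfolding distinct_map[of "(`) \<sigma>"] using assms by (auto intro: inj_onI simp: inj_image_eq_iff)
  show ?thesis
    unfolding lin_ext_basis push_def eq dist
    by (cases "distinct (map snd w)") (simp_all only: if_True if_False lin_ext_basis lin_ext_zero)
qed

section \<open>From cycles of flags to the Specht module\<close>

context border_strip
begin

definition to_tabloids :: "(nat set list \<Rightarrow> 'k::field) \<Rightarrow> (box \<Rightarrow> nat) set \<Rightarrow> 'k"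
  where "to_tabloids = lin_ext (\<lambda>ys. basis_vec (flag_tabloid ys))"

text \<open>\<open>fill ys\<close> is a tableau with flag \<open>ys\<close>, so the tabloid is
  nonempty and any member recovers its flag.\<close>

lemma inj_flag_tabloid: "inj_on flag_tabloid top_flags"
proof (rule inj_onI)
  fix ys zs assume "ys \<in> top_flags" "flag_tabloid ys = flag_tabloid zs"
  then show "ys = zs" using fill_tableau[of ys] by (auto simp: flag_tabloid_def)
qed

lemma polytabloid_eq:
  assumes t: "t \<in> tableaux B n"
  shows "polytabloid B n t = (to_tabloids (flag_polytabloid t) :: _ \<Rightarrow> 'k::field)"
proof -
  have "to_tabloids (flag_polytabloid t) = (\<Sum>\<gamma>\<in>column_stabilizer B n t.
      fscale (of_int (sign \<gamma>)) (basis_vec (flag_tabloid (map ((`) \<gamma>) (flag t))) :: _ \<Rightarrow> 'k))"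
    unfolding flag_polytabloid_def to_tabloids_def
    by (subst lin_ext_sum) (simp_all add: lin_ext_scale free_space_scale free_space_basis)
  also have "\<dots> = polytabloid B n t"
    unfolding polytabloid_def
  proof (intro sum.cong refl)
    fix \<gamma> assume "\<gamma> \<in> column_stabilizer B n t"
    then show "fscale (of_int (sign \<gamma>)) (basis_vec (flag_tabloid (map ((`) \<gamma>) (flag t))))
        = (fscale (of_int (sign \<gamma>)) (basis_vec (tabloid_act B \<gamma> (tabloid B n t))) :: _ \<Rightarrow> 'k)"
      by (simp only: tabloid_eq[OF t] flag_tabloid_act column_stabilizerD(1))
  qed
  finally show ?thesis by simp
qed

abbreviation top_cycles :: "(nat set list \<Rightarrow> 'k::field) set"
  where "top_cycles \<equiv> {f \<in> free_space top_flags. boundary f = 0}"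

lemma to_tabloids_add:
  "f \<in> free_space UNIV \<Longrightarrow> g \<in> free_space UNIV \<Longrightarrow> to_tabloids (f + g) = to_tabloids f + to_tabloids g"
  unfolding to_tabloids_def by (rule lin_ext_add)

lemma to_tabloids_scale: "to_tabloids (fscale a f) = fscale a (to_tabloids f)"
  unfolding to_tabloids_def by (rule lin_ext_scale)

lemma to_tabloids_image:
  "to_tabloids ` (top_cycles :: (nat set list \<Rightarrow> 'k::field) set)
    = fun_space.span (polytabloid B n ` tableaux B n)" (is "_ = ?S")
proof
  \<comment> \<open>Additivity of \<open>to_tabloids\<close> is available on finite supports, so the
    span argument runs inside \<open>free_space UNIV\<close>.\<close>
  have "fun_space.subspace {f \<in> free_space UNIV. to_tabloids f \<in> (?S :: (_ \<Rightarrow> 'k) set)}"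
    unfolding fun_space.subspace_def
    by (auto intro: free_space_add free_space_scale fun_space.span_add fun_space.span_scale
        simp only: mem_Collect_eq to_tabloids_add to_tabloids_scale)
      (simp_all only: to_tabloids_def lin_ext_zero fun_space.span_zero free_space_zero)
  moreover have "flag_polytabloid ` tableaux B n \<subseteq> {f \<in> free_space UNIV. to_tabloids f \<in> (?S :: (_ \<Rightarrow> 'k) set)}"
    using polytabloid_eq[symmetric] free_space_UNIV[OF flag_polytabloid_free]
    by (auto intro: fun_space.span_base)
  ultimately have "fun_space.span (flag_polytabloid ` tableaux B n)
      \<subseteq> {f \<in> free_space UNIV. to_tabloids f \<in> (?S :: (_ \<Rightarrow> 'k) set)}"
    by (rule fun_space.span_minimal[rotated])
  then show "to_tabloids ` (top_cycles :: (nat set list \<Rightarrow> 'k) set) \<subseteq> ?S"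
    unfolding top_cycles_eq_span by blast
  show "(?S :: (_ \<Rightarrow> 'k) set) \<subseteq> to_tabloids ` top_cycles"
  proof (rule fun_space.span_minimal)
    show "polytabloid B n ` tableaux B n \<subseteq> to_tabloids ` (top_cycles :: (nat set list \<Rightarrow> 'k) set)"
      using polytabloid_eq flag_polytabloid_free boundary_flag_polytabloid by blast
    show "fun_space.subspace (to_tabloids ` (top_cycles :: (nat set list \<Rightarrow> 'k) set))"
      unfolding to_tabloids_def
      by (rule subspace_lin_ext_image[OF top_cycles_subspace]) (blast intro: free_space_UNIV)
  qed
qed

lemma to_tabloids_bij:
  "bij_betw to_tabloids (top_cycles :: (nat set list \<Rightarrow> 'k::field) set)
    (fun_space.span (polytabloid B n ` tableaux B n))"
  unfolding bij_betw_def
proof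
  show "inj_on to_tabloids (top_cycles :: (nat set list \<Rightarrow> 'k) set)"
  proof (rule inj_onI)
    fix f g :: "nat set list \<Rightarrow> 'k"
    assume f: "f \<in> top_cycles" and g: "g \<in> top_cycles" and eq: "to_tabloids f = to_tabloids g"
    show "f = g"
    proof
      fix ys
      show "f ys = g ys"
      proof (cases "ys \<in> top_flags")
        case True
        have "to_tabloids f (flag_tabloid ys) = f ys" "to_tabloids g (flag_tabloid ys) = g ys"
          unfolding to_tabloids_def using f g True
          by (auto intro!: lin_ext_inj_apply[OF _ inj_flag_tabloid])
        then show ?thesis using eq by simp
      next
        case False
        then have "f ys = 0" "g ys = 0"
          using f g free_space_support[of f top_flags ys] free_space_support[of g top_flags ys] by auto
        then show ?thesis by simp
      qed
    qed
  qed
qed (rule to_tabloids_image)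

lemma to_tabloids_act:
  assumes "\<sigma> permutes {1..n}" "f \<in> free_space UNIV"
  shows "to_tabloids (lin_ext (\<lambda>ys. basis_vec (map ((`) \<sigma>) ys)) f)
    = lin_ext (\<lambda>T. basis_vec (tabloid_act B \<sigma> T)) (to_tabloids f)"
  unfolding to_tabloids_def
  by (simp only: lin_ext_comp[OF assms(2) free_space_basis] UNIV_I lin_ext_basis flag_tabloid_act[OF assms(1)])

theorem homology_isomorphic_specht_module:
  "gmodule_isomorphic (sym_group n)
    (reduced_homology (order_complex (proper_partitions n c) pp_le) pp_le pp_act (int (length c) - 2)
      :: (nat \<Rightarrow> nat, 'k::field, (pointed_partition list \<Rightarrow> 'k) set) gmodule)
    (specht_module B n)"
proof -
  interpret R: chain_retraction "proper_partitions n c" pp_le "proper_subsets n (tail_sums c)" "(\<subseteq>)"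
    snd "flag_partition n"
    by (rule chain_retraction_flags[OF c_sum])
  let ?m = "length c - 1"
  let ?V = "{f \<in> free_space (nclists (proper_partitions n c) pp_le ?m). boundary f = (0 :: pointed_partition list \<Rightarrow> 'k)}"
  let ?\<phi> = "\<lambda>f. to_tabloids (lin_ext (push snd) f) :: _ \<Rightarrow> 'k"
  have top: "nclists (proper_partitions n c) pp_le (Suc ?m) = {}"
    using no_long_chains[OF c_ne] c_ne by simp
  \<comment> \<open>The top chains have \<open>?m\<close> elements. For a single part only the empty
    chain remains, in degree \<open>-1\<close>.\<close>
  have d: "int (length c) - 2 = int ?m - 1" using c_ne by (cases c) auto
  have free: "lin_ext (push snd) f \<in> (free_space UNIV :: (nat set list \<Rightarrow> 'k) set)" if "f \<in> ?V" for f
    by (rule lin_ext_free[of f UNIV]) (use that in \<open>auto intro: free_space_UNIV\<close>)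
  have "gmodule_isomorphic (sym_group n) (gmodule_quot (perm_gmodule (\<lambda>g. map (pp_act g)) ?V) {0})
    (perm_gmodule (tabloid_act B) (fun_space.span (polytabloid B n ` tableaux B n)))"
  proof (rule gmodule_quot_zero_isomorphic[where \<phi> = ?\<phi>])
    have "bij_betw (to_tabloids \<circ> lin_ext (push snd)) ?V
        (fun_space.span (polytabloid B n ` tableaux B n) :: (_ \<Rightarrow> 'k) set)"
      by (rule bij_betw_trans[OF R.push_bij[OF top] to_tabloids_bij])
    then show "bij_betw ?\<phi> ?V (fun_space.span (polytabloid B n ` tableaux B n))"
      by (simp only: comp_def)
  next
    fix f g assume fg: "f \<in> ?V" "g \<in> ?V"
    then have "f \<in> free_space UNIV" "g \<in> free_space UNIV" by (auto intro: free_space_UNIV)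
    then show "?\<phi> (f + g) = ?\<phi> f + ?\<phi> g"
      by (simp only: lin_ext_add to_tabloids_add free[OF fg(1)] free[OF fg(2)])
  next
    fix a f assume "f \<in> ?V"
    show "?\<phi> (fscale a f) = fscale a (?\<phi> f)"
      by (simp only: lin_ext_scale to_tabloids_scale)
  next
    fix \<sigma> f assume \<sigma>: "\<sigma> \<in> carrier (sym_group n)" and f: "f \<in> ?V"
    have perm: "\<sigma> permutes {1..n}" using \<sigma> by (simp add: sym_group_def)
    have fU: "f \<in> free_space UNIV" using f by (auto intro: free_space_UNIV)
    have "lin_ext (push snd) (lin_ext (\<lambda>w. basis_vec (map (pp_act \<sigma>) w)) f)
        = lin_ext (\<lambda>w. lin_ext (\<lambda>ys. basis_vec (map ((`) \<sigma>) ys)) (push snd w)) f"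
      by (simp only: lin_ext_comp[OF fU free_space_basis] UNIV_I push_act[OF permutes_inj[OF perm]])
    also have "\<dots> = lin_ext (\<lambda>ys. basis_vec (map ((`) \<sigma>) ys)) (lin_ext (push snd) f :: _ \<Rightarrow> 'k)"
      by (rule lin_ext_comp[OF fU push_free_UNIV, symmetric])
    finally show "?\<phi> (lin_ext (\<lambda>w. basis_vec (map (pp_act \<sigma>) w)) f)
        = lin_ext (\<lambda>T. basis_vec (tabloid_act B \<sigma> T)) (?\<phi> f)"
      by (simp only: to_tabloids_act[OF perm free[OF f]])
  qed
  then show ?thesis
    unfolding d reduced_homology_top[OF pp_le_refl top] specht_module_eq .
qed

end

theorem theorem7p4:
  fixes n :: nat and c :: "nat list" and B :: "box set"
  assumes "pointed_composition n c"
    and "last c > 0"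
    and "border_strip_of c B"
  shows "gmodule_isomorphic (sym_group n)
    (reduced_homology (order_complex (restricted_partitions n c - {pp_top n}) pp_le) pp_le pp_act
        (int (length c) - 2)
      :: (nat \<Rightarrow> nat, 'k::field, (pointed_partition list \<Rightarrow> 'k) set) gmodule)
    (specht_module B n)"
proof -
  have c: "c \<noteq> []" "sum_list c = n" "\<forall>x\<in>set (butlast c). 1 \<le> x"
    using assms(1) by (simp_all add: pointed_composition_def)
  \<comment> \<open>A positive last part makes all parts positive, so that every row of the strip is
    nonempty and the tail sums are distinct.\<close>
  have "1 \<le> x" if "x \<in> set c" for x
  proof -
    have "x \<in> set (butlast c) \<or> x = last c"
      using that append_butlast_last_id[OF c(1)] by (metis Un_iff empty_iff empty_set set_ConsD set_append)
    then show ?thesis using c(3) assms(2) by auto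
  qed
  then obtain \<mu> \<kappa> where "border_strip n c B \<mu> \<kappa>"
    using border_strip_of_imp[OF assms(3) c(1) _ c(2)] by blast
  then show ?thesis
    using border_strip.homology_isomorphic_specht_module unfolding proper_partitions_def by blast
qed

end
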